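(* Let $m\in\mathbb{Z}$ and suppose that $p^2\nmid m^4+5m^3+15m^2+25m+25$ for every prime $p\neq 5$. Let $\mathbb{H}_m$ be the quintic field generated over $\mathbb{Q}$ by a root of $$h_m(x)=x^5+m^2x^4-(2m^3+6m^2+10m+10)x^3+(m^4+5m^3+11m^2+15m+5)x^2+(m^3+4m^2+10m+10)x+1.$$ Then $$I(\mathbb{H}_m)=1$$ and $$i(\mathbb{H}_m)=\begin{cases}5&\text{if } m\equiv 2\pmod 5,\\ 1&\text{otherwise.}\end{cases}$$
   Context: For a number field $\mathbb{K}$ of degree $n$ over $\mathbb{Q}$ with ring of integers $\mathbb{A}$, let $\widehat{\mathbb{A}}$ be the set of $\theta\in\mathbb{A}$ that are primitive over $\mathbb{Q}$, i.e. $\mathbb{K}=\mathbb{Q}(\theta)$. For $\theta\in\widehat{\mathbb{A}}$ let $I(\theta)=[\mathbb{A}:\mathbb{Z}[\theta]]$ and define $I(\mathbb{K})=\gcd_{\theta\in\widehat{\mathbb{A}}} I(\theta)$. For $\theta\in\mathbb{A}$ let $F_\theta(x)\in\mathbb{Z}[x]$ be the (degree $n$) characteristic polynomial of $\theta$ over $\mathbb{Q}$ and set $i(\theta)=\gcd_{x\in\mathbb{Z}}F_\theta(x)$. Define $i(\mathbb{K})=\operatorname{lcm}_{\theta\in\widehat{\mathbb{A}}}\, i(\theta)$. *)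

theory Defs
  imports
    "HOL-Number_Theory.Cong"
    "HOL-Algebra.Generated_Fields"
    "HOL-Algebra.Algebraic_Closure_Type"
    "Jordan_Normal_Form.Char_Poly"
begin

hide_const (open) Divisibility.prime  (* so that prime is the type-class notion *)

text \<open>
  Number fields are taken inside the complex numbers: a field is its carrier set
  \<open>K :: complex set\<close>, and \<open>\<rat>(\<theta>)\<close>, \<open>\<int>[\<theta>]\<close> are the subfield and the (unital) subring
  of \<open>\<complex>\<close> generated by \<open>\<theta>\<close>.
\<close>

abbreviation complex_field :: "complex ring" where
  "complex_field \<equiv> ring_of_type_algebra"

definition Q_adjoin :: "complex \<Rightarrow> complex set" where
  "Q_adjoin \<theta> = generate_field complex_field {\<theta>}"

definition Z_adjoin :: "complex \<Rightarrow> complex set" where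
  "Z_adjoin \<theta> = generate_ring complex_field {\<theta>}"

definition ring_of_integers :: "complex set \<Rightarrow> complex set" where
  "ring_of_integers K = {\<theta> \<in> K. algebraic_int \<theta>}"

definition primitive_integers :: "complex set \<Rightarrow> complex set" where
  "primitive_integers K = {\<theta> \<in> ring_of_integers K. Q_adjoin \<theta> = K}"


text \<open>
  The index of \<open>\<int>[\<theta>]\<close> in the ring of integers, as the number of cosets of additive groups.
  \<^const>\<open>card\<close> would yield \<open>0\<close> for an infinite index, but the index is finite whenever
  \<open>\<theta>\<close> is a primitive integer of a number field.
\<close>

definition elem_index :: "complex set \<Rightarrow> complex \<Rightarrow> nat" where
  "elem_index K \<theta> =
     card (ring_of_integers K //
       {(x, y). x \<in> ring_of_integers K \<and> y \<in> ring_of_integers K \<and> x - y \<in> Z_adjoin \<theta>})"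

definition field_index :: "complex set \<Rightarrow> nat" where
  "field_index K = Gcd (elem_index K ` primitive_integers K)"


global_interpretation rat_vs: vector_space "\<lambda>(q :: rat) (z :: complex). of_rat q * z"
  by unfold_locales (simp_all add: algebra_simps of_rat_add of_rat_mult)

definition is_Q_basis :: "complex list \<Rightarrow> complex set \<Rightarrow> bool" where
  "is_Q_basis bs K \<longleftrightarrow>
     distinct bs \<and> rat_vs.independent (set bs) \<and> rat_vs.span (set bs) = K"

text \<open>\<open>M\<close> is the matrix of the map \<open>x \<mapsto> \<theta> x\<close> with respect to the ordered basis \<open>bs\<close>.\<close>

definition is_mult_matrix :: "complex list \<Rightarrow> complex \<Rightarrow> rat mat \<Rightarrow> bool" where
  "is_mult_matrix bs \<theta> M \<longleftrightarrow>
     M \<in> carrier_mat (length bs) (length bs) \<and>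
     (\<forall>j < length bs. \<theta> * bs ! j = (\<Sum>i < length bs. of_rat (M $$ (i, j)) * bs ! i))"

text \<open>
  The characteristic polynomial over \<open>\<rat>\<close> of multiplication by \<open>\<theta>\<close> on \<open>K\<close>, as an integer
  polynomial. It does not depend on the basis, and for \<open>\<theta>\<close> in the ring of integers of a number
  field \<open>K\<close> its coefficients are integers, so the description is then proper.
\<close>

definition field_char_poly :: "complex set \<Rightarrow> complex \<Rightarrow> int poly" where
  "field_char_poly K \<theta> =
     (THE F. \<exists>bs M. is_Q_basis bs K \<and> is_mult_matrix bs \<theta> M \<and>
        map_poly rat_of_int F = char_poly M)"

definition elem_value_gcd :: "complex set \<Rightarrow> complex \<Rightarrow> int" where
  "elem_value_gcd K \<theta> = Gcd (range (\<lambda>x :: int. poly (field_char_poly K \<theta>) x))"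

definition field_value_lcm :: "complex set \<Rightarrow> int" where
  "field_value_lcm K = Lcm (elem_value_gcd K ` primitive_integers K)"


definition h_poly :: "int \<Rightarrow> int poly" where
  "h_poly m =
     [: 1,
        m ^ 3 + 4 * m ^ 2 + 10 * m + 10,
        m ^ 4 + 5 * m ^ 3 + 11 * m ^ 2 + 15 * m + 5,
        - (2 * m ^ 3 + 6 * m ^ 2 + 10 * m + 10),
        m ^ 2,
        1 :]"

end

(*
  Fix a prime q. If x is integral and q x = g(\<theta>), then the monic equation of x shows that a
  power of g lies in the ideal (F, q) of \<int>[X], where F is the minimal polynomial of \<theta>. So q does
  not divide the index of \<theta> when F is squarefree modulo q, and likewise when F is Eisenstein at
  q. Write d = m^3 + 5 m^2 + 10 m + 7 and D = m^4 + 5 m^3 + 15 m^2 + 25 m + 25. The root \<rho>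
  serves for the primes not dividing d D, since d^2 D lies in (h, h'); 5 \<rho> + m^2 is Eisenstein
  at the primes q \<noteq> 5 dividing D, and \<rho> + 1 at q = 5. For the primes dividing d take w + \<rho> +
  \<rho>^2, where w is the integral element with denominator d of the basis of Gaal and Pohst: its
  index is a unit modulo d.

  A common divisor of the values of a monic quintic polynomial divides 5! = 120. The primes 2
  and 3 are inert, so a norm divisible by p forces the element to be divisible by p, which
  cannot happen for both y and 1 - y. The same holds for p = 5 unless m is 0 or 2 modulo 5. If 5
  divides m, then 5 is totally ramified, and if m = 2 modulo 5, then the characteristic
  polynomial of w + \<rho> + \<rho>^2 is congruent to X^5 - X.
*)
theory Submission
  imports Defs "HOL-Algebra.Sylow"
begin

text \<open>Everything runs on Bezout relations between integer polynomials and on divisibility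
  among algebraic integers; ideals of the ring of integers do not occur. What is proved at a prime
  \<open>q\<close> is that no integer of the field has order \<open>q\<close> modulo
  \<int>[\<theta>]. This says something about the index only once the index is known to be finite,
  because \<open>card\<close> of an infinite quotient is 0 and every prime divides 0. Finiteness
  comes from the nondegenerate trace form. The primes dividing d force an element of a new kind: w
  has order |d| modulo \<int>[\<rho>], so d divides the index of \<rho> and that of a \<rho> + b for
  all integers a \<noteq> 0 and b. The prime 5 is among them exactly if m = 2 modulo 5. In that case
  5 splits completely, which \<rho> cannot show: its polynomial is (X - 1) (X^4 - 1) modulo 5, with
  a double root at 1 and none at 0. So the same new element settles the index at d and the value
  5.\<close>

section \<open>Sums and products of algebraic integers\<close>

text \<open>A family \<open>b\<close> rather than a set of generators, since the monomials
  \<open>x ^ i * y ^ j\<close> used below may coincide.\<close>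

definition int_span :: "'i set \<Rightarrow> ('i \<Rightarrow> complex) \<Rightarrow> complex set" where
  "int_span I b = range (\<lambda>c. \<Sum>i\<in>I. of_int (c i) * b i)"

lemma int_span_0: "0 \<in> int_span I b"
  unfolding int_span_def by (rule range_eqI[of _ _ "\<lambda>_. 0"]) simp

lemma int_span_add: "x \<in> int_span I b \<Longrightarrow> y \<in> int_span I b \<Longrightarrow> x + y \<in> int_span I b"
proof -
  assume "x \<in> int_span I b" "y \<in> int_span I b"
  then obtain c c' where "x = (\<Sum>i\<in>I. of_int (c i) * b i)" "y = (\<Sum>i\<in>I. of_int (c' i) * b i)"
    unfolding int_span_def by auto
  then have "x + y = (\<Sum>i\<in>I. of_int (c i + c' i) * b i)"
    by (simp add: distrib_right sum.distrib)
  then show ?thesis unfolding int_span_def by (intro range_eqI[of _ _ "\<lambda>i. c i + c' i"])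
qed

lemma int_span_scale: "x \<in> int_span I b \<Longrightarrow> of_int k * x \<in> int_span I b"
proof -
  assume "x \<in> int_span I b"
  then obtain c where "x = (\<Sum>i\<in>I. of_int (c i) * b i)"
    unfolding int_span_def by auto
  then have "of_int k * x = (\<Sum>i\<in>I. of_int (k * c i) * b i)"
    by (simp add: sum_distrib_left mult.assoc)
  then show ?thesis unfolding int_span_def by (intro range_eqI[of _ _ "\<lambda>i. k * c i"])
qed

lemma int_span_sum:
  "(\<And>j. j \<in> J \<Longrightarrow> f j \<in> int_span I b) \<Longrightarrow> sum f J \<in> int_span I b"
  by (induction J rule: infinite_finite_induct) (auto intro: int_span_0 int_span_add)

lemma int_span_base: "finite I \<Longrightarrow> i \<in> I \<Longrightarrow> b i \<in> int_span I b"
  unfolding int_span_def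
  by (rule range_eqI[of _ _ "\<lambda>j. if j = i then 1 else 0"])
     (simp add: if_distrib[of of_int] if_distrib[of "\<lambda>x. x * _"] cong: if_cong)

lemma int_span_mult_closed:
  assumes "\<And>i. i \<in> I \<Longrightarrow> z * b i \<in> int_span I b" and "x \<in> int_span I b"
  shows "z * x \<in> int_span I b"
proof -
  from assms(2) obtain c where x: "x = (\<Sum>i\<in>I. of_int (c i) * b i)"
    unfolding int_span_def by auto
  have "z * x = (\<Sum>i\<in>I. of_int (c i) * (z * b i))"
    by (simp add: x sum_distrib_left mult_ac)
  then show ?thesis using assms(1) by (auto intro!: int_span_sum int_span_scale)
qed

text \<open>The determinant trick: the vector of generators is an eigenvector, with eigenvalue
  \<open>z\<close>, of an integer matrix, whose characteristic polynomial is monic and integral. The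
  generator \<open>b k\<close> keeps that vector from being zero.\<close>

lemma algebraic_int_if_int_span:
  assumes I: "finite I" and k: "k \<in> I" "b k \<noteq> 0"
    and closed: "\<And>i. i \<in> I \<Longrightarrow> z * b i \<in> int_span I b"
  shows "algebraic_int z"
proof -
  define n where "n = card I"
  obtain h where h: "bij_betw h {0..<n} I"
    using ex_bij_betw_nat_finite[OF I] n_def by auto
  have "\<forall>i. \<exists>c. i \<in> I \<longrightarrow> z * b i = (\<Sum>j\<in>I. of_int (c j) * b j)"
    using closed unfolding int_span_def by blast
  then obtain c where c: "\<And>i. i \<in> I \<Longrightarrow> z * b i = (\<Sum>j\<in>I. of_int (c i j) * b j)"
    by metis
  define M where "M = mat n n (\<lambda>(i, j). c (h i) (h j))"
  define v where "v = vec n (\<lambda>i. b (h i))"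
  have M: "M \<in> carrier_mat n n" by (simp add: M_def)
  have MC: "map_mat (of_int :: int \<Rightarrow> complex) M \<in> carrier_mat n n" using M by simp
  have hI: "i < n \<Longrightarrow> h i \<in> I" for i using h by (auto simp: bij_betw_def)
  have "eigenvector (map_mat of_int M) v z"
    unfolding eigenvector_def
  proof (intro conjI)
    show "v \<in> carrier_vec (dim_row (map_mat of_int M))" by (simp add: v_def M_def)
    obtain i where i: "i < n" "h i = k"
      using h k by (auto simp: bij_betw_def)
    then show "v \<noteq> 0\<^sub>v (dim_row (map_mat of_int M))"
      using k by (auto simp: v_def M_def vec_eq_iff)
    show "map_mat of_int M *\<^sub>v v = z \<cdot>\<^sub>v v"
    proof (rule eq_vecI)
      fix i assume "i < dim_vec (z \<cdot>\<^sub>v v)"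
      then have i: "i < n" by (simp add: v_def)
      have "(map_mat of_int M *\<^sub>v v) $ i = (\<Sum>j = 0..<n. of_int (c (h i) (h j)) * b (h j))"
        using i by (simp add: scalar_prod_def M_def v_def)
      also have "\<dots> = (\<Sum>j\<in>I. of_int (c (h i) j) * b j)"
        by (rule sum.reindex_bij_betw[OF h])
      also have "\<dots> = z * b (h i)" using c[OF hI[OF i]] by simp
      finally show "(map_mat of_int M *\<^sub>v v) $ i = (z \<cdot>\<^sub>v v) $ i"
        using i by (simp add: v_def)
    qed (simp add: v_def M_def)
  qed
  then have "poly (char_poly (map_mat of_int M)) z = 0"
    using eigenvalue_root_char_poly[OF MC] by (auto simp: eigenvalue_def)
  then have "poly (map_poly of_int (char_poly M)) z = 0"
    by (simp add: of_int_hom.char_poly_hom[OF M])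
  then show ?thesis
    unfolding algebraic_int_altdef_ipoly using degree_monic_char_poly[OF M] by auto
qed

lemma algebraic_int_power_reduce:
  assumes "algebraic_int (x :: complex)"
  obtains n a where "0 < n" "x ^ n = (\<Sum>i<n. of_int (a i) * x ^ i)"
proof -
  obtain p :: "int poly" where p: "poly (map_poly of_int p) x = 0" "lead_coeff p = 1"
    using assms unfolding algebraic_int_altdef_ipoly by blast
  have "degree p > 0"
  proof (rule ccontr)
    assume "\<not> degree p > 0"
    then obtain a where "p = [:a:]" using degree_eq_zeroE by blast
    then show False using p by simp
  qed
  moreover have "x ^ degree p = (\<Sum>i<degree p. of_int (- coeff p i) * x ^ i)"
  proof -
    have "0 = (\<Sum>i\<le>degree p. of_int (coeff p i) * x ^ i)"
      using p by (simp add: poly_altdef coeff_map_poly degree_map_poly)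
    also have "\<dots> = (\<Sum>i<degree p. of_int (coeff p i) * x ^ i) + x ^ degree p"
      using p by (simp add: lessThan_Suc_atMost[symmetric])
    finally have "x ^ degree p = - (\<Sum>i<degree p. of_int (coeff p i) * x ^ i)"
      by (intro minus_unique[symmetric]) (rule sym)
    then show ?thesis by (simp add: sum_negf)
  qed
  ultimately show thesis by (rule that)
qed

text \<open>The monomials below the degrees of monic relations of \<open>x\<close> and
  \<open>y\<close> span \<int>[x, y], which is stable under multiplication by \<open>x\<close> and
  by \<open>y\<close>, hence by their sum and product.\<close>

lemma
  assumes x: "algebraic_int x" and y: "algebraic_int y"
  shows algebraic_int_add [intro]: "algebraic_int (x + y :: complex)"
    and algebraic_int_mult [intro]: "algebraic_int (x * y :: complex)"
proof -
  obtain n a where n: "0 < n" "x ^ n = (\<Sum>i<n. of_int (a i) * x ^ i)"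
    using algebraic_int_power_reduce[OF x] .
  obtain k c where k: "0 < k" "y ^ k = (\<Sum>i<k. of_int (c i) * y ^ i)"
    using algebraic_int_power_reduce[OF y] .
  define I where "I = {..<n} \<times> {..<k}"
  define b where "b = (\<lambda>(i :: nat, j :: nat). x ^ i * y ^ j)"
  have I: "finite I" by (simp add: I_def)
  have base: "x ^ i * y ^ j \<in> int_span I b" if "i < n" "j < k" for i j
    using int_span_base[OF I, of "(i, j)" b] that by (simp add: I_def b_def)
  have X: "x * b i \<in> int_span I b" if "i \<in> I" for i
  proof (cases i)
    case (Pair i j)
    then have ij: "i < n" "j < k" using that by (auto simp: I_def)
    show ?thesis
    proof (cases "Suc i < n")
      case True
      then show ?thesis using base[of "Suc i" j] ij Pair by (simp add: b_def mult_ac)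
    next
      case False
      then have "Suc i = n" using ij by simp
      then have "x * b (i, j) = x ^ n * y ^ j" by (auto simp: b_def)
      also have "\<dots> = (\<Sum>i<n. of_int (a i) * (x ^ i * y ^ j))"
        by (simp add: n(2) sum_distrib_right mult.assoc)
      also have "\<dots> \<in> int_span I b"
        using base ij by (auto intro!: int_span_sum int_span_scale)
      finally show ?thesis using Pair by simp
    qed
  qed
  have Y: "y * b i \<in> int_span I b" if "i \<in> I" for i
  proof (cases i)
    case (Pair i j)
    then have ij: "i < n" "j < k" using that by (auto simp: I_def)
    show ?thesis
    proof (cases "Suc j < k")
      case True
      then show ?thesis using base[of i "Suc j"] ij Pair by (simp add: b_def mult_ac)
    next
      case False
      then have "Suc j = k" using ij by simp
      then have "y * b (i, j) = x ^ i * y ^ k" by (auto simp: b_def)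
      also have "\<dots> = (\<Sum>j<k. of_int (c j) * (x ^ i * y ^ j))"
        by (simp add: k(2) sum_distrib_left mult_ac)
      also have "\<dots> \<in> int_span I b"
        using base ij by (auto intro!: int_span_sum int_span_scale)
      finally show ?thesis using Pair by simp
    qed
  qed
  have 0: "(0, 0) \<in> I" "b (0, 0) \<noteq> 0" using n k by (auto simp: I_def b_def)
  show "algebraic_int (x + y)"
    by (rule algebraic_int_if_int_span[where b = b and k = "(0, 0)", OF I 0])
       (auto simp: distrib_right intro!: int_span_add X Y)
  show "algebraic_int (x * y)"
    by (rule algebraic_int_if_int_span[where b = b and k = "(0, 0)", OF I 0])
       (auto simp: mult.assoc intro!: int_span_mult_closed[of I x] X Y)
qed

lemma algebraic_int_diff [intro]:
  "algebraic_int x \<Longrightarrow> algebraic_int y \<Longrightarrow> algebraic_int (x - y :: complex)"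
  using algebraic_int_add[of x "- y"] by auto

lemma algebraic_int_power [intro]: "algebraic_int x \<Longrightarrow> algebraic_int (x ^ k :: complex)"
  by (induction k) auto

lemma algebraic_int_of_int [simp, intro]: "algebraic_int (of_int k)"
  by (rule int_imp_algebraic_int) auto

text \<open>A rational algebraic integer is an integer. Divisibility among algebraic integers thus
  descends to \<int>, which is how most contradictions below arise.\<close>

lemma algebraic_int_dvd:
  assumes "algebraic_int z" "of_int a = of_int b * (z :: complex)"
  shows "b dvd a"
proof (cases "b = 0")
  case False
  then have "z = of_rat (of_int a / of_int b)" using assms(2)
    by (simp add: of_rat_divide field_simps)
  then have "z \<in> \<int>" using assms(1) by (intro rational_algebraic_int_is_int) auto
  then obtain k where "z = of_int k" by (auto elim: Ints_cases)
  then have "a = b * k" using assms(2) by (metis of_int_eq_iff of_int_mult)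
  then show ?thesis by simp
qed (use assms in auto)

section \<open>Integer polynomials modulo a prime\<close>

text \<open>The scaling factor of pseudo-division is a power of the leading coefficient, here
  1.\<close>

lemma monic_division:
  fixes f e :: "int poly"
  assumes "lead_coeff e = 1"
  obtains s r where "f = e * s + r" "r = 0 \<or> degree r < degree e"
proof -
  obtain s r where sr: "pseudo_divmod f e = (s, r)" by fastforce
  have "e \<noteq> 0" using assms by auto
  from pseudo_divmod[OF this sr] show thesis using assms that by simp
qed

lemma monic_quotient:
  fixes F e s r :: "int poly"
  assumes F: "F = e * s + r" "lead_coeff F = 1" and e: "lead_coeff e = 1"
    and r: "r = 0 \<or> degree r < degree e" and deg: "degree e < degree F"
  shows "lead_coeff s = 1" "degree F = degree e + degree s"
proof -
  have e0: "e \<noteq> 0" using e by auto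
  have s0: "s \<noteq> 0" using F r deg by auto
  have es: "degree (e * s) = degree e + degree s" using e0 s0 by (simp add: degree_mult_eq)
  have "coeff r (degree e + degree s) = 0" using r by (auto intro: coeff_eq_0)
  then have "coeff F (degree e + degree s) = lead_coeff s"
    using e by (simp add: F(1) coeff_mult_degree_sum)
  moreover show "degree F = degree e + degree s"
  proof (cases "r = 0")
    case False
    then have "degree r < degree (e * s)" using r es by simp
    then show ?thesis using es by (simp add: F(1) degree_add_eq_left)
  qed (simp add: F(1) es)
  ultimately show "lead_coeff s = 1" using F(2) by simp
qed

text \<open>Leading terms divisible by \<open>p\<close> are deleted, so that \<open>degree g\<close>
  is the degree of \<open>f\<close> modulo \<open>p\<close>; this stops because \<open>f\<close> is
  nonzero modulo \<open>p\<close>.\<close>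

lemma reduce_mod_prime_lead:
  fixes f :: "int poly"
  assumes "\<not> [:p:] dvd f"
  obtains g where "[:p:] dvd f - g" "\<not> p dvd lead_coeff g" "degree g \<le> degree f"
proof -
  have "\<exists>g. [:p:] dvd f - g \<and> \<not> p dvd lead_coeff g \<and> degree g \<le> degree f"
    using assms
  proof (induction "degree f" arbitrary: f rule: less_induct)
    case less
    show ?case
    proof (cases "p dvd lead_coeff f")
      case False
      then show ?thesis by (intro exI[of _ f]) auto
    next
      case True
      define f' where "f' = f - monom (lead_coeff f) (degree f)"
      have m: "[:p:] dvd monom (lead_coeff f) (degree f)"
        using True by (simp add: const_poly_dvd_iff)
      have f': "\<not> [:p:] dvd f'"
      proof
        assume "[:p:] dvd f'"
        then have "[:p:] dvd f' + monom (lead_coeff f) (degree f)" using m by (rule dvd_add)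
        then show False using less.prems by (simp add: f'_def)
      qed
      have "degree f' \<le> degree f"
        unfolding f'_def by (intro degree_diff_le) (auto simp: degree_monom_le)
      moreover have "coeff f' (degree f) = 0" by (simp add: f'_def)
      moreover have "f' \<noteq> 0" using f' by auto
      ultimately have lt: "degree f' < degree f"
        by (metis le_neq_implies_less leading_coeff_0_iff)
      obtain g where g: "[:p:] dvd f' - g" "\<not> p dvd lead_coeff g" "degree g \<le> degree f'"
        using less.hyps[OF lt f'] by blast
      have "f - g = (f' - g) + monom (lead_coeff f) (degree f)" by (simp add: f'_def)
      then have "[:p:] dvd f - g" using g m by (metis dvd_add)
      then show ?thesis using g lt by (intro exI[of _ g]) auto
    qed
  qed
  then show thesis using that by blast
qed

text \<open>The image of \<open>J\<close> in \<open>\<int>/p[X]\<close> is a principal ideal; \<open>e\<close> lifts its monic generator.\<close>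

lemma ideal_mod_prime_generator:
  fixes J :: "int poly set"
  assumes p: "prime p" and add: "\<And>f g. f \<in> J \<Longrightarrow> g \<in> J \<Longrightarrow> f + g \<in> J"
    and mult: "\<And>f g. g \<in> J \<Longrightarrow> f * g \<in> J" and pJ: "[:p:] \<in> J"
    and f0: "f0 \<in> J" "\<not> [:p:] dvd f0"
  obtains e where "e \<in> J" "lead_coeff e = 1" "degree e \<le> degree f0"
    "\<forall>g\<in>J. g = 0 \<or> degree g < degree e \<longrightarrow> [:p:] dvd g"
proof -
  define P where "P = (\<lambda>n. \<exists>g\<in>J. degree g = n \<and> \<not> p dvd lead_coeff g)"
  have red: "\<exists>n \<le> degree f. P n" if f: "f \<in> J" "\<not> [:p:] dvd f" for f
  proof -
    obtain g where g: "[:p:] dvd f - g" "\<not> p dvd lead_coeff g" "degree g \<le> degree f"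
      using reduce_mod_prime_lead[OF f(2)] .
    obtain c where "f - g = [:p:] * c" using g(1) by (auto elim: dvdE)
    then have "g = f + (- c) * [:p:]" by (simp add: algebra_simps)
    then have "g \<in> J" by (metis add f(1) mult pJ)
    then show ?thesis using g unfolding P_def by blast
  qed
  define n where "n = (LEAST n. P n)"
  have "\<exists>n. P n" using red[OF f0] by blast
  then have "P n" unfolding n_def by (auto intro: LeastI)
  then obtain g where g: "g \<in> J" "degree g = n" "\<not> p dvd lead_coeff g"
    unfolding P_def by blast
  have "coprime p (lead_coeff g)" using p g(3) by (intro prime_imp_coprime) auto
  then obtain a b where ab: "a * lead_coeff g + b * p = 1"
    by (metis bezout_int coprime_iff_gcd_eq_1 gcd.commute mult.commute)
  \<comment> \<open>\<open>a\<close> inverts the leading coefficient of \<open>g\<close> modulo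
    \<open>p\<close>; adding \<open>b * p\<close> in degree \<open>n\<close> makes the leading
    coefficient exactly 1 without changing the class modulo \<open>p\<close>.\<close>
  define e where "e = smult a g + [:p:] * monom b n"
  have "degree e \<le> n" unfolding e_def
    using g(2) by (intro degree_add_le) (auto intro: order.trans[OF degree_smult_le] simp: degree_monom_le mult_monom[of _ 0, simplified monom_0])
  moreover have "coeff e n = 1" using g(2) ab by (simp add: e_def algebra_simps)
  moreover from this have "n \<le> degree e" by (intro le_degree) simp
  ultimately have e: "degree e = n" "lead_coeff e = 1" by auto
  have "smult a g = [:a:] * g" by simp
  then have eJ: "e \<in> J" unfolding e_def
    using add[OF mult[OF g(1), of "[:a:]"] mult[OF pJ, of "monom b n"]] by (simp add: mult.commute)
  show thesis
  proof
    show "degree e \<le> degree f0"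
      using red[OF f0] e(1) unfolding n_def by (metis Least_le order.trans)
    show "\<forall>h\<in>J. h = 0 \<or> degree h < degree e \<longrightarrow> [:p:] dvd h"
    proof (intro ballI impI, rule ccontr)
      fix h assume h: "h \<in> J" "h = 0 \<or> degree h < degree e"
      assume "\<not> [:p:] dvd h"
      moreover from this have "degree h < n" using h e by auto
      ultimately show False using red[OF h(1)] not_less_Least unfolding n_def
        by (metis le_less_trans)
    qed
  qed (use e eJ in auto)
qed

text \<open>Irreducibility over the field with \<open>p\<close> elements, expressed in \<int>[X]:
  modulo a prime, the factors of a monic polynomial can be normalised to monic ones and lifted with
  their degrees.\<close>

definition irreducible_mod :: "int \<Rightarrow> int poly \<Rightarrow> bool" where
  "irreducible_mod p F \<longleftrightarrow> lead_coeff F = 1 \<and> 0 < degree F \<and>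
     (\<forall>e s. lead_coeff e = 1 \<longrightarrow> lead_coeff s = 1 \<longrightarrow> [:p:] dvd F - e * s \<longrightarrow>
        degree e = 0 \<or> degree s = 0)"

lemma irreducible_modD:
  "irreducible_mod p F \<Longrightarrow> lead_coeff e = 1 \<Longrightarrow> lead_coeff s = 1 \<Longrightarrow> [:p:] dvd F - e * s \<Longrightarrow>
    degree e = 0 \<or> degree s = 0"
  by (simp add: irreducible_mod_def)

lemma monic_degree_0: "lead_coeff f = 1 \<Longrightarrow> degree f = 0 \<Longrightarrow> f = 1" for f :: "int poly"
  by (metis degree_eq_zeroE lead_coeff_pCons(2) one_pCons)

text \<open>\<open>e\<close> lifts the greatest common divisor of \<open>g\<close> and
  \<open>F\<close> modulo \<open>p\<close>, as generator of the image of the ideal \<open>J\<close>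
  = (g, F, p). The remainder of \<open>F\<close> by \<open>e\<close> lies in \<open>J\<close>, so it
  vanishes modulo \<open>p\<close> by the minimality of \<open>e\<close>.\<close>

lemma bezout_mod_prime:
  fixes F g :: "int poly"
  assumes p: "prime p" and F: "lead_coeff F = 1" and g: "\<not> [:p:] dvd g" "degree g < degree F"
  obtains e s r u v w where "e = u * g + v * F + [:p:] * w" "F = e * s + [:p:] * r"
    "lead_coeff e = 1" "lead_coeff s = 1" "degree F = degree e + degree s" "degree e \<le> degree g"
proof -
  define J where "J = {h. \<exists>u v w. h = u * g + v * F + [:p:] * w}"
  have JI: "u * g + v * F + [:p:] * w \<in> J" for u v w unfolding J_def by blast
  have add: "x + y \<in> J" if "x \<in> J" "y \<in> J" for x y
  proof -
    from that obtain u v w u' v' w' where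
      "x = u * g + v * F + [:p:] * w" "y = u' * g + v' * F + [:p:] * w'" unfolding J_def by blast
    then have "x + y = (u + u') * g + (v + v') * F + [:p:] * (w + w')" by (simp only: algebra_simps)
    then show ?thesis using JI by metis
  qed
  have mult: "x * y \<in> J" if "y \<in> J" for x y
  proof -
    from that obtain u v w where "y = u * g + v * F + [:p:] * w" unfolding J_def by blast
    then have "x * y = (x * u) * g + (x * v) * F + [:p:] * (x * w)" by (simp only: algebra_simps)
    then show ?thesis using JI by metis
  qed
  have gJ: "g \<in> J" using JI[of 1 0 0] by simp
  have FJ: "F \<in> J" using JI[of 0 1 0] by simp
  have pJ: "[:p:] \<in> J" using JI[of 0 0 1] by simp
  obtain e where e: "e \<in> J" "lead_coeff e = 1" "degree e \<le> degree g"
    "\<forall>g\<in>J. g = 0 \<or> degree g < degree e \<longrightarrow> [:p:] dvd g"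
    using ideal_mod_prime_generator[OF p add mult pJ gJ g(1)] .
  obtain s r where sr: "F = e * s + r" "r = 0 \<or> degree r < degree e"
    using monic_division[OF e(2)] .
  have s: "lead_coeff s = 1" "degree F = degree e + degree s"
    using monic_quotient[OF sr(1) F e(2) sr(2)] e(3) g(2) by auto
  have "r = F + (- s) * e" using sr(1) by (simp add: algebra_simps)
  then have "r \<in> J" using add[OF FJ mult[OF e(1)]] by metis
  then have "[:p:] dvd r" using e(4) sr(2) by blast
  then obtain r' where "r = [:p:] * r'" ..
  moreover obtain u v w where "e = u * g + v * F + [:p:] * w" using e(1) unfolding J_def by blast
  ultimately show thesis using that sr(1) e(2,3) s by blast
qed

text \<open>Modulo \<open>p\<close> and \<open>F\<close> one computes in a field, where the nonzero
  class of \<open>g\<close> is invertible: the common divisor \<open>e\<close> has degree at most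
  \<open>degree g < degree F\<close>, so it is 1.\<close>

lemma irreducible_mod_bezout:
  assumes p: "prime p" and F: "irreducible_mod p F"
    and g: "\<not> [:p:] dvd g" "degree g < degree F"
  obtains u v w where "u * g + v * F = 1 + [:p:] * w"
proof -
  have lF: "lead_coeff F = 1" using F by (simp add: irreducible_mod_def)
  obtain e s r u v w where euvw: "e = u * g + v * F + [:p:] * w" and Fes: "F = e * s + [:p:] * r"
    and e: "lead_coeff e = 1" "degree e \<le> degree g"
    and s: "lead_coeff s = 1" "degree F = degree e + degree s"
    using bezout_mod_prime[OF p lF g] by metis
  have "[:p:] dvd F - e * s" by (simp only: Fes add_diff_cancel_left' dvd_triv_left)
  then have "degree e = 0 \<or> degree s = 0" by (rule irreducible_modD[OF F e(1) s(1)])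
  then have "degree e = 0" using s e(2) g(2) by auto
  then have "e = 1" using e(1) by (intro monic_degree_0)
  then have "u * g + v * F = 1 + [:p:] * (- w)" using euvw by (simp add: algebra_simps)
  then show thesis by (rule that)
qed

lemma power_cong_mod_two:
  fixes x y s q :: "'a :: comm_ring_1"
  assumes "x = y + s * a + q * b"
  shows "\<exists>a b. x ^ k = y ^ k + s * a + q * b"
proof (induction k)
  case 0
  show ?case by (intro exI[of _ 0]) simp
next
  case (Suc k)
  then obtain a' b' where "x ^ k = y ^ k + s * a' + q * b'" by blast
  then have "x ^ Suc k = x * (y ^ k + s * a' + q * b')" by simp
  also have "\<dots> = y ^ Suc k + s * (a * y ^ k + a' * x) + q * (b * y ^ k + b' * x)"
  proof -
    have "x * y ^ k = y ^ Suc k + s * (a * y ^ k) + q * (b * y ^ k)"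
      by (simp add: assms algebra_simps)
    then show ?thesis by (simp add: algebra_simps)
  qed
  finally show ?case by blast
qed

text \<open>The Bezout relation says that \<open>F\<close> is squarefree modulo \<open>p\<close>.\<close>

lemma dvd_if_nilpotent_mod:
  fixes p R :: int
  assumes p: "prime p" and F: "lead_coeff F = 1"
    and cert: "U * F + V * pderiv F = [:R:] + [:p:] * W" "\<not> p dvd R"
    and gk: "g ^ k = F * t + [:p:] * t'" and deg: "degree g < degree F"
  shows "[:p:] dvd g"
proof (rule ccontr)
  assume g: "\<not> [:p:] dvd g"
  obtain e s r' u v w where euvw: "e = u * g + v * F + [:p:] * w" and Fes: "F = e * s + [:p:] * r'"
    and e: "degree e \<le> degree g" and s: "lead_coeff s = 1" "degree F = degree e + degree s"
    using bezout_mod_prime[OF p F g deg] by metis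
  then have s0: "0 < degree s" using deg by auto
  have dF: "pderiv F = pderiv e * s + e * pderiv s + [:p:] * pderiv r'"
    by (simp add: Fes pderiv_add pderiv_mult pderiv_smult)
  \<comment> \<open>Since \<open>F\<close> is \<open>e * s\<close> modulo \<open>p\<close>, the
    Leibniz rule puts \<open>R\<close> into (e, s, p), and \<open>e\<close> itself lies in (g, s,
    p). So \<open>R\<close> is a multiple of \<open>g\<close> modulo (s, p), where
    \<open>g ^ k\<close> vanishes; hence \<open>R ^ k\<close> lies in (s, p).\<close>
  have "[:R:] = U * F + V * pderiv F - [:p:] * W" using cert(1) by (simp add: algebra_simps)
  also have "\<dots> = e * (V * pderiv s) + s * (U * e + V * pderiv e)
      + [:p:] * (U * r' + V * pderiv r' - W)"
    unfolding dF by (subst (1) Fes) (simp only: algebra_simps)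
  also have "e * (V * pderiv s) = g * (u * V * pderiv s) + s * (v * e * V * pderiv s)
      + [:p:] * ((v * r' + w) * V * pderiv s)"
    by (subst euvw, subst Fes) (simp only: algebra_simps)
  finally have "[:R:] = g * (u * V * pderiv s)
      + s * (v * e * V * pderiv s + (U * e + V * pderiv e))
      + [:p:] * ((v * r' + w) * V * pderiv s + (U * r' + V * pderiv r' - W))"
    by (simp only: algebra_simps)
  then obtain a b where ab: "[:R:] ^ k = (g * (u * V * pderiv s)) ^ k + s * a + [:p:] * b"
    using power_cong_mod_two by blast
  have "(g * (u * V * pderiv s)) ^ k = (F * t + [:p:] * t') * (u * V * pderiv s) ^ k"
    by (simp only: power_mult_distrib gk)
  also have "\<dots> = s * (e * t * (u * V * pderiv s) ^ k)
      + [:p:] * ((r' * t + t') * (u * V * pderiv s) ^ k)"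
    unfolding Fes by (simp only: algebra_simps)
  finally have "[:R:] ^ k = s * (e * t * (u * V * pderiv s) ^ k + a)
      + [:p:] * ((r' * t + t') * (u * V * pderiv s) ^ k + b)"
    unfolding ab by (simp only: algebra_simps)
  then obtain A B where AB: "[:R ^ k:] = s * A + [:p:] * B" by (auto simp: poly_const_pow)
  have pR: "\<not> p dvd R ^ k" using cert(2) p by (metis prime_dvd_power)
  have "\<not> [:p:] dvd A"
  proof
    assume "[:p:] dvd A"
    then have "[:p:] dvd [:R ^ k:]" unfolding AB by (intro dvd_add dvd_mult dvd_triv_left)
    then show False using pR by simp
  qed
  then obtain A1 where A1: "[:p:] dvd A - A1" "\<not> p dvd lead_coeff A1"
    using reduce_mod_prime_lead by blast
  then obtain A2 where "A - A1 = [:p:] * A2" by (auto elim: dvdE)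
  then have "A = A1 + [:p:] * A2" by (simp add: algebra_simps)
  \<comment> \<open>The monic \<open>s\<close> has positive degree, so a nonzero multiple of it
    modulo \<open>p\<close> cannot be the constant \<open>R ^ k\<close>: the top coefficient of
    \<open>s * A1\<close> would be divisible by \<open>p\<close>.\<close>
  then have "s * A1 = [:R ^ k:] - [:p:] * (B + s * A2)" using AB by (simp add: algebra_simps)
  then have "coeff (s * A1) (degree s + degree A1) =
      - (p * coeff (B + s * A2) (degree s + degree A1))"
    using s0 by (cases "degree s + degree A1") auto
  then have "p dvd lead_coeff A1" using s(1) by (simp add: coeff_mult_degree_sum)
  then show False using A1(2) by simp
qed

section \<open>Evaluation and adjunction\<close>

definition ev :: "int poly \<Rightarrow> complex \<Rightarrow> complex" where
  "ev g x = poly (map_poly of_int g) x"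

lemma ev_0 [simp]: "ev 0 x = 0"
  and ev_1 [simp]: "ev 1 x = 1"
  and ev_pCons [simp]: "ev (pCons a g) x = of_int a + x * ev g x"
  and ev_add [simp]: "ev (f + g) x = ev f x + ev g x"
  and ev_diff [simp]: "ev (f - g) x = ev f x - ev g x"
  and ev_minus [simp]: "ev (- f) x = - ev f x"
  and ev_mult [simp]: "ev (f * g) x = ev f x * ev g x"
  and ev_smult [simp]: "ev (smult a f) x = of_int a * ev f x"
  and ev_power [simp]: "ev (f ^ k) x = ev f x ^ k"
  and ev_pcompose: "ev (pcompose f g) x = ev f (ev g x)"
proof -
  show pC: "ev (pCons a g) x = of_int a + x * ev g x" for a g
    by (simp add: ev_def of_int_hom.map_poly_pCons_hom)
  show mult: "ev (f * g) x = ev f x * ev g x" for f g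
    by (simp add: ev_def of_int_poly_hom.hom_mult)
  show "ev (f ^ k) x = ev f x ^ k" 
    by (simp add: ev_def of_int_poly_hom.hom_power)
  show add: "ev (f + g) x = ev f x + ev g x" for f g x
    by (simp add: ev_def of_int_poly_hom.hom_add)
  show "ev (pcompose f g) x = ev f (ev g x)"
    by (simp add: ev_def of_int_hom.map_poly_pcompose poly_pcompose)
  show "ev (smult a f) x = of_int a * ev f x"
    by (simp add: ev_def of_int_hom.map_poly_hom_smult)
  show "ev (f - g) x = ev f x - ev g x" "ev (- f) x = - ev f x"
    by (simp_all add: ev_def of_int_poly_hom.hom_minus of_int_poly_hom.hom_uminus)
qed (simp_all add: ev_def)

lemma ev_altdef:
  assumes "degree g < n"
  shows "ev g x = (\<Sum>i<n. of_int (coeff g i) * x ^ i)"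
proof -
  have "ev g x = (\<Sum>i\<le>degree g. of_int (coeff g i) * x ^ i)"
    by (simp add: ev_def poly_altdef coeff_map_poly degree_map_poly)
  also have "\<dots> = (\<Sum>i<n. of_int (coeff g i) * x ^ i)"
    using assms by (intro sum.mono_neutral_left) (auto simp: coeff_eq_0)
  finally show ?thesis .
qed

lemma ev_monom [simp]: "ev (monom a i) x = of_int a * x ^ i"
  by (simp add: ev_def map_poly_monom poly_monom)

lemma ev_Poly_sum: "ev (\<Sum>i<n. monom (a i) i) x = (\<Sum>i<n. of_int (a i) * x ^ i)"
proof (induction n)
  case (Suc n)
  then show ?case by simp
qed simp

lemma degree_sum_monom_less: "0 < n \<Longrightarrow> degree (\<Sum>i<n. monom (a i :: int) i) < n"
  by (rule degree_sum_less) (auto simp: degree_monom_eq le_less_trans[OF degree_monom_le])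

lemma algebraic_int_ev [intro]: "algebraic_int x \<Longrightarrow> algebraic_int (ev g x)"
  by (induction g) auto

lemma algebraic_int_obtain_ev:
  assumes "algebraic_int (x :: complex)"
  obtains f where "lead_coeff f = 1" "ev f x = 0"
  using assms unfolding algebraic_int_altdef_ipoly ev_def by blast

lemma algebraic_int_if_ev: "lead_coeff f = 1 \<Longrightarrow> ev f x = 0 \<Longrightarrow> algebraic_int x"
  unfolding algebraic_int_altdef_ipoly ev_def by blast

lemma complex_field_simps [simp]:
  "carrier complex_field = UNIV"
  "x \<otimes>\<^bsub>complex_field\<^esub> y = x * y" "x \<oplus>\<^bsub>complex_field\<^esub> y = x + y"
  "\<one>\<^bsub>complex_field\<^esub> = 1" "\<zero>\<^bsub>complex_field\<^esub> = 0"
  by (simp_all add: ring_of_type_algebra_def)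

lemma complex_field_field: "field complex_field"
  by (rule field_from_type_algebra)

lemma complex_field_a_inv [simp]: "a_inv complex_field x = - x"
proof -
  interpret field complex_field by (rule complex_field_field)
  show ?thesis using minus_equality[of "- x" x] by simp
qed

lemma complex_field_m_inv [simp]:
  assumes "x \<noteq> 0" shows "m_inv complex_field x = inverse x"
proof -
  interpret field complex_field by (rule complex_field_field)
  show ?thesis using comm_inv_char[of x "inverse x"] assms by simp
qed

lemma Z_adjoin_eq: "Z_adjoin \<theta> = range (\<lambda>g. ev g \<theta>)"
proof (intro equalityI subsetI)
  fix x assume "x \<in> Z_adjoin \<theta>"
  then have "x \<in> generate_ring complex_field {\<theta>}" by (simp add: Z_adjoin_def)
  then show "x \<in> range (\<lambda>g. ev g \<theta>)"
  proof induction
    case one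
    show ?case by (rule range_eqI[of _ _ 1]) simp
  next
    case (incl h)
    then show ?case by (intro range_eqI[of _ _ "[:0, 1:]"]) simp
  next
    case (a_inv h)
    then obtain g where "h = ev g \<theta>" by blast
    then show ?case by (intro range_eqI[of _ _ "- g"]) simp
  next
    case (eng_add x y)
    then obtain f g where "x = ev f \<theta>" "y = ev g \<theta>" by blast
    then show ?case by (intro range_eqI[of _ _ "f + g"]) simp
  next
    case (eng_mult x y)
    then obtain f g where "x = ev f \<theta>" "y = ev g \<theta>" by blast
    then show ?case by (intro range_eqI[of _ _ "f * g"]) simp
  qed
next
  fix x assume "x \<in> range (\<lambda>g. ev g \<theta>)"
  then obtain g where x: "x = ev g \<theta>" by blast
  define Z where "Z = generate_ring complex_field {\<theta>}"
  have 1: "1 \<in> Z" using generate_ring.one[of complex_field "{\<theta>}"] by (simp add: Z_def)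
  have \<theta>: "\<theta> \<in> Z" using generate_ring.incl[of \<theta> "{\<theta>}" complex_field] by (simp add: Z_def)
  have m: "- y \<in> Z" if "y \<in> Z" for y
    using generate_ring.a_inv[of y complex_field "{\<theta>}"] that by (simp add: Z_def)
  have add: "y + z \<in> Z" if "y \<in> Z" "z \<in> Z" for y z
    using generate_ring.eng_add[of y complex_field "{\<theta>}" z] that by (simp add: Z_def)
  have mult: "y * z \<in> Z" if "y \<in> Z" "z \<in> Z" for y z
    using generate_ring.eng_mult[of y complex_field "{\<theta>}" z] that by (simp add: Z_def)
  have 0: "0 \<in> Z" using add[OF 1 m[OF 1]] by simp
  have nat: "of_nat k \<in> Z" for k by (induction k) (auto intro: 0 1 add)
  have int: "of_int k \<in> Z" for k
    by (cases k rule: int_cases2) (use nat m[OF nat] in auto)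
  have "ev g \<theta> \<in> Z" by (induction g) (auto intro: 0 add mult int \<theta>)
  then show "x \<in> Z_adjoin \<theta>" by (simp add: x Z_def Z_adjoin_def)
qed

lemma Q_adjoin_closed:
  shows Q_adjoin_1: "1 \<in> Q_adjoin \<theta>"
    and Q_adjoin_base: "\<theta> \<in> Q_adjoin \<theta>"
    and Q_adjoin_uminus: "x \<in> Q_adjoin \<theta> \<Longrightarrow> - x \<in> Q_adjoin \<theta>"
    and Q_adjoin_add: "x \<in> Q_adjoin \<theta> \<Longrightarrow> y \<in> Q_adjoin \<theta> \<Longrightarrow> x + y \<in> Q_adjoin \<theta>"
    and Q_adjoin_mult: "x \<in> Q_adjoin \<theta> \<Longrightarrow> y \<in> Q_adjoin \<theta> \<Longrightarrow> x * y \<in> Q_adjoin \<theta>"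
    and Q_adjoin_inverse: "x \<in> Q_adjoin \<theta> \<Longrightarrow> inverse x \<in> Q_adjoin \<theta>"
proof -
  show 1: "1 \<in> Q_adjoin \<theta>"
    using generate_field.one[of complex_field "{\<theta>}"] by (simp add: Q_adjoin_def)
  show "\<theta> \<in> Q_adjoin \<theta>"
    using generate_field.incl[of \<theta> "{\<theta>}" complex_field] by (simp add: Q_adjoin_def)
  show m: "- y \<in> Q_adjoin \<theta>" if "y \<in> Q_adjoin \<theta>" for y
    using generate_field.a_inv[of y complex_field "{\<theta>}"] that by (simp add: Q_adjoin_def)
  show add: "y + z \<in> Q_adjoin \<theta>" if "y \<in> Q_adjoin \<theta>" "z \<in> Q_adjoin \<theta>" for y z
    using generate_field.eng_add[of y complex_field "{\<theta>}" z] that by (simp add: Q_adjoin_def)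
  show "y * z \<in> Q_adjoin \<theta>" if "y \<in> Q_adjoin \<theta>" "z \<in> Q_adjoin \<theta>" for y z
    using generate_field.eng_mult[of y complex_field "{\<theta>}" z] that by (simp add: Q_adjoin_def)
  show "inverse y \<in> Q_adjoin \<theta>" if "y \<in> Q_adjoin \<theta>" for y
    using generate_field.m_inv[of y complex_field "{\<theta>}"] that add[OF 1 m[OF 1]]
    by (cases "y = 0") (simp_all add: Q_adjoin_def)
qed

lemma Q_adjoin_of_int: "of_int k \<in> Q_adjoin \<theta>"
proof -
  have 0: "0 \<in> Q_adjoin \<theta>" using Q_adjoin_add[OF Q_adjoin_1 Q_adjoin_uminus[OF Q_adjoin_1]] by simp
  have nat: "of_nat k \<in> Q_adjoin \<theta>" for k
    by (induction k) (auto intro: 0 Q_adjoin_1 Q_adjoin_add)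
  show ?thesis
    by (cases k rule: int_cases2) (use nat Q_adjoin_uminus[OF nat] in auto)
qed

lemma Q_adjoin_diff: "x \<in> Q_adjoin \<theta> \<Longrightarrow> y \<in> Q_adjoin \<theta> \<Longrightarrow> x - y \<in> Q_adjoin \<theta>"
  using Q_adjoin_add[of x \<theta> "- y"] Q_adjoin_uminus by simp

lemma Q_adjoin_divide: "x \<in> Q_adjoin \<theta> \<Longrightarrow> y \<in> Q_adjoin \<theta> \<Longrightarrow> x / y \<in> Q_adjoin \<theta>"
  by (simp add: divide_inverse Q_adjoin_mult Q_adjoin_inverse)

lemma Q_adjoin_power: "x \<in> Q_adjoin \<theta> \<Longrightarrow> x ^ k \<in> Q_adjoin \<theta>"
  by (induction k) (auto intro: Q_adjoin_1 Q_adjoin_mult)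

lemma Q_adjoin_of_rat: "of_rat q \<in> Q_adjoin \<theta>"
  by (cases q) (simp add: of_rat_rat Q_adjoin_divide Q_adjoin_of_int)

lemma Q_adjoin_sum: "(\<And>i. i \<in> I \<Longrightarrow> f i \<in> Q_adjoin \<theta>) \<Longrightarrow> sum f I \<in> Q_adjoin \<theta>"
  using Q_adjoin_of_int[of 0]
  by (induction I rule: infinite_finite_induct) (auto intro: Q_adjoin_add)

lemma Q_adjoin_ev: "x \<in> Q_adjoin \<theta> \<Longrightarrow> ev g x \<in> Q_adjoin \<theta>"
  using Q_adjoin_of_int[of 0]
    by (induction g) (auto intro: Q_adjoin_add Q_adjoin_mult Q_adjoin_of_int)

lemma Q_adjoin_subset:
  assumes "\<theta> \<in> Q_adjoin \<rho>" shows "Q_adjoin \<theta> \<subseteq> Q_adjoin \<rho>"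
proof
  fix x assume "x \<in> Q_adjoin \<theta>"
  then have "x \<in> generate_field complex_field {\<theta>}" by (simp add: Q_adjoin_def)
  then show "x \<in> Q_adjoin \<rho>"
    by induction
      (auto intro: Q_adjoin_1 Q_adjoin_uminus Q_adjoin_add Q_adjoin_mult Q_adjoin_inverse assms)
qed

text \<open>If the constant term of a relation for \<open>y\<close> is 0, then \<open>y\<close> can
  be cancelled; otherwise that term is, up to sign, the multiple of \<open>y\<close> sought.\<close>

lemma algebraic_int_nonzero_inverse:
  assumes "algebraic_int y" "y \<noteq> 0"
  obtains f k where "k \<noteq> 0" "y * ev f y = of_int k"
proof -
  obtain p where p: "lead_coeff p = 1" "ev p y = 0" using algebraic_int_obtain_ev[OF assms(1)] .
  have "\<exists>f k. k \<noteq> 0 \<and> y * ev f y = of_int k" if "p \<noteq> 0" "ev p y = 0" for p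
    using that
  proof (induction p)
    case (pCons a p)
    show ?case
    proof (cases "a = 0")
      case True
      then show ?thesis using pCons assms(2) by auto
    next
      case False
      moreover have "y * ev p y = of_int (- a)" using pCons.prems(2)
        by (simp add: eq_neg_iff_add_eq_0 add.commute)
      ultimately show ?thesis by (intro exI[of _ p] exI[of _ "- a"]) simp
    qed
  qed simp
  moreover have "p \<noteq> 0" using p(1) by auto
  ultimately obtain f k where "k \<noteq> 0" "y * ev f y = of_int k" using p(2) by metis
  then show thesis by (rule that)
qed

text \<open>Integer denominators are enough for inverses:
  \<open>algebraic_int_nonzero_inverse\<close> rewrites \<open>1 / ev g \<theta>\<close> as a
  polynomial in \<open>ev g \<theta>\<close> over an integer.\<close>

lemma Q_adjoin_eq:
  assumes \<theta>: "algebraic_int \<theta>"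
  shows "Q_adjoin \<theta> = {ev g \<theta> / of_int k |g k. k \<noteq> 0}"
proof (intro equalityI subsetI)
  fix x assume "x \<in> {ev g \<theta> / of_int k |g k. k \<noteq> 0}"
  then show "x \<in> Q_adjoin \<theta>"
    by (auto intro: Q_adjoin_divide Q_adjoin_ev Q_adjoin_base Q_adjoin_of_int)
next
  fix x assume "x \<in> Q_adjoin \<theta>"
  then have "x \<in> generate_field complex_field {\<theta>}" by (simp add: Q_adjoin_def)
  then have "\<exists>g k. k \<noteq> 0 \<and> x = ev g \<theta> / of_int k"
  proof induction
    case one
    show ?case by (intro exI[of _ 1]) simp
  next
    case (incl h)
    then show ?case by (intro exI[of _ "[:0, 1:]"] exI[of _ 1]) simp
  next
    case (a_inv h)
    then obtain g k where "k \<noteq> 0" "h = ev g \<theta> / of_int k" by blast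
    then show ?case by (intro exI[of _ "- g"] exI[of _ k]) simp
  next
    case (m_inv h)
    then obtain g k where gk: "k \<noteq> 0" "h = ev g \<theta> / of_int k" by blast
    then have "ev g \<theta> \<noteq> 0" using m_inv by auto
    then obtain f l where fl: "l \<noteq> 0" "ev g \<theta> * ev f (ev g \<theta>) = of_int l"
      using algebraic_int_nonzero_inverse[OF algebraic_int_ev[OF \<theta>]] by metis
    have "inverse h = of_int k * ev f (ev g \<theta>) / of_int l"
    proof -
      have "ev f (ev g \<theta>) \<noteq> 0" using fl by auto
      then show ?thesis using gk(1) \<open>ev g \<theta> \<noteq> 0\<close> by (simp add: gk(2) fl(2)[symmetric])
    qed
    moreover have "m_inv complex_field h = inverse h" using m_inv by simp
    ultimately have "m_inv complex_field h = ev (smult k (pcompose f g)) \<theta> / of_int l"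
      by (simp add: ev_pcompose)
    then show ?case using fl(1) by blast
  next
    case (eng_add x y)
    then obtain f k g l where "k \<noteq> 0" "x = ev f \<theta> / of_int k" "l \<noteq> 0" "y = ev g \<theta> / of_int l"
      by blast
    then show ?case
      by (intro exI[of _ "smult l f + smult k g"] exI[of _ "k * l"]) (simp add: field_simps)
  next
    case (eng_mult x y)
    then obtain f k g l where "k \<noteq> 0" "x = ev f \<theta> / of_int k" "l \<noteq> 0" "y = ev g \<theta> / of_int l"
      by blast
    then show ?case by (intro exI[of _ "f * g"] exI[of _ "k * l"]) simp
  qed
  then show "x \<in> {ev g \<theta> / of_int k |g k. k \<noteq> 0}" by blast
qed

section \<open>Power bases of number fields\<close>

lemmas algebraic_int_intros = algebraic_int_add algebraic_int_diff algebraic_int_mult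
  algebraic_int_power algebraic_int_ev algebraic_int_of_int

text \<open>Multiplied by a power of \<open>q\<close>, the monic relation of \<open>x\<close>
  becomes one for \<open>q * x\<close> in which every term but the leading one is divisible by
  \<open>q\<close>. The induction over coefficients passes through polynomials that need not vanish
  at \<open>x\<close>.\<close>

lemma integral_multiple_power:
  assumes x: "algebraic_int x"
  obtains k t where "(of_int q * x) ^ k = of_int q * ev t (of_int q * x)"
proof -
  define y where "y = of_int q * x"
  have "\<exists>t. of_int q ^ degree f * ev f x = of_int (lead_coeff f) * y ^ degree f + of_int q * ev t y"
    for f :: "int poly"
  proof (induction f)
    case 0
    show ?case by (intro exI[of _ 0]) simp
  next
    case (pCons a f)
    show ?case
    proof (cases "f = 0")
      case True
      then show ?thesis by (intro exI[of _ 0]) simp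
    next
      case False
      from pCons.IH obtain t where
        t: "of_int q ^ degree f * ev f x = of_int (lead_coeff f) * y ^ degree f
            + of_int q * ev t y" ..
      have "of_int q ^ degree (pCons a f) * ev (pCons a f) x =
          of_int q * (of_int q ^ degree f * of_int a) + y * (of_int q ^ degree f * ev f x)"
        using False by (simp add: algebra_simps y_def)
      also have "\<dots> = of_int (lead_coeff (pCons a f)) * y ^ degree (pCons a f)
          + of_int q * ev (pCons (q ^ degree f * a) t) y"
        unfolding t using False by (simp add: algebra_simps)
      finally show ?thesis by blast
    qed
  qed
  moreover obtain f where f: "lead_coeff f = 1" "ev f x = 0" using algebraic_int_obtain_ev[OF x] .
  ultimately obtain t where "0 = y ^ degree f + of_int q * ev t y"
    by (metis mult_1 mult_zero_right of_int_1)
  then have "y ^ degree f = of_int q * ev (- t) y" by (simp add: eq_neg_iff_add_eq_0)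
  then show thesis using that unfolding y_def by metis
qed

text \<open>Splits off the lowest term of \<open>g\<close> that survives modulo \<open>q\<close>, a
  substitute for the \<theta>-adic valuation in the Eisenstein case.\<close>

lemma lowest_coeff_mod:
  fixes g :: "int poly"
  assumes "\<not> [:q:] dvd g"
  obtains j c g1 g2 where "j \<le> degree g" "\<not> q dvd c" "g = smult q g1 + monom 1 j * pCons c g2"
proof -
  have "\<exists>j c g1 g2. j \<le> degree g \<and> \<not> q dvd c \<and> g = smult q g1 + monom 1 j * pCons c g2"
    using assms
  proof (induction g)
    case (pCons a g)
    show ?case
    proof (cases "q dvd a")
      case False
      then show ?thesis by (intro exI[of _ 0] exI[of _ a] exI[of _ 0] exI[of _ g]) simp
    next
      case True
      then obtain b where b: "a = q * b" ..
      have g: "\<not> [:q:] dvd g"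
      proof
        assume "[:q:] dvd g"
        then obtain h where "g = [:q:] * h" ..
        then have "pCons a g = [:q:] * pCons b h" using b by simp
        then show False using pCons.prems by (metis dvd_triv_left)
      qed
      then have "g \<noteq> 0" by auto
      from pCons.IH[OF g] obtain j c g1 g2 where
        *: "j \<le> degree g" "\<not> q dvd c" "g = smult q g1 + monom 1 j * pCons c g2" by blast
      have "pCons a g = smult q (pCons b g1) + monom 1 (Suc j) * pCons c g2"
        by (subst *(3)) (simp add: b monom_Suc)
      moreover have "Suc j \<le> degree (pCons a g)" using * \<open>g \<noteq> 0\<close> by simp
      ultimately show ?thesis using *(2) by blast
    qed
  qed simp
  then show thesis using that by blast
qed

lemma common_denominator:
  fixes c :: "nat \<Rightarrow> rat"
  obtains N a where "N \<noteq> 0" "\<And>i. i < n \<Longrightarrow> c i = of_int (a i) / of_int N"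
proof -
  have "\<exists>N a. N \<noteq> 0 \<and> (\<forall>i<n. c i = of_int (a i) / of_int N)"
  proof (induction n)
    case 0
    show ?case by (intro exI[of _ 1]) simp
  next
    case (Suc n)
    then obtain N a where N: "N \<noteq> 0" "\<forall>i<n. c i = of_int (a i) / of_int N" by blast
    obtain u v where "c n = Rat.Fract u v" "v > 0" by (cases "c n")
    then have uv: "c n = of_int u / of_int v" "v \<noteq> 0" by (simp_all add: Fract_of_int_quotient)
    show ?case
      by (rule exI[of _ "N * v"], rule exI[of _ "\<lambda>i. if i = n then u * N else a i * v"])
         (use N uv in \<open>auto simp: less_Suc_eq field_simps\<close>)
  qed
  then show thesis using that by blast
qed

text \<open>\<open>F\<close> is the minimal polynomial of \<open>\<theta>\<close>. Minimality among
  integer polynomials yields linear independence of the powers over \<rat> by clearing denominators,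
  see \<open>lin_eq_0\<close>.\<close>

locale power_basis =
  fixes \<theta> :: complex and F :: "int poly"
  assumes monic: "lead_coeff F = 1" and root: "ev F \<theta> = 0"
    and minimal: "\<And>g. ev g \<theta> = 0 \<Longrightarrow> degree g < degree F \<Longrightarrow> g = 0"
begin

abbreviation "n \<equiv> degree F"
abbreviation "K \<equiv> Q_adjoin \<theta>"

lemma integral: "algebraic_int \<theta>"
  using algebraic_int_if_ev[OF monic root] .

lemma n_pos: "0 < n"
proof (rule ccontr)
  assume "\<not> 0 < n"
  then have "F = 1" using monic by (intro monic_degree_0) auto
  then show False using root by simp
qed

lemma ev_reduce: obtains h s where "g = F * s + h" "degree h < n" "ev g \<theta> = ev h \<theta>"
proof -
  obtain s h where "g = F * s + h" "h = 0 \<or> degree h < n" using monic_division[OF monic] .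
  then show thesis using n_pos root by (intro that[of s h]) auto
qed

lemma Z_adjoinE:
  assumes "x \<in> Z_adjoin \<theta>" obtains g where "degree g < n" "x = ev g \<theta>"
  using assms ev_reduce unfolding Z_adjoin_eq by (metis imageE)

lemma ev_eq_0E:
  assumes "ev g \<theta> = 0" obtains s where "g = F * s"
  using assms ev_reduce[of g] minimal by (metis add.right_neutral)

section \<open>Absence of q-torsion modulo \<int>[\<theta>]\<close>

lemma no_torsion_squarefree:
  assumes q: "prime q" and cert: "U * F + V * pderiv F = [:R:] + [:q:] * W" "\<not> q dvd R"
    and x: "algebraic_int x" "of_int q * x \<in> Z_adjoin \<theta>"
  shows "x \<in> Z_adjoin \<theta>"
proof -
  obtain g where g: "degree g < n" "of_int q * x = ev g \<theta>" using Z_adjoinE[OF x(2)] .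
  obtain k t where "(of_int q * x) ^ k = of_int q * ev t (of_int q * x)"
    using integral_multiple_power[OF x(1)] .
  then have "ev (g ^ k - smult q (pcompose t g)) \<theta> = 0" by (simp add: g(2) ev_pcompose)
  then obtain s where "g ^ k - smult q (pcompose t g) = F * s" by (rule ev_eq_0E)
  then have "g ^ k = F * s + [:q:] * pcompose t g" by (simp add: algebra_simps)
  then have "[:q:] dvd g" by (rule dvd_if_nilpotent_mod[OF q monic cert _ g(1)])
  then obtain h where "g = [:q:] * h" ..
  then have "of_int q * x = of_int q * ev h \<theta>" using g(2) by simp
  then have "x = ev h \<theta>" using q by auto
  then show ?thesis by (simp add: Z_adjoin_eq)
qed

text \<open>If \<open>q\<close> did not divide the numerator \<open>g\<close>, then \<open>g\<close>
  would be invertible modulo \<open>F\<close> and \<open>q\<close>; as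
  \<open>ev g \<theta> = q * x\<close>, this would make \<open>q\<close> divide 1 among the
  algebraic integers.\<close>

lemma no_torsion_irreducible:
  assumes q: "prime q" and F: "irreducible_mod q F"
    and x: "algebraic_int x" "of_int q * x \<in> Z_adjoin \<theta>"
  shows "x \<in> Z_adjoin \<theta>"
proof -
  obtain g where g: "degree g < n" "of_int q * x = ev g \<theta>" using Z_adjoinE[OF x(2)] .
  have "[:q:] dvd g"
  proof (rule ccontr)
    assume "\<not> [:q:] dvd g"
    then obtain u v w where "u * g + v * F = 1 + [:q:] * w"
      using irreducible_mod_bezout[OF q F _ g(1)] by blast
    then have "ev (u * g + v * F) \<theta> = ev (1 + [:q:] * w) \<theta>" by simp
    then have "1 = ev u \<theta> * ev g \<theta> - of_int q * ev w \<theta>" by (simp add: root)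
    then have *: "of_int 1 = of_int q * (ev u \<theta> * x - ev w \<theta>)"
      by (simp add: algebra_simps flip: g(2))
    have "q dvd 1"
      by (rule algebraic_int_dvd[OF _ *]) (intro algebraic_int_intros integral x(1))
    then show False using q by auto
  qed
  then obtain h where "g = [:q:] * h" ..
  then have "of_int q * x = of_int q * ev h \<theta>" using g(2) by simp
  then have "x = ev h \<theta>" using q by auto
  then show ?thesis by (simp add: Z_adjoin_eq)
qed

lemma no_torsion_Eisenstein:
  assumes q: "prime q" and F: "[:q:] dvd F - monom 1 n" "\<not> q ^ 2 dvd coeff F 0"
    and x: "algebraic_int x" "of_int q * x \<in> Z_adjoin \<theta>"
  shows "x \<in> Z_adjoin \<theta>"
proof -
  obtain g where g: "degree g < n" "of_int q * x = ev g \<theta>" using Z_adjoinE[OF x(2)] .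
  have "[:q:] dvd g"
  proof (rule ccontr)
    assume "\<not> [:q:] dvd g"
    then obtain j c g1 g2 where *: "j \<le> degree g" "\<not> q dvd c"
      "g = smult q g1 + monom 1 j * pCons c g2" using lowest_coeff_mod by blast
    note c = *(2)
    obtain e E where eE: "F - monom 1 n = [:q:] * pCons e E"
      using F(1) by (metis dvdE pCons_cases)
    have "coeff (F - monom 1 n) 0 = q * e" by (simp add: eE)
    then have "\<not> q dvd e" using F(2) n_pos by (auto simp: power2_eq_square)
    have \<theta>n: "\<theta> ^ n = - (of_int q * (of_int e + \<theta> * ev E \<theta>))"
    proof -
      have "ev F \<theta> - \<theta> ^ n = of_int q * (of_int e + \<theta> * ev E \<theta>)"
        using arg_cong[OF eE, of "\<lambda>f. ev f \<theta>"] by (simp add: algebra_simps)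
      then show ?thesis using root by (metis diff_0 minus_minus)
    qed
    \<comment> \<open>Multiplying by \<open>\<theta>\<^sup>l\<close> shifts the lowest term of \<open>g\<close> to \<open>c \<theta>\<^sup>n\<^sup>-\<^sup>1\<close>, which is then divisible by \<open>q\<close>.\<close>
    define l where "l = n - 1 - j"
    have l: "\<theta> ^ l * \<theta> ^ j * \<theta> = \<theta> ^ n"
      using * g(1) n_pos by (simp add: l_def flip: power_add power_Suc2)
    define y where "y = \<theta> ^ l * x - \<theta> ^ l * ev g1 \<theta> + ev g2 \<theta> * (of_int e + \<theta> * ev E \<theta>)"
    \<comment> \<open>Cancelling \<open>q\<close> will give
      \<open>y * \<theta> = - (c * (e + \<theta> * ev E \<theta>))\<close>. Moving the multiple of
      \<open>\<theta>\<close> to the left leaves \<open>\<theta> * w = - (c * e)\<close>: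
      \<open>\<theta>\<close> divides an integer prime to \<open>q\<close>, although
      \<open>\<theta> ^ n\<close> is divisible by \<open>q\<close>.\<close>
    define w where "w = y + of_int c * ev E \<theta>"
    have w: "algebraic_int w" unfolding w_def y_def by (intro algebraic_int_intros integral x(1))
    have gx: "of_int q * x = of_int q * ev g1 \<theta> + \<theta> ^ j * (of_int c + \<theta> * ev g2 \<theta>)"
      unfolding g(2) by (subst *(3)) (simp add: algebra_simps)
    have "\<theta> ^ l * (of_int q * x) = of_int q * (\<theta> ^ l * ev g1 \<theta>)
        + of_int c * (\<theta> ^ l * \<theta> ^ j) + (\<theta> ^ l * \<theta> ^ j * \<theta>) * ev g2 \<theta>"
      unfolding gx by (simp add: algebra_simps)
    then have "of_int c * (\<theta> ^ l * \<theta> ^ j) = of_int q * y"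
      unfolding l \<theta>n y_def by (simp add: algebra_simps)
    then have "of_int q * (y * \<theta>) = of_int c * (\<theta> ^ l * \<theta> ^ j * \<theta>)" by (metis mult.assoc)
    also have "\<dots> = of_int q * (- (of_int c * (of_int e + \<theta> * ev E \<theta>)))"
      unfolding l \<theta>n by simp
    finally have "y * \<theta> = - (of_int c * (of_int e + \<theta> * ev E \<theta>))"
      using q by (metis mult_left_cancel of_int_eq_0_iff not_prime_0)
    then have "\<theta> * w = of_int (- (c * e))" by (simp add: w_def algebra_simps)
    then have "of_int ((- (c * e)) ^ n) = \<theta> ^ n * w ^ n" by (metis of_int_power power_mult_distrib)
    also have "\<dots> = of_int q * (- ((of_int e + \<theta> * ev E \<theta>) * w ^ n))" unfolding \<theta>n by simp
    finally have *: "of_int ((- (c * e)) ^ n) = of_int q * (- ((of_int e + \<theta> * ev E \<theta>) * w ^ n))" .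
    have "q dvd (- (c * e)) ^ n"
      by (rule algebraic_int_dvd[OF _ *]) (intro algebraic_int_intros algebraic_int_minus integral w)
    then have "q dvd - (c * e)" using q by (metis prime_dvd_power)
    then have "q dvd c * e" by simp
    then show False using q c \<open>\<not> q dvd e\<close> by (simp add: prime_dvd_mult_iff)
  qed
  then obtain h where "g = [:q:] * h" ..
  then have "of_int q * x = of_int q * ev h \<theta>" using g(2) by simp
  then have "x = ev h \<theta>" using q by auto
  then show ?thesis by (simp add: Z_adjoin_eq)
qed

section \<open>Coordinates in the power basis\<close>

definition lin :: "(nat \<Rightarrow> rat) \<Rightarrow> complex" where
  "lin c = (\<Sum>i<n. of_rat (c i) * \<theta> ^ i)"

text \<open>Only the values at indices below \<open>n\<close>, for \<open>x\<close> in
  \<open>K\<close>, are determined; hence the side conditions \<open>i < n\<close> below.\<close>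

definition crd :: "complex \<Rightarrow> nat \<Rightarrow> rat" where
  "crd x = (SOME c. x = lin c)"

lemma lin_in_K: "lin c \<in> K"
  unfolding lin_def
  by (intro Q_adjoin_sum Q_adjoin_mult Q_adjoin_of_rat Q_adjoin_power Q_adjoin_base)

lemma K_obtain_ev:
  assumes "x \<in> K" obtains g k where "degree g < n" "k \<noteq> 0" "x = ev g \<theta> / of_int k"
  using assms ev_reduce unfolding Q_adjoin_eq[OF integral] by (smt (verit) mem_Collect_eq)

lemma lin_crd: assumes "x \<in> K" shows "lin (crd x) = x"
proof -
  obtain g k where g: "degree g < n" "k \<noteq> 0" "x = ev g \<theta> / of_int k" using K_obtain_ev[OF assms] .
  have "x = lin (\<lambda>i. of_int (coeff g i) / of_int k)"
    by (simp add: g(3) ev_altdef[OF g(1)] lin_def sum_divide_distrib of_rat_divide)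
  then show ?thesis unfolding crd_def by (metis (mono_tags, lifting) someI)
qed

lemma lin_eq_0: assumes "lin c = 0" "i < n" shows "c i = 0"
proof -
  obtain N a where N: "N \<noteq> 0" "\<And>i. i < n \<Longrightarrow> c i = of_int (a i) / of_int N"
    using common_denominator[of n c] by metis
  define g where "g = (\<Sum>i<n. monom (a i) i)"
  have "ev g \<theta> = of_int N * lin c"
    using N by (simp add: g_def ev_Poly_sum lin_def sum_distrib_left of_rat_divide)
  moreover have "degree g < n" unfolding g_def by (rule degree_sum_monom_less[OF n_pos])
  ultimately have "g = 0" using assms by (intro minimal) simp_all
  then have "coeff g i = 0" by simp
  then have "a i = 0" using assms(2) by (simp add: g_def coeff_sum)
  then show ?thesis using N assms(2) by simp
qed

lemma lin_add: "lin (\<lambda>i. c i + d i) = lin c + lin d"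
  by (simp add: lin_def of_rat_add distrib_right sum.distrib)

lemma lin_diff: "lin (\<lambda>i. c i - d i) = lin c - lin d"
  by (simp add: lin_def of_rat_diff left_diff_distrib sum_subtractf)

lemma lin_scale: "lin (\<lambda>i. r * c i) = of_rat r * lin c"
  unfolding lin_def sum_distrib_left by (rule sum.cong) (simp_all add: of_rat_mult)

lemma crd_unique: assumes "x = lin c" "i < n" shows "crd x i = c i"
proof -
  have "lin (\<lambda>i. crd x i - c i) = 0"
    using lin_crd[of x] assms lin_in_K by (simp add: lin_diff)
  from lin_eq_0[OF this assms(2)] show ?thesis by simp
qed

lemma crd_add: "x \<in> K \<Longrightarrow> y \<in> K \<Longrightarrow> i < n \<Longrightarrow> crd (x + y) i = crd x i + crd y i"
  by (rule crd_unique) (simp_all add: lin_add lin_crd)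

lemma crd_scale: "x \<in> K \<Longrightarrow> i < n \<Longrightarrow> crd (of_rat r * x) i = r * crd x i"
  by (rule crd_unique) (simp_all add: lin_scale lin_crd)

lemma crd_power: "j < n \<Longrightarrow> i < n \<Longrightarrow> crd (\<theta> ^ j) i = (if i = j then 1 else 0)"
  by (rule crd_unique) (simp_all add: lin_def if_distrib[of of_rat]
      if_distrib[of "\<lambda>x. x * _"] cong: if_cong)

lemma crd_sum:
  "(\<And>k. k \<in> I \<Longrightarrow> f k \<in> K) \<Longrightarrow> i < n \<Longrightarrow> crd (\<Sum>k\<in>I. f k) i = (\<Sum>k\<in>I. crd (f k) i)"
proof (induction I rule: infinite_finite_induct)
  case (insert k I)
  then show ?case by (simp add: crd_add Q_adjoin_sum)
qed (auto intro!: crd_unique simp: lin_def)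

lemma crd_mult:
  assumes "x \<in> K" "y \<in> K" "i < n"
  shows "crd (x * y) i = (\<Sum>k<n. crd (x * \<theta> ^ k) i * crd y k)"
proof -
  have "x * y = (\<Sum>k<n. of_rat (crd y k) * (x * \<theta> ^ k))"
  proof -
    have "x * lin (crd y) = (\<Sum>k<n. of_rat (crd y k) * (x * \<theta> ^ k))"
      by (simp add: lin_def sum_distrib_left mult_ac)
    then show ?thesis by (simp add: lin_crd[OF assms(2)])
  qed
  then have "crd (x * y) i = (\<Sum>k<n. crd (of_rat (crd y k) * (x * \<theta> ^ k)) i)"
    using assms by (simp add: crd_sum Q_adjoin_mult Q_adjoin_of_rat Q_adjoin_power Q_adjoin_base)
  also have "\<dots> = (\<Sum>k<n. crd (x * \<theta> ^ k) i * crd y k)"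
    using assms by (intro sum.cong refl)
      (simp add: crd_scale Q_adjoin_mult Q_adjoin_power Q_adjoin_base)
  finally show ?thesis .
qed

lemma crd_ev: assumes "degree g < n" "i < n" shows "crd (ev g \<theta>) i = of_int (coeff g i)"
  using assms by (intro crd_unique) (simp_all add: ev_altdef lin_def)

end

section \<open>Multiplication matrices and traces\<close>

text \<open>The coefficients are, up to sign, the elementary symmetric functions of the roots; the
  induction multiplies in one linear factor at a time.\<close>

lemma algebraic_int_coeff_if_roots:
  fixes p :: "complex poly"
  assumes p: "lead_coeff p = 1" and roots: "\<And>x. poly p x = 0 \<Longrightarrow> algebraic_int x"
  shows "algebraic_int (coeff p i)"
proof -
  obtain as where "smult (lead_coeff p) (\<Prod>a\<leftarrow>as. [:- a, 1:]) = p"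
    using fundamental_theorem_algebra_factorized[of p] by blast
  then have p': "p = (\<Prod>a\<leftarrow>as. [:- a, 1:])" using p by simp
  have "algebraic_int a" if "a \<in> set as" for a
    using that by (intro roots) (auto simp: p' poly_prod_list prod_list_zero_iff)
  then have "algebraic_int (coeff (\<Prod>a\<leftarrow>as. [:- a, 1:]) i)"
  proof (induction as arbitrary: i)
    case Nil
    show ?case by (cases i) auto
  next
    case (Cons a as)
    let ?q = "\<Prod>a\<leftarrow>as. [:- a, 1:]"
    have IH: "algebraic_int (coeff ?q j)" for j using Cons by simp
    have "algebraic_int (a * coeff ?q j)" for j
      using Cons.prems by (intro algebraic_int_mult IH) simp
    then show ?case using IH by (cases i) (auto intro!: algebraic_int_diff)
  qed
  then show ?thesis by (simp add: p')
qed

lemma sum_insert_index: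
  fixes f :: "nat \<Rightarrow> 'a :: ab_group_add"
  assumes "i < Suc m"
  shows "(\<Sum>k<m. f (insert_index i k)) = (\<Sum>k<Suc m. f k) - f i"
proof -
  have "inj_on (insert_index i) {..<m}" by (auto simp: inj_on_def insert_index_def split: if_splits)
  moreover have "insert_index i ` {..<m} = {..<Suc m} - {i}"
    using insert_index_image[OF assms] by (simp add: lessThan_atLeast0)
  ultimately have "(\<Sum>k<m. f (insert_index i k)) = sum f ({..<Suc m} - {i})"
    by (metis (no_types, lifting) comp_apply sum.cong sum.reindex)
  then show ?thesis using assms by (simp add: sum_diff1 del: sum.lessThan_Suc)
qed

text \<open>The derivative of the characteristic polynomial is the sum of those of the principal minors.\<close>

lemma coeff_char_poly_trace:
  fixes A :: "rat mat"
  assumes "A \<in> carrier_mat (Suc m) (Suc m)"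
  shows "coeff (char_poly A) m = - (\<Sum>i<Suc m. A $$ (i, i))"
  using assms
proof (induction m arbitrary: A)
  case 0
  have "char_poly_matrix A \<in> carrier_mat 1 1" using 0 by simp
  then have "char_poly A = char_poly_matrix A $$ (0, 0)" unfolding char_poly_def
    by (rule det_single)
  then show ?case using 0 by (simp add: char_poly_matrix_def)
next
  case (Suc m)
  let ?n = "Suc (Suc m)"
  let ?t = "\<Sum>i<?n. A $$ (i, i)"
  have minor: "coeff (char_poly (mat_delete A i i)) m = - (?t - A $$ (i, i))" if i: "i < ?n" for i
  proof -
    have "mat_delete A i i \<in> carrier_mat (Suc m) (Suc m)"
      using Suc.prems i by (simp add: mat_delete_carrier[of A ?n ?n, simplified])
    then have "coeff (char_poly (mat_delete A i i)) m = - (\<Sum>k<Suc m. mat_delete A i i $$ (k, k))"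
      by (rule Suc.IH)
    also have "(\<Sum>k<Suc m. mat_delete A i i $$ (k, k))
        = (\<Sum>k<Suc m. A $$ (insert_index i k, insert_index i k))"
      by (intro sum.cong refl) (simp add: mat_delete_index[OF Suc.prems i i])
    also have "\<dots> = ?t - A $$ (i, i)" using i by (rule sum_insert_index)
    finally show ?thesis .
  qed
  \<comment> \<open>Each diagonal entry occurs in all principal minors but one, so the coefficients
    of the minors add up to \<open>- (m + 1)\<close> times the trace; the factor
    \<open>m + 1\<close> produced by the derivative cancels.\<close>
  have "of_nat (Suc m) * coeff (char_poly A) (Suc m) = coeff (pderiv (char_poly A)) m"
    by (simp add: coeff_pderiv)
  also have "\<dots> = (\<Sum>i<?n. coeff (char_poly (mat_delete A i i)) m)"
    by (simp add: pderiv_char_poly[OF Suc.prems] coeff_sum)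
  also have "\<dots> = (\<Sum>i<?n. - (?t - A $$ (i, i)))"
    by (intro sum.cong refl minor) simp
  also have "\<dots> = ?t - of_nat ?n * ?t"
    by (simp only: sum_negf sum_subtractf sum_constant card_lessThan minus_diff_eq)
  also have "\<dots> = of_nat (Suc m) * - ?t" by (simp add: algebra_simps del: sum.lessThan_Suc)
  finally have "coeff (char_poly A) (Suc m) = - ?t"
    by (metis mult_left_cancel of_nat_neq_0)
  then show ?case .
qed

lemma rat_int_if_algebraic_int:
  assumes "algebraic_int (of_rat r :: complex)"
  shows "r = of_int \<lfloor>r\<rfloor>"
proof -
  have "of_rat r \<in> (\<int> :: complex set)" using assms by (intro rational_algebraic_int_is_int) auto
  then obtain k where "of_rat r = (of_int k :: complex)" by (auto elim: Ints_cases)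
  then have "r = of_int k" by (metis of_rat_eq_iff of_rat_of_int_eq)
  then show ?thesis by simp
qed

context power_basis
begin

definition mulmat :: "complex \<Rightarrow> rat mat" where
  "mulmat x = mat n n (\<lambda>(i, j). crd (x * \<theta> ^ j) i)"

lemma mulmat_carrier [simp]: "mulmat x \<in> carrier_mat n n"
  by (simp add: mulmat_def)

lemma K_power [simp]: "\<theta> ^ j \<in> K"
  by (intro Q_adjoin_power Q_adjoin_base)

lemma mulmat_mult:
  assumes "x \<in> K" "y \<in> K" shows "mulmat (x * y) = mulmat x * mulmat y"
proof (rule eq_matI)
  fix i j assume "i < dim_row (mulmat x * mulmat y)" "j < dim_col (mulmat x * mulmat y)"
  then have ij: "i < n" "j < n" by (simp_all add: mulmat_def)
  have "crd (x * (y * \<theta> ^ j)) i = (\<Sum>k<n. crd (x * \<theta> ^ k) i * crd (y * \<theta> ^ j) k)"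
    using assms ij by (intro crd_mult Q_adjoin_mult) simp_all
  then show "mulmat (x * y) $$ (i, j) = (mulmat x * mulmat y) $$ (i, j)"
    using ij by (simp add: mulmat_def scalar_prod_def mult.assoc lessThan_atLeast0)
qed (simp_all add: mulmat_def)

text \<open>A monic integer polynomial that annihilates \<open>x\<close> also annihilates
  multiplication by \<open>x\<close>, and therefore each eigenvalue \<open>z\<close>.\<close>

lemma char_poly_mulmat_root:
  assumes x: "x \<in> K" "algebraic_int x"
    and z: "poly (map_poly of_rat (char_poly (mulmat x))) z = 0"
  shows "algebraic_int (z :: complex)"
proof -
  define M where "M = map_mat (of_rat :: rat \<Rightarrow> complex) (mulmat x)"
  have M: "M \<in> carrier_mat n n" by (simp add: M_def)
  have "eigenvalue M z"
    using z eigenvalue_root_char_poly[OF M]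
      by (simp add: M_def of_rat_hom.char_poly_hom[OF mulmat_carrier])
  then obtain v where v: "v \<in> carrier_vec n" "v \<noteq> 0\<^sub>v n" "M *\<^sub>v v = z \<cdot>\<^sub>v v"
    using M unfolding eigenvalue_def eigenvector_def by auto
  have eig: "(\<Sum>j<n. of_rat (crd (x * \<theta> ^ j) i) * v $ j) = z * v $ i" if "i < n" for i
  proof -
    have "(M *\<^sub>v v) $ i = (\<Sum>j<n. of_rat (crd (x * \<theta> ^ j) i) * v $ j)"
      using that v(1) by (simp add: M_def mulmat_def scalar_prod_def lessThan_atLeast0)
    then show ?thesis using v(1,3) that by simp
  qed
  \<comment> \<open>\<open>L y\<close> is \<open>mulmat y\<close> applied to \<open>v\<close>, so multiplication by \<open>x\<close> inside \<open>L\<close> amounts to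
    multiplication by \<open>z\<close>.\<close>
  define L where "L = (\<lambda>y i. \<Sum>j<n. of_rat (crd (y * \<theta> ^ j) i) * v $ j)"
  have L1: "L (of_int a) i = of_int a * v $ i" if "i < n" for a i
  proof -
    have "crd (of_int a * \<theta> ^ j) i = of_int a * (if i = j then 1 else 0)" if "j < n" for j
      using crd_scale[of "\<theta> ^ j" i "of_int a"] crd_power that \<open>i < n\<close> by simp
    then have "L (of_int a) i = (\<Sum>j<n. of_rat (of_int a * (if i = j then 1 else 0)) * v $ j)"
      unfolding L_def by (intro sum.cong) auto
    also have "\<dots> = (\<Sum>j<n. if i = j then of_int a * v $ j else 0)"
      by (intro sum.cong) auto
    finally show ?thesis using that by simp
  qed
  have Ladd: "L (y + y') i = L y i + L y' i" if "y \<in> K" "y' \<in> K" "i < n" for y y' i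
    using that by (simp add: L_def distrib_right crd_add Q_adjoin_mult of_rat_add sum.distrib)
  have Lmult: "L (x * y) i = z * L y i" if "y \<in> K" "i < n" for y i
  proof -
    have "crd (x * y * \<theta> ^ j) i = (\<Sum>k<n. crd (y * \<theta> ^ k) i * crd (x * \<theta> ^ j) k)" for j
    proof -
      have "x * y * \<theta> ^ j = y * (x * \<theta> ^ j)" by simp
      then show ?thesis using that x by (simp only:) (intro crd_mult Q_adjoin_mult; simp)
    qed
    then have "L (x * y) i
        = (\<Sum>j<n. \<Sum>k<n. of_rat (crd (y * \<theta> ^ k) i) * (of_rat (crd (x * \<theta> ^ j) k) * v $ j))"
      by (simp only: L_def of_rat_sum of_rat_mult sum_distrib_right mult.assoc)
    also have "\<dots> = (\<Sum>k<n. of_rat (crd (y * \<theta> ^ k) i) * (\<Sum>j<n. of_rat (crd (x * \<theta> ^ j) k) * v $ j))"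
      by (subst sum.swap) (simp add: sum_distrib_left)
    also have "\<dots> = (\<Sum>k<n. of_rat (crd (y * \<theta> ^ k) i) * (z * v $ k))"
      by (intro sum.cong refl) (simp add: eig)
    also have "\<dots> = z * L y i" by (simp add: L_def sum_distrib_left mult_ac)
    finally show ?thesis .
  qed
  have Lev: "L (ev f x) i = ev f z * v $ i" if "i < n" for f i
  proof (induction f)
    case 0
    show ?case using L1[OF that, of 0] by simp
  next
    case (pCons a f)
    then show ?case using that x
      by (simp add: Ladd Lmult L1 Q_adjoin_mult Q_adjoin_ev Q_adjoin_of_int algebra_simps)
  qed
  obtain f where f: "lead_coeff f = 1" "ev f x = 0" using algebraic_int_obtain_ev[OF x(2)] .
  obtain i where i: "i < n" "v $ i \<noteq> 0"
    using v(1,2) by (auto simp: vec_eq_iff)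
  have "ev f z * v $ i = L (of_int 0) i" using Lev[OF i(1), of f] f by simp
  then have "ev f z = 0" using i L1[OF i(1), of 0] by simp
  then show ?thesis using f by (intro algebraic_int_if_ev)
qed

text \<open>The coefficients are rational, and they are algebraic integers because the roots
  are.\<close>

lemma char_poly_mulmat_integral:
  assumes "x \<in> K" "algebraic_int x"
  obtains P where "char_poly (mulmat x) = map_poly of_int P"
proof -
  let ?p = "char_poly (mulmat x)"
  let ?q = "map_poly of_rat ?p :: complex poly"
  have p: "degree ?p = n" "coeff ?p n = 1" using degree_monic_char_poly[OF mulmat_carrier] by auto
  have "lead_coeff ?q = 1" using p by (simp add: coeff_map_poly degree_map_poly)
  then have "algebraic_int (coeff ?q i)" for i
    using char_poly_mulmat_root[OF assms] by (rule algebraic_int_coeff_if_roots)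
  then have "coeff ?p i = of_int \<lfloor>coeff ?p i\<rfloor>" for i
    by (intro rat_int_if_algebraic_int) (simp add: coeff_map_poly)
  then have "?p = map_poly of_int (map_poly floor ?p)"
    by (intro poly_eqI) (simp add: coeff_map_poly)
  then show thesis by (rule that)
qed

section \<open>The trace form and a common denominator of the integers of K\<close>

definition tr :: "complex \<Rightarrow> rat" where
  "tr x = (\<Sum>i<n. crd (x * \<theta> ^ i) i)"

lemma tr_integral:
  assumes "x \<in> K" "algebraic_int x"
  shows "tr x = of_int \<lfloor>tr x\<rfloor>"
proof -
  obtain P where P: "char_poly (mulmat x) = map_poly of_int P"
    using char_poly_mulmat_integral[OF assms] .
  obtain m where m: "n = Suc m" using n_pos gr0_implies_Suc by blast
  have "coeff (char_poly (mulmat x)) m = - (\<Sum>i<n. mulmat x $$ (i, i))"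
    using coeff_char_poly_trace[of "mulmat x" m] m mulmat_carrier[of x] by simp
  also have "(\<Sum>i<n. mulmat x $$ (i, i)) = tr x" by (simp add: tr_def mulmat_def)
  finally have "tr x = of_int (- coeff P m)" by (simp add: P coeff_map_poly)
  then show ?thesis by simp
qed

lemma tr_add: "x \<in> K \<Longrightarrow> y \<in> K \<Longrightarrow> tr (x + y) = tr x + tr y"
  by (simp add: tr_def distrib_right crd_add Q_adjoin_mult sum.distrib)

lemma tr_scale: "x \<in> K \<Longrightarrow> tr (of_rat r * x) = r * tr x"
  by (simp add: tr_def mult.assoc crd_scale Q_adjoin_mult sum_distrib_left)

lemma tr_1: "tr 1 = of_nat n"
  by (simp add: tr_def crd_power)

lemma tr_lin: "x \<in> K \<Longrightarrow> tr (x * lin c) = (\<Sum>j<n. c j * tr (x * \<theta> ^ j))"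
proof -
  assume x: "x \<in> K"
  have "tr (\<Sum>j<k. of_rat (c j) * (x * \<theta> ^ j)) = (\<Sum>j<k. c j * tr (x * \<theta> ^ j))" for k
  proof (induction k)
    case 0
    show ?case using tr_scale[of 1 0] Q_adjoin_1 by simp
  next
    case (Suc k)
    then show ?case using x
      by (simp add: tr_add tr_scale Q_adjoin_sum Q_adjoin_mult Q_adjoin_of_rat)
  qed
  from this[of n] show ?thesis by (simp add: lin_def sum_distrib_left mult_ac)
qed

text \<open>The determinant of the trace form on the power basis is a common denominator.\<close>

lemma bounded_denominator:
  obtains N :: int where "N \<noteq> 0" "\<And>x. x \<in> K \<Longrightarrow> algebraic_int x \<Longrightarrow> of_int N * x \<in> Z_adjoin \<theta>"
proof -
  define T where "T = mat n n (\<lambda>(i, j). \<lfloor>tr (\<theta> ^ i * \<theta> ^ j)\<rfloor>)"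
  have T: "T \<in> carrier_mat n n" by (simp add: T_def)
  have Tij: "of_int (T $$ (i, j)) = tr (\<theta> ^ i * \<theta> ^ j)" if "i < n" "j < n" for i j
  proof -
    have "tr (\<theta> ^ i * \<theta> ^ j) = of_int \<lfloor>tr (\<theta> ^ i * \<theta> ^ j)\<rfloor>"
      by (intro tr_integral Q_adjoin_mult K_power algebraic_int_mult algebraic_int_power integral)
    then show ?thesis using that by (simp add: T_def)
  qed
  \<comment> \<open>A kernel vector would give a nonzero \<open>x\<close> with
    \<open>tr (x * y) = 0\<close> for all \<open>y\<close> in \<open>K\<close>, but
    \<open>tr (x * inverse x) = n\<close>.\<close>
  have "det T \<noteq> 0"
  proof
    assume "det T = 0"
    then obtain v where v: "v \<in> carrier_vec n" "v \<noteq> 0\<^sub>v n" "T *\<^sub>v v = 0\<^sub>v n"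
      using det_0_iff_vec_prod_zero[OF T] by blast
    define x where "x = lin (\<lambda>j. of_int (v $ j))"
    have xK: "x \<in> K" by (simp add: x_def lin_in_K)
    have "x \<noteq> 0"
    proof
      assume "x = 0"
      then have "v $ i = 0" if "i < n" for i using lin_eq_0[of _ i] that unfolding x_def by force
      then show False using v by (auto simp: vec_eq_iff)
    qed
    have "tr (x * \<theta> ^ i) = 0" if i: "i < n" for i
    proof -
      have "0 = (T *\<^sub>v v) $ i" using v i by simp
      also have "\<dots> = (\<Sum>j<n. T $$ (i, j) * v $ j)"
        using T v(1) i by (simp add: scalar_prod_def lessThan_atLeast0)
      finally have "(\<Sum>j<n. T $$ (i, j) * v $ j) = 0" by simp
      then have "(\<Sum>j<n. of_int (T $$ (i, j)) * of_int (v $ j)) = (0 :: rat)"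
        by (metis (no_types, lifting) of_int_0 of_int_mult of_int_sum sum.cong)
      moreover have "tr (\<theta> ^ i * x) = (\<Sum>j<n. of_int (v $ j) * tr (\<theta> ^ i * \<theta> ^ j))"
        unfolding x_def by (intro tr_lin) simp
      ultimately show ?thesis using i by (simp add: Tij mult.commute)
    qed
    then have "tr (x * lin c) = 0" for c using tr_lin[OF xK] by simp
    then have "tr (x * inverse x) = 0" using lin_crd[OF Q_adjoin_inverse[OF xK]] by metis
    then show False using \<open>x \<noteq> 0\<close> tr_1 n_pos by simp
  qed
  moreover have "of_int (det T) * x \<in> Z_adjoin \<theta>" if x: "x \<in> K" "algebraic_int x" for x
  proof -
    define s where "s = (\<lambda>i. \<lfloor>tr (x * \<theta> ^ i)\<rfloor>)"
    have s: "of_int (s i) = tr (x * \<theta> ^ i)" for i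
      using tr_integral[of "x * \<theta> ^ i"] x integral by (auto simp: s_def Q_adjoin_mult)
    have s': "of_int (s i) = (\<Sum>j<n. of_int (T $$ (i, j)) * crd x j)" if "i < n" for i
    proof -
      have "tr (\<theta> ^ i * lin (crd x)) = (\<Sum>j<n. crd x j * tr (\<theta> ^ i * \<theta> ^ j))"
        by (intro tr_lin) simp
      then show ?thesis using that x(1) by (simp add: s lin_crd Tij mult.commute)
    qed
    \<comment> \<open>Cramer's rule: the adjugate of \<open>T\<close>, applied to the integral
      traces \<open>s\<close>, gives \<open>det T\<close> times the coordinates of
      \<open>x\<close>.\<close>
    define a where "a = (\<lambda>k. \<Sum>i<n. adj_mat T $$ (k, i) * s i)"
    have "of_int (a k) = of_int (det T) * crd x k" if k: "k < n" for k
    proof -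
      have adj: "(\<Sum>i<n. adj_mat T $$ (k, i) * T $$ (i, j)) = (if k = j then det T else 0)"
        if "j < n" for j
      proof -
        have "(adj_mat T * T) $$ (k, j) = (det T \<cdot>\<^sub>m 1\<^sub>m n) $$ (k, j)" using adj_mat(3)[OF T]
          by simp
        then show ?thesis using k that T adj_mat(1)[OF T]
          by (simp add: scalar_prod_def lessThan_atLeast0)
      qed
      have "of_int (a k) = (\<Sum>i<n. \<Sum>j<n. of_int (adj_mat T $$ (k, i) * T $$ (i, j)) * crd x j)"
        by (simp only: a_def of_int_sum of_int_mult sum_distrib_left mult.assoc)
          (intro sum.cong refl, simp add: s' sum_distrib_left)
      also have "\<dots> = (\<Sum>j<n. of_int (\<Sum>i<n. adj_mat T $$ (k, i) * T $$ (i, j)) * crd x j)"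
        by (subst sum.swap) (simp add: sum_distrib_right)
      also have "\<dots> = (\<Sum>j<n. if k = j then of_int (det T) * crd x j else 0)"
        by (intro sum.cong refl) (simp add: adj)
      finally show ?thesis using k by simp
    qed
    then have "of_int (det T) * x = ev (\<Sum>i<n. monom (a i) i) \<theta>"
    proof -
      assume *: "\<And>k. k < n \<Longrightarrow> of_int (a k) = of_int (det T) * crd x k"
      have "of_int (det T) * x = of_rat (of_int (det T)) * lin (crd x)" using lin_crd[OF x(1)]
        by simp
      also have "\<dots> = lin (\<lambda>k. of_int (a k))"
        unfolding lin_scale[symmetric] by (simp add: lin_def *)
      finally show ?thesis by (simp add: lin_def ev_Poly_sum)
    qed
    then show ?thesis by (simp add: Z_adjoin_eq)
  qed
  ultimately show thesis by (rule that)
qed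

end

section \<open>Indices and characteristic polynomials\<close>

lemma Cauchy_prime_order:
  fixes G (structure)
  assumes G: "group G" "finite (carrier G)" and p: "prime p" "p dvd Coset.order G"
  obtains x where "x \<in> carrier G" "x \<noteq> \<one>\<^bsub>G\<^esub>" "x [^]\<^bsub>G\<^esub> p = \<one>\<^bsub>G\<^esub>"
proof -
  interpret group G by (rule G)
  \<comment> \<open>\<open>m\<close> may still be divisible by \<open>p\<close>: the exponent 1
    yields a subgroup of order exactly \<open>p\<close>, in which every element other than the
    identity serves.\<close>
  obtain m where m: "Coset.order G = p ^ 1 * m" using p(2) by auto
  obtain H where H: "subgroup H G" "card H = p"
    using sylow_thm[OF p(1) G(1) m G(2)] by auto
  interpret H: group "G\<lparr>carrier := H\<rparr>" by (rule subgroup.subgroup_is_group[OF H(1) G(1)])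
  have "\<not> H \<subseteq> {\<one>}"
  proof
    assume "H \<subseteq> {\<one>}"
    then have "card H \<le> 1" using card_mono[of "{\<one>}" H] by simp
    then show False using H(2) prime_gt_1_nat[OF p(1)] by simp
  qed
  then obtain x where x: "x \<in> H" "x \<noteq> \<one>" by auto
  have "x [^]\<^bsub>G\<lparr>carrier := H\<rparr>\<^esub> p = \<one>"
    using H.pow_order_eq_1[of x] x(1) H(2) by (simp add: Coset.order_def)
  then have "x [^] p = \<one>" using nat_pow_consistent by metis
  moreover have "x \<in> carrier G" using subgroup.subset[OF H(1)] x(1) by auto
  ultimately show thesis using x(2) that by blast
qed

text \<open>By Cauchy's theorem a prime dividing the index would be the order of an element of the
  quotient group.\<close>

lemma prime_not_dvd_card_quotient:
  fixes A H :: "complex set"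
  assumes A: "0 \<in> A" "\<And>x y. x \<in> A \<Longrightarrow> y \<in> A \<Longrightarrow> x - y \<in> A"
    and H: "H \<subseteq> A" "0 \<in> H" "\<And>x y. x \<in> H \<Longrightarrow> y \<in> H \<Longrightarrow> x - y \<in> H"
    and fin: "finite (A // {(x, y). x \<in> A \<and> y \<in> A \<and> x - y \<in> H})" (is "finite (A // ?R)")
    and p: "prime p" and tor: "\<And>x. x \<in> A \<Longrightarrow> of_nat p * x \<in> H \<Longrightarrow> x \<in> H"
  shows "\<not> p dvd card (A // {(x, y). x \<in> A \<and> y \<in> A \<and> x - y \<in> H})"
proof
  assume dvd: "p dvd card (A // ?R)"
  have Aneg: "- x \<in> A" if "x \<in> A" for x using A(2)[OF A(1) that] by simp
  have Aadd: "x + y \<in> A" if "x \<in> A" "y \<in> A" for x y using A(2)[OF that(1) Aneg[OF that(2)]] by simp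
  have Hneg: "- x \<in> H" if "x \<in> H" for x using H(3)[OF H(2) that] by simp
  have Hadd: "x + y \<in> H" if "x \<in> H" "y \<in> H" for x y using H(3)[OF that(1) Hneg[OF that(2)]] by simp
  define G where "G = \<lparr>carrier = A, monoid.mult = (+), one = (0 :: complex)\<rparr>"
  have G: "comm_group G" unfolding G_def
    by (rule comm_groupI) (auto simp: A(1) Aadd add_ac intro!: bexI[of _ "- _"] Aneg)
  interpret comm_group G by (rule G)
  have carr: "carrier G = A" and mult: "x \<otimes>\<^bsub>G\<^esub> y = x + y" and one: "\<one>\<^bsub>G\<^esub> = 0" for x y
    by (simp_all add: G_def)
  have inv: "inv\<^bsub>G\<^esub> x = - x" if "x \<in> A" for x
    using that Aneg by (intro inv_equality) (simp_all add: carr mult one)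
  have sub: "subgroup H G"
    by (intro subgroupI) (use H Hadd Hneg in \<open>auto simp: carr mult inv subset_iff\<close>)
  then have norm: "H \<lhd> G" by (rule subgroup_imp_normal)
  interpret N: normal H G by (rule norm)
  have coset: "?R `` {x} = H #>\<^bsub>G\<^esub> x" if "x \<in> A" for x
  proof (intro equalityI subsetI)
    fix y assume "y \<in> ?R `` {x}"
    then have "x - y \<in> H" by simp
    then have "- (x - y) \<in> H" by (rule Hneg)
    moreover have "y = (- (x - y)) + x" by simp
    ultimately show "y \<in> H #>\<^bsub>G\<^esub> x" unfolding r_coset_def mult by blast
  next
    fix y assume "y \<in> H #>\<^bsub>G\<^esub> x"
    then obtain h where "h \<in> H" "y = h + x" unfolding r_coset_def mult by blast
    then show "y \<in> ?R `` {x}" using that Hneg[of h] H(1) Aadd by auto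
  qed
  define Q where "Q = G Mod H"
  have quot: "A // ?R = carrier Q"
  proof -
    have "(\<Union>x\<in>A. {?R `` {x}}) = (\<Union>x\<in>A. {H #>\<^bsub>G\<^esub> x})"
      by (rule SUP_cong[OF refl]) (simp only: coset)
    then show ?thesis unfolding quotient_def Q_def FactGroup_def RCOSETS_def carr by simp
  qed
  have grp: "group Q" unfolding Q_def by (rule N.factorgroup_is_group)
  obtain C where C: "C \<in> carrier Q" "C \<noteq> \<one>\<^bsub>Q\<^esub>" "C [^]\<^bsub>Q\<^esub> p = \<one>\<^bsub>Q\<^esub>"
    using Cauchy_prime_order[OF grp _ p] fin dvd unfolding quot Coset.order_def by blast
  obtain x where x: "x \<in> A" "C = H #>\<^bsub>G\<^esub> x"
    using C(1) unfolding Q_def FactGroup_def RCOSETS_def carr by auto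
  have px: "of_nat k * x \<in> A" for k by (induction k) (auto simp: distrib_right A(1) x(1) Aadd)
  have "C [^]\<^bsub>Q\<^esub> k = H #>\<^bsub>G\<^esub> (of_nat k * x)" for k :: nat
  proof (induction k)
    case 0
    have "H #>\<^bsub>G\<^esub> 0 = H" using coset_join2[of 0 H] sub A(1) H(2) by (simp add: carr)
    then show ?case by (simp add: Q_def FactGroup_def)
  next
    case (Suc k)
    then have "C [^]\<^bsub>Q\<^esub> Suc k = (H #>\<^bsub>G\<^esub> (of_nat k * x)) <#>\<^bsub>G\<^esub> (H #>\<^bsub>G\<^esub> x)"
      by (simp add: Q_def FactGroup_def x(2))
    also have "\<dots> = H #>\<^bsub>G\<^esub> (of_nat k * x + x)"
      using N.rcos_sum[of "of_nat k * x" x] px x(1) by (simp add: carr mult)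
    finally show ?case by (simp add: algebra_simps)
  qed
  then have "H #>\<^bsub>G\<^esub> (of_nat p * x) = H" using C(3) by (simp add: Q_def FactGroup_def)
  moreover have "of_nat p * x \<in> carrier G" using px[of p] by (simp add: carr)
  ultimately have "of_nat p * x \<in> H" using sub by (rule coset_join1)
  then have "x \<in> H" by (rule tor[OF x(1)])
  then have "C = H" using x sub coset_join2[of x H] by (simp add: carr)
  then show False using C(2) by (simp add: Q_def FactGroup_def)
qed

lemma det_cong_int:
  fixes A B :: "int mat"
  assumes "A \<in> carrier_mat n n" "B \<in> carrier_mat n n"
    and "\<And>i j. i < n \<Longrightarrow> j < n \<Longrightarrow> [A $$ (i, j) = B $$ (i, j)] (mod p)"
  shows "[det A = det B] (mod p)"
  unfolding det_def'[OF assms(1)] det_def'[OF assms(2)]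
  by (intro cong_sum cong_mult cong_refl cong_prod assms(3)) (auto dest: permutes_in_image)

text \<open>Pseudo-division by \<open>g\<close> reduces the numerators at the cost of a power of its
  leading coefficient, which the rational scalars absorb. So the dimension of \<rat>(y) is at most
  the degree of any nonzero integer polynomial vanishing at \<open>y\<close>.\<close>

lemma dim_le_degree:
  assumes y: "algebraic_int y" and g: "g \<noteq> 0" "ev g y = 0"
  shows "Q_adjoin y \<subseteq> rat_vs.span ((\<lambda>i. y ^ i) ` {..<degree g})"
proof
  fix x assume "x \<in> Q_adjoin y"
  then obtain f k where fk: "k \<noteq> 0" "x = ev f y / of_int k" unfolding Q_adjoin_eq[OF y] by blast
  obtain s r where sr: "pseudo_divmod f g = (s, r)" by fastforce
  define c where "c = lead_coeff g ^ (Suc (degree f) - degree g)"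
  have c: "c \<noteq> 0" using g by (simp add: c_def)
  have "smult c f = g * s + r" and r: "r = 0 \<or> degree r < degree g"
    using pseudo_divmod[OF g(1) sr] by (simp_all add: c_def)
  then have cf: "of_int c * ev f y = ev r y" using g(2)
    by (metis ev_add ev_mult ev_smult mult_zero_left add_0)
  have "x = ev r y / of_int (c * k)" using fk(1) c by (simp add: fk(2) flip: cf)
  also have "ev r y = (\<Sum>i<degree g. of_int (coeff r i) * y ^ i)"
    using r by (auto intro: ev_altdef)
  finally have "x = (\<Sum>i<degree g. of_rat (of_int (coeff r i) / of_int (c * k)) * y ^ i)"
    by (simp add: sum_divide_distrib of_rat_divide of_rat_mult)
  also have "\<dots> \<in> rat_vs.span ((\<lambda>i. y ^ i) ` {..<degree g})"
    by (intro rat_vs.span_sum rat_vs.span_scale rat_vs.span_base) auto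
  finally show "x \<in> rat_vs.span ((\<lambda>i. y ^ i) ` {..<degree g})" .
qed

text \<open>The columns of \<open>M\<close> hold the coordinates, so the vector of the basis
  elements is an eigenvector, with eigenvalue \<open>y\<close>, of the transpose, which has the same
  characteristic polynomial.\<close>

lemma char_poly_mult_matrix_root:
  assumes M: "is_mult_matrix bs y M" and j: "j < length bs" "bs ! j \<noteq> 0"
  shows "poly (map_poly of_rat (char_poly M)) y = 0"
proof -
  let ?n = "length bs"
  have Mc: "M \<in> carrier_mat ?n ?n"
    and eq: "\<And>j. j < ?n \<Longrightarrow> y * bs ! j = (\<Sum>i<?n. of_rat (M $$ (i, j)) * bs ! i)"
    using M by (auto simp: is_mult_matrix_def)
  define C where "C = transpose_mat (map_mat (of_rat :: rat \<Rightarrow> complex) M)"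
  have C: "C \<in> carrier_mat ?n ?n" using Mc by (simp add: C_def)
  have "eigenvector C (vec ?n (\<lambda>i. bs ! i)) y"
    unfolding eigenvector_def
  proof (intro conjI)
    show "vec ?n (\<lambda>i. bs ! i) \<noteq> 0\<^sub>v (dim_row C)" using j C by (auto simp: vec_eq_iff)
    show "C *\<^sub>v vec ?n (\<lambda>i. bs ! i) = y \<cdot>\<^sub>v vec ?n (\<lambda>i. bs ! i)"
      using C Mc by (intro eq_vecI) (auto simp: C_def scalar_prod_def eq lessThan_atLeast0)
  qed (use C in simp)
  then have "poly (char_poly C) y = 0"
    using eigenvalue_root_char_poly[OF C] unfolding eigenvalue_def by blast
  also have "char_poly C = char_poly (map_mat of_rat M)"
    unfolding C_def using Mc by (intro char_poly_transpose_mat) simp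
  finally show ?thesis by (simp add: of_rat_hom.char_poly_hom[OF Mc])
qed

context power_basis
begin

text \<open>For a common denominator \<open>N\<close>, the class of \<open>x\<close> is determined
  by the \<open>n\<close> coefficients of \<open>N * x\<close> modulo \<open>N\<close>.\<close>

lemma finite_quotient:
  "finite (ring_of_integers K //
    {(x, y). x \<in> ring_of_integers K \<and> y \<in> ring_of_integers K \<and> x - y \<in> Z_adjoin \<theta>})"
  (is "finite (?A // ?R)")
proof -
  obtain N where N: "N \<noteq> 0" "\<And>x. x \<in> K \<Longrightarrow> algebraic_int x \<Longrightarrow> of_int N * x \<in> Z_adjoin \<theta>"
    using bounded_denominator by metis
  have "\<exists>g. x \<in> ?A \<longrightarrow> degree g < n \<and> of_int N * x = ev g \<theta>" for x
    using N(2)[of x] Z_adjoinE unfolding ring_of_integers_def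
      by (metis (no_types, lifting) mem_Collect_eq)
  then obtain g where g: "\<And>x. x \<in> ?A \<Longrightarrow> degree (g x) < n" "\<And>x. x \<in> ?A \<Longrightarrow> of_int N * x = ev (g x) \<theta>"
    by metis
  define r where "r = (\<lambda>x. \<lambda>i\<in>{..<n}. coeff (g x) i mod \<bar>N\<bar>)"
  have eq: "x - y \<in> Z_adjoin \<theta>" if "x \<in> ?A" "y \<in> ?A" "r x = r y" for x y
  proof -
    have "[:N:] dvd g x - g y"
    proof (subst const_poly_dvd_iff, intro allI)
      fix i
      show "N dvd coeff (g x - g y) i"
      proof (cases "i < n")
        case True
        then have "coeff (g x) i mod \<bar>N\<bar> = coeff (g y) i mod \<bar>N\<bar>"
          using fun_cong[OF that(3), of i] by (simp add: r_def)
        then show ?thesis by (simp add: mod_eq_dvd_iff)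
      next
        case False
        then show ?thesis using g(1)[OF that(1)] g(1)[OF that(2)] by (simp add: coeff_eq_0)
      qed
    qed
    then obtain h where h: "g x - g y = [:N:] * h" ..
    have "of_int N * (x - y) = ev (g x - g y) \<theta>" using g(2) that by (simp add: algebra_simps)
    also have "\<dots> = of_int N * ev h \<theta>" by (simp add: h)
    finally have "x - y = ev h \<theta>" using N(1) by simp
    then show ?thesis by (simp add: Z_adjoin_eq)
  qed
  have "r ` ?A \<subseteq> {..<n} \<rightarrow>\<^sub>E {0..<\<bar>N\<bar>}" 
    unfolding r_def by (intro image_subsetI) (simp only: restrict_PiE_iff, simp add: N(1))
  then have fin: "finite (r ` ?A)" by (rule finite_subset) (intro finite_PiE; simp)
  have add: "x - z \<in> Z_adjoin \<theta>" if "x - y \<in> Z_adjoin \<theta>" "y - z \<in> Z_adjoin \<theta>" for x y z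
  proof -
    from that obtain f f' where "x - y = ev f \<theta>" "y - z = ev f' \<theta>" unfolding Z_adjoin_eq by blast
    then have "x - z = ev (f + f') \<theta>" by (simp add: algebra_simps)
    then show ?thesis unfolding Z_adjoin_eq by blast
  qed
  have "?A // ?R \<subseteq> (\<lambda>v. ?R `` {SOME x. x \<in> ?A \<and> r x = v}) ` (r ` ?A)"
  proof
    fix C assume "C \<in> ?A // ?R"
    then obtain x where x: "x \<in> ?A" "C = ?R `` {x}" by (auto elim: quotientE)
    define x' where "x' = (SOME x'. x' \<in> ?A \<and> r x' = r x)"
    have x': "x' \<in> ?A" "r x' = r x"
      using x(1) someI[of "\<lambda>x'. x' \<in> ?A \<and> r x' = r x" x] by (auto simp: x'_def)
    have e: "x - x' \<in> Z_adjoin \<theta>" "x' - x \<in> Z_adjoin \<theta>" using x(1) x' by (auto intro: eq)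
    have "?R `` {x} = ?R `` {x'}"
      using x(1) x'(1) by (auto intro: add[OF e(1)] add[OF e(2)])
    then show "C \<in> (\<lambda>v. ?R `` {SOME x. x \<in> ?A \<and> r x = v}) ` (r ` ?A)"
      using x by (auto simp: x'_def)
  qed
  then show ?thesis using fin finite_subset by blast
qed

lemma prime_not_dvd_elem_index:
  assumes p: "prime p"
    and tor: "\<And>x. algebraic_int x \<Longrightarrow> of_int (int p) * x \<in> Z_adjoin \<theta> \<Longrightarrow> x \<in> Z_adjoin \<theta>"
  shows "\<not> p dvd elem_index K \<theta>"
  unfolding elem_index_def
proof (rule prime_not_dvd_card_quotient[OF _ _ _ _ _ finite_quotient p])
  show "Z_adjoin \<theta> \<subseteq> ring_of_integers K"
    unfolding Z_adjoin_eq ring_of_integers_def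
    using algebraic_int_ev[OF integral] by (auto intro: Q_adjoin_ev Q_adjoin_base)
  show "0 \<in> ring_of_integers K" using Q_adjoin_of_int[of 0] by (auto simp: ring_of_integers_def)
  show "0 \<in> Z_adjoin \<theta>" unfolding Z_adjoin_eq by (rule range_eqI[of _ _ 0]) simp
  show "x - y \<in> ring_of_integers K" if "x \<in> ring_of_integers K" "y \<in> ring_of_integers K" for x y
    using that by (auto simp: ring_of_integers_def Q_adjoin_diff)
  show "x - y \<in> Z_adjoin \<theta>" if "x \<in> Z_adjoin \<theta>" "y \<in> Z_adjoin \<theta>" for x y
  proof -
    from that obtain f g where "x = ev f \<theta>" "y = ev g \<theta>" unfolding Z_adjoin_eq by blast
    then have "x - y = ev (f - g) \<theta>" by simp
    then show ?thesis unfolding Z_adjoin_eq by blast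
  qed
  show "x \<in> Z_adjoin \<theta>" if "x \<in> ring_of_integers K" "of_nat p * x \<in> Z_adjoin \<theta>" for x
  proof (rule tor)
    show "algebraic_int x" using that(1) by (simp add: ring_of_integers_def)
  qed (use that(2) in simp)
qed

section \<open>Dimension over \<rat> and independence of the characteristic polynomial from the
  basis\<close>

lemma inj_power: "inj_on (\<lambda>i. \<theta> ^ i) {..<n}"
  by (rule inj_onI) (metis crd_power lessThan_iff zero_neq_one)

lemma independent_powers: "rat_vs.independent ((\<lambda>i. \<theta> ^ i) ` {..<n})"
proof (rule rat_vs.independent_if_scalars_zero)
  fix f x assume "(\<Sum>x\<in>(\<lambda>i. \<theta> ^ i) ` {..<n}. of_rat (f x) * x) = 0" and x: "x \<in> (\<lambda>i. \<theta> ^ i) ` {..<n}"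
  then have "lin (\<lambda>i. f (\<theta> ^ i)) = 0" by (simp add: lin_def sum.reindex[OF inj_power])
  then show "f x = 0" using x lin_eq_0[of "\<lambda>i. f (\<theta> ^ i)"] by auto
qed simp

lemma span_powers: "rat_vs.span ((\<lambda>i. \<theta> ^ i) ` {..<n}) = K"
proof
  show "K \<subseteq> rat_vs.span ((\<lambda>i. \<theta> ^ i) ` {..<n})"
  proof (rule dim_le_degree[OF integral _ root])
    show "F \<noteq> 0" using monic by auto
  qed
  have "rat_vs.subspace K"
    using Q_adjoin_of_int[of 0]
    by (auto simp: rat_vs.subspace_def intro: Q_adjoin_add Q_adjoin_mult Q_adjoin_of_rat)
  then show "rat_vs.span ((\<lambda>i. \<theta> ^ i) ` {..<n}) \<subseteq> K" by (intro rat_vs.span_minimal) auto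
qed

lemma powers_subset: "(\<lambda>i. \<theta> ^ i) ` {..<n} \<subseteq> K"
  by auto

lemma card_powers: "card ((\<lambda>i. \<theta> ^ i) ` {..<n}) = n"
  by (simp add: card_image[OF inj_power])

lemma is_Q_basis_length:
  assumes "is_Q_basis bs K" shows "length bs = n"
proof -
  have bs: "distinct bs" "rat_vs.independent (set bs)" "rat_vs.span (set bs) = K"
    using assms by (auto simp: is_Q_basis_def)
  have "card (set bs) \<le> n"
    using rat_vs.independent_span_bound[OF _ bs(2), of "(\<lambda>i. \<theta> ^ i) ` {..<n}"]
      rat_vs.span_superset[of "set bs"] bs(3) by (simp add: span_powers card_powers)
  moreover have "n \<le> card (set bs)"
    using rat_vs.independent_span_bound[OF finite_set independent_powers, of bs] powers_subset
    unfolding bs(3) card_powers by blast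
  ultimately show ?thesis using bs(1) by (simp add: distinct_card)
qed

lemma minimal_if_primitive:
  assumes "algebraic_int y" "Q_adjoin y = K" "ev g y = 0" "degree g < n"
  shows "g = 0"
proof (rule ccontr)
  assume "g \<noteq> 0"
  then have "K \<subseteq> rat_vs.span ((\<lambda>i. y ^ i) ` {..<degree g})"
    using dim_le_degree[OF assms(1) _ assms(3)] assms(2) by simp
  then have "n \<le> card ((\<lambda>i. y ^ i) ` {..<degree g})"
    using rat_vs.independent_span_bound[OF _ independent_powers, of "(\<lambda>i. y ^ i) ` {..<degree g}"]
      powers_subset unfolding card_powers by blast
  also have "\<dots> \<le> degree g" using card_image_le[of "{..<degree g}" "\<lambda>i. y ^ i"] by simp
  finally show False using assms(4) by simp
qed

definition power_list :: "complex list" where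
  "power_list = map (\<lambda>i. \<theta> ^ i) [0..<n]"

lemma is_Q_basis_powers: "is_Q_basis power_list K"
  unfolding is_Q_basis_def power_list_def
  using inj_power independent_powers span_powers
  by (simp add: distinct_map lessThan_atLeast0)

lemma is_mult_matrix_powers: "y \<in> K \<Longrightarrow> is_mult_matrix power_list y (mulmat y)"
  unfolding is_mult_matrix_def power_list_def
  using lin_crd[of "y * \<theta> ^ _"] by (auto simp: mulmat_def lin_def Q_adjoin_mult)

lemma primitive_power_basis:
  assumes y: "y \<in> primitive_integers K"
    and P: "char_poly (mulmat y) = map_poly of_int P"
  shows "power_basis y P" "degree P = n"
proof -
  have y': "y \<in> K" "algebraic_int y" "Q_adjoin y = K"
    using y by (auto simp: primitive_integers_def ring_of_integers_def)
  have deg: "degree P = n" and lead: "lead_coeff P = 1"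
    using degree_monic_char_poly[OF mulmat_carrier, of y]
      by (simp_all add: P coeff_map_poly degree_map_poly)
  then show "degree P = n" by simp
  have "poly (map_poly of_rat (char_poly (mulmat y))) y = 0"
    using n_pos by (intro char_poly_mult_matrix_root[OF is_mult_matrix_powers[OF y'(1)], of 0])
      (simp_all add: power_list_def)
  then have "ev P y = 0" by (simp add: ev_def P map_poly_map_poly o_def)
  then show "power_basis y P"
    using lead deg minimal_if_primitive[OF y'(2,3)] by unfold_locales auto
qed

text \<open>Every candidate is monic of degree \<open>n\<close> and vanishes at \<open>y\<close>, so
  its difference from \<open>P\<close> has degree below \<open>n\<close> and is 0 by minimality.
  This replaces a change of basis.\<close>

lemma field_char_poly_eq:
  assumes y: "y \<in> primitive_integers K"
    and P: "char_poly (mulmat y) = map_poly of_int P"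
  shows "field_char_poly K y = P"
  unfolding field_char_poly_def
proof (rule the_equality)
  have yK: "y \<in> K" using y by (auto simp: primitive_integers_def ring_of_integers_def)
  show "\<exists>bs M. is_Q_basis bs K \<and> is_mult_matrix bs y M \<and> map_poly rat_of_int P = char_poly M"
    using is_Q_basis_powers is_mult_matrix_powers[OF yK] P by metis
  fix F' assume "\<exists>bs M. is_Q_basis bs K \<and> is_mult_matrix bs y M \<and> map_poly rat_of_int F' =
      char_poly M"
  then obtain bs M where bs: "is_Q_basis bs K" "is_mult_matrix bs y M" "map_poly rat_of_int F' =
      char_poly M"
    by blast
  note len = is_Q_basis_length[OF bs(1)]
  have M: "M \<in> carrier_mat n n" using bs(2) len by (simp add: is_mult_matrix_def)
  have F': "degree F' = n" "lead_coeff F' = 1"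
    using degree_monic_char_poly[OF M] by (simp_all flip: bs(3) add: coeff_map_poly degree_map_poly)
  have "bs ! 0 \<in> set bs" using len n_pos by simp
  then have "bs ! 0 \<noteq> 0" using bs(1) rat_vs.dependent_zero by (auto simp: is_Q_basis_def)
  then have "poly (map_poly of_rat (char_poly M)) y = 0"
    using char_poly_mult_matrix_root[OF bs(2), of 0] len n_pos by simp
  then have root': "ev F' y = 0" by (simp add: ev_def map_poly_map_poly o_def flip: bs(3))
  interpret y: power_basis y P by (rule primitive_power_basis[OF y P])
  have degP: "degree P = n" by (rule primitive_power_basis[OF y P])
  have "degree (F' - P) < n"
  proof -
    have "degree (F' - P) \<le> n" using F' degP by (intro degree_diff_le) auto
    moreover have "coeff (F' - P) n = 0" using F' degP y.monic by simp
    ultimately show ?thesis using n_pos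
      by (metis le_neq_implies_less leading_coeff_0_iff degree_0)
  qed
  then have "F' - P = 0" using root' y.root degP by (intro y.minimal) auto
  then show "F' = P" by simp
qed

text \<open>The determinant is the norm of \<open>a - y\<close>: values of the characteristic
  polynomial become norms, to which multiplicativity applies.\<close>

lemma det_mulmat_diff:
  assumes "y \<in> K" "char_poly (mulmat y) = map_poly of_int P"
  shows "det (mulmat (of_int a - y)) = of_int (poly P a)"
proof -
  have "- (char_matrix (mulmat y) (of_int a)) = mulmat (of_int a - y)"
  proof (rule eq_matI)
    fix i j assume "i < dim_row (mulmat (of_int a - y))" "j < dim_col (mulmat (of_int a - y))"
    then have ij: "i < n" "j < n" by (simp_all add: mulmat_def)
    have "(of_int a - y) * \<theta> ^ j = of_rat (of_int a) * \<theta> ^ j + of_rat (- 1) * (y * \<theta> ^ j)"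
      by (simp add: algebra_simps)
    then have "crd ((of_int a - y) * \<theta> ^ j) i = of_int a * (if i = j then 1 else 0)
        - crd (y * \<theta> ^ j) i"
      using ij assms(1) crd_scale[of _ i "- 1"]
      by (simp only: crd_add crd_scale crd_power Q_adjoin_mult Q_adjoin_of_rat K_power)
    then show "(- (char_matrix (mulmat y) (of_int a))) $$ (i, j) = mulmat (of_int a - y) $$ (i, j)"
      using ij by (simp add: char_matrix_def mulmat_def)
  qed (simp_all add: char_matrix_def mulmat_def)
  then have "det (mulmat (of_int a - y)) = poly (char_poly (mulmat y)) (of_int a)"
    using char_poly_matrix[OF mulmat_carrier, of y "of_int a"] by simp
  then show ?thesis by (simp add: assms(2))
qed

text \<open>Modulo \<open>p\<close>, multiplication by \<open>ev g \<theta>\<close> is the identity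
  on \<int>[\<theta>], so its integer matrix is congruent to the unit matrix.\<close>

lemma det_mulmat_ev:
  assumes "degree g < n" "[:p:] dvd g - 1"
  obtains d where "det (mulmat (ev g \<theta>)) = of_int d" "[d = 1] (mod p)"
proof -
  have red: "\<exists>h. degree h < n \<and> ev g \<theta> * \<theta> ^ j = ev h \<theta> \<and> [:p:] dvd h - monom 1 j" if "j < n" for j
  proof -
    obtain e where e: "g - 1 = [:p:] * e" using assms(2) ..
    obtain s r where r: "e * monom 1 j = F * s + r" "degree r < n" "ev (e * monom 1 j) \<theta> = ev r \<theta>"
      using ev_reduce .
    have "g = 1 + [:p:] * e" using e by (simp add: algebra_simps)
    then have "ev g \<theta> * \<theta> ^ j = ev (monom 1 j + [:p:] * r) \<theta>"
      using r(3) by (simp add: algebra_simps)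
    moreover have "degree (monom 1 j + [:p:] * r) < n"
      using that r(2) by (intro degree_add_less)
        (auto simp: degree_monom_eq intro: le_less_trans[OF degree_smult_le])
    moreover have "[:p:] dvd (monom 1 j + [:p:] * r) - monom 1 j"
      by (simp only: add_diff_cancel_left' dvd_triv_left)
    ultimately show ?thesis by blast
  qed
  then obtain h where h: "\<And>j. j < n \<Longrightarrow> degree (h j) < n"
    "\<And>j. j < n \<Longrightarrow> ev g \<theta> * \<theta> ^ j = ev (h j) \<theta>"
    "\<And>j. j < n \<Longrightarrow> [:p:] dvd h j - monom 1 j"
    by metis
  define B where "B = mat n n (\<lambda>(i, j). coeff (h j) i)"
  have B: "B \<in> carrier_mat n n" by (simp add: B_def)
  have "mulmat (ev g \<theta>) = map_mat of_int B"
    by (rule eq_matI) (simp_all add: mulmat_def B_def h crd_ev)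
  then have "det (mulmat (ev g \<theta>)) = of_int (det B)" by simp
  moreover have "[det B = det (1\<^sub>m n)] (mod p)"
  proof (rule det_cong_int[OF B])
    fix i j assume ij: "i < n" "j < n"
    have "p dvd coeff (h j - monom 1 j) i" using h(3)[OF ij(2)] by (simp add: const_poly_dvd_iff)
    then show "[B $$ (i, j) = 1\<^sub>m n $$ (i, j)] (mod p)"
      using ij by (cases "i = j") (simp_all add: B_def cong_iff_dvd_diff)
  qed simp
  ultimately show thesis using that by simp
qed

end

section \<open>Common divisors of polynomial values\<close>

lemma elem_value_gcd_dvd: "elem_value_gcd K y dvd poly (field_char_poly K y) a"
  unfolding elem_value_gcd_def by (rule Gcd_dvd) simp

text \<open>The primitive part of a nonzero polynomial vanishing at \<open>\<theta>\<close> is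
  nonzero modulo \<open>p\<close>. In degree below that of \<open>F\<close> it would be invertible
  modulo \<open>F\<close> and \<open>p\<close>, and evaluation at \<open>\<theta>\<close> would make
  \<open>p\<close> divide 1.\<close>

lemma power_basis_if_irreducible_mod:
  assumes p: "prime p" and F: "irreducible_mod p F" and root: "ev F \<theta> = 0"
  shows "power_basis \<theta> F"
proof
  show lead: "lead_coeff F = 1" using F by (simp add: irreducible_mod_def)
  have int: "algebraic_int \<theta>" using algebraic_int_if_ev[OF lead root] .
  show "ev F \<theta> = 0" by (rule root)
  fix g assume g: "ev g \<theta> = 0" "degree g < degree F"
  show "g = 0"
  proof (rule ccontr)
    assume "g \<noteq> 0"
    define h where "h = primitive_part g"
    have gh: "g = smult (content g) h" by (simp add: h_def)
    have h0: "ev h \<theta> = 0"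
    proof -
      have "of_int (content g) * ev h \<theta> = 0" using g(1) by (subst (asm) gh) simp
      then show ?thesis using \<open>g \<noteq> 0\<close> by simp
    qed
    have "\<not> [:p:] dvd h"
    proof
      assume "[:p:] dvd h"
      then have "p dvd content h" by (simp add: const_poly_dvd_iff_dvd_content)
      then show False using \<open>g \<noteq> 0\<close> prime_gt_1_int[OF p] by (simp add: h_def)
    qed
    moreover have "degree h < degree F" using g(2) by (simp add: h_def)
    ultimately obtain u v w where "u * h + v * F = 1 + [:p:] * w"
      using irreducible_mod_bezout[OF p F] by blast
    then have "ev (u * h + v * F) \<theta> = ev (1 + [:p:] * w) \<theta>" by simp
    then have "0 = 1 + of_int p * ev w \<theta>" by (simp add: h0 root)
    then have *: "of_int 1 = of_int p * (- ev w \<theta>)"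
      by (simp add: eq_neg_iff_add_eq_0)
    have "p dvd 1" by (rule algebraic_int_dvd[OF _ *])
      (intro algebraic_int_minus algebraic_int_ev int)
    then show False using p by auto
  qed
qed

context power_basis
begin

lemma det_mulmat_integral:
  assumes "x \<in> K" "algebraic_int x"
  obtains c where "det (mulmat x) = of_int c"
proof -
  have "- x \<in> K" "algebraic_int (- x)" using assms by (auto intro: Q_adjoin_uminus)
  then obtain P where "char_poly (mulmat (- x)) = map_poly of_int P"
    using char_poly_mulmat_integral by blast
  from det_mulmat_diff[OF \<open>- x \<in> K\<close> this, of 0] show thesis using that by simp
qed

text \<open>The least positive \<open>k\<close> with \<open>k * y\<close> in \<int>[\<theta>] is
  prime to \<open>p\<close>: if \<open>k = p * l\<close>, then \<open>tor\<close> applied to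
  \<open>l * y\<close> contradicts minimality.\<close>

lemma coprime_denominator:
  assumes p: "prime p" and tor: "\<And>x. algebraic_int x \<Longrightarrow> of_int p * x \<in> Z_adjoin \<theta> \<Longrightarrow> x \<in> Z_adjoin \<theta>"
    and y: "y \<in> K" "algebraic_int y"
  obtains k where "\<not> p dvd int k" "of_nat k * y \<in> Z_adjoin \<theta>"
proof -
  define P where "P = (\<lambda>k. 0 < k \<and> of_nat k * y \<in> Z_adjoin \<theta>)"
  obtain N where N: "N \<noteq> 0" "of_int N * y \<in> Z_adjoin \<theta>"
    using bounded_denominator y by metis
  then obtain g where g: "of_int N * y = ev g \<theta>" unfolding Z_adjoin_eq by blast
  have "of_nat (nat \<bar>N\<bar>) * y = ev (if N \<ge> 0 then g else - g) \<theta>"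
    using g by (auto simp: abs_if)
  then have "P (nat \<bar>N\<bar>)" using N(1) unfolding P_def Z_adjoin_eq by auto
  define k where "k = (LEAST k. P k)"
  have k: "P k" unfolding k_def using \<open>P (nat \<bar>N\<bar>)\<close> by (rule LeastI)
  have "\<not> p dvd int k"
  proof
    assume "p dvd int k"
    then obtain l where l: "int k = p * l" ..
    have "0 < p" "0 < int k" using p k by (auto simp: P_def prime_gt_0_int)
    then have "0 < l" using l by (metis zero_less_mult_pos)
    then have kl: "k = nat p * nat l" using l \<open>0 < p\<close>
      by (metis nat_int nat_mult_distrib order_less_imp_le)
    have ky: "of_int p * (of_nat (nat l) * y) = of_nat k * y"
      using \<open>0 < p\<close> by (simp add: kl)
    have "algebraic_int (of_nat (nat l) * y)"
      by (intro algebraic_int_mult y(2) int_imp_algebraic_int) simp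
    moreover have "of_int p * (of_nat (nat l) * y) \<in> Z_adjoin \<theta>"
      unfolding ky using k by (simp only: P_def)
    ultimately have "of_nat (nat l) * y \<in> Z_adjoin \<theta>" by (rule tor)
    then have "P (nat l)" using \<open>0 < l\<close> by (simp add: P_def)
    moreover have "nat l < k"
      using \<open>0 < l\<close> prime_gt_1_int[OF p] by (simp add: kl)
    ultimately show False unfolding k_def using not_less_Least by blast
  qed
  then show thesis using k that unfolding P_def by blast
qed

text \<open>Up to a factor \<open>k\<close> prime to \<open>p\<close>, \<open>y\<close> is
  \<open>ev g \<theta>\<close>. If \<open>p\<close> did not divide \<open>g\<close>, some integral
  multiple of \<open>y\<close> would be congruent to 1 modulo \<open>p\<close> and have norm
  congruent to 1, whereas its norm is a multiple of \<open>c\<close>.\<close>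

lemma inert_dvd:
  assumes p: "prime p" and F: "irreducible_mod p F"
    and y: "y \<in> K" "algebraic_int y" and c: "det (mulmat y) = of_int c" "p dvd c"
  obtains z where "algebraic_int z" "y = of_int p * z"
proof -
  obtain k where k: "\<not> p dvd int k" "of_nat k * y \<in> Z_adjoin \<theta>"
    using coprime_denominator[OF p no_torsion_irreducible[OF p F] y] .
  obtain g where g: "degree g < n" "of_nat k * y = ev g \<theta>" using Z_adjoinE[OF k(2)] .
  have "[:p:] dvd g"
  proof (rule ccontr)
    assume "\<not> [:p:] dvd g"
    then obtain u v w where uvw: "u * g + v * F = 1 + [:p:] * w"
      using irreducible_mod_bezout[OF p F _ g(1)] by blast
    \<comment> \<open>Drops the multiple of \<open>F\<close> in \<open>w\<close>, which vanishes at
      \<open>\<theta>\<close>, so that \<open>det_mulmat_ev\<close> applies to a polynomial of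
      degree below \<open>n\<close>.\<close>
    obtain s r where r: "w = F * s + r" "degree r < n" "ev w \<theta> = ev r \<theta>" using ev_reduce .
    define G where "G = 1 + [:p:] * r"
    have deg: "degree G < n" unfolding G_def using r(2) n_pos
      by (intro degree_add_less) (auto intro: le_less_trans[OF degree_smult_le])
    have pG: "[:p:] dvd G - 1" by (simp only: G_def add_diff_cancel_left' dvd_triv_left)
    have "ev (u * g + v * F) \<theta> = ev (1 + [:p:] * w) \<theta>" using uvw by simp
    then have G: "ev G \<theta> = (ev u \<theta> * of_nat k) * y"
      by (simp add: G_def r(3) root mult.assoc flip: g(2))
    obtain d where d: "det (mulmat (ev G \<theta>)) = of_int d" "[d = 1] (mod p)"
      using det_mulmat_ev[OF deg pG] .
    have x: "ev u \<theta> * of_nat k \<in> K" "algebraic_int (ev u \<theta> * of_nat k)"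
      using Q_adjoin_of_int[of "int k"] algebraic_int_of_int[of "int k"]
      by (auto intro!: Q_adjoin_mult Q_adjoin_ev Q_adjoin_base algebraic_int_mult algebraic_int_ev integral)
    obtain e where e: "det (mulmat (ev u \<theta> * of_nat k)) = of_int e"
      using det_mulmat_integral[OF x] .
    have "of_int d = (of_int (e * c) :: rat)"
      using d(1) by (simp add: G mulmat_mult[OF x(1) y(1)] e c(1) det_mult[OF mulmat_carrier mulmat_carrier])
    then have "d = e * c" by (simp only: of_int_eq_iff)
    then have "p dvd d" using c(2) by simp
    then have "p dvd 1" using d(2) by (metis cong_dvd_iff)
    then show False using p by auto
  qed
  then obtain h where h: "g = [:p:] * h" ..
  \<comment> \<open>Both \<open>k * y\<close> and \<open>p * y\<close> are divisible by
    \<open>p\<close>, hence so is \<open>y\<close>.\<close>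
  have "coprime (int k) p" using p k(1) by (metis prime_imp_coprime coprime_commute)
  then obtain a b where ab: "a * int k + b * p = 1"
    by (metis bezout_int coprime_iff_gcd_eq_1)
  have "of_int (a * int k + b * p) * y = of_int p * (of_int a * ev h \<theta> + of_int b * y)"
    using g(2) by (simp add: h algebra_simps)
  then have "y = of_int p * (of_int a * ev h \<theta> + of_int b * y)" by (simp add: ab)
  moreover have "algebraic_int (of_int a * ev h \<theta> + of_int b * y)"
    by (intro algebraic_int_intros integral y(2))
  ultimately show thesis using that by blast
qed

lemma primitive_integersD:
  assumes "y \<in> primitive_integers K"
  shows "y \<in> K" "algebraic_int y" "Q_adjoin y = K"
  using assms by (auto simp: primitive_integers_def ring_of_integers_def)

lemma field_char_poly_props:
  assumes y: "y \<in> primitive_integers K"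
  shows "char_poly (mulmat y) = map_poly of_int (field_char_poly K y)"
    and "power_basis y (field_char_poly K y)" and "degree (field_char_poly K y) = n"
proof -
  obtain P where P: "char_poly (mulmat y) = map_poly of_int P"
    using char_poly_mulmat_integral primitive_integersD[OF y] by metis
  note eq = field_char_poly_eq[OF y P]
  show "char_poly (mulmat y) = map_poly of_int (field_char_poly K y)" using P eq by simp
  show "power_basis y (field_char_poly K y)" "degree (field_char_poly K y) = n"
    using primitive_power_basis[OF y P] eq by simp_all
qed

lemma inert_not_dvd_value_gcd:
  assumes p: "prime p" and F: "irreducible_mod p F" and y: "y \<in> primitive_integers K"
  shows "\<not> p dvd elem_value_gcd K y"
proof
  assume dvd: "p dvd elem_value_gcd K y"
  let ?P = "field_char_poly K y"
  note yK = primitive_integersD[OF y]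
  have val: "p dvd poly ?P a" for a
    using dvd elem_value_gcd_dvd by (rule dvd_trans)
  have "\<exists>z. algebraic_int z \<and> of_int a - y = of_int p * z" for a
  proof -
    have a: "of_int a - y \<in> K" "algebraic_int (of_int a - y)"
      using yK by (auto intro: Q_adjoin_diff Q_adjoin_of_int)
    show ?thesis
      using inert_dvd[OF p F a det_mulmat_diff[OF yK(1) field_char_poly_props(1)[OF y]] val]
        by blast
  qed
  from this[of 0] this[of 1] obtain z z' where z: "algebraic_int z" "of_int 0 - y = of_int p * z"
    and z': "algebraic_int z'" "of_int 1 - y = of_int p * z'" by blast
  have "of_int 1 = of_int p * (z' - z)"
    unfolding right_diff_distrib z(2)[symmetric] z'(2)[symmetric] by simp
  then have "p dvd 1" using z(1) z'(1) by (intro algebraic_int_dvd[of "z' - z"]) auto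
  then show False using p by auto
qed

lemma field_char_poly_unique:
  assumes y: "y \<in> primitive_integers K" and G: "lead_coeff G = 1" "degree G = n" "ev G y = 0"
  shows "field_char_poly K y = G"
proof -
  interpret y: power_basis y "field_char_poly K y" by (rule field_char_poly_props(2)[OF y])
  note deg = field_char_poly_props(3)[OF y]
  have "degree (field_char_poly K y - G) < n"
  proof -
    have "degree (field_char_poly K y - G) \<le> n" using G deg by (intro degree_diff_le) auto
    moreover have "coeff (field_char_poly K y - G) n = 0" using G deg y.monic by simp
    ultimately show ?thesis using n_pos
      by (metis le_neq_implies_less leading_coeff_0_iff degree_0)
  qed
  then have "field_char_poly K y - G = 0" using G(3) y.root deg by (intro y.minimal) auto
  then show ?thesis by simp
qed

end

text \<open>Over a field a nonzero polynomial has no more roots than its degree; the remainder of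
  the synthetic division at a root is a multiple of \<open>p\<close>.\<close>

lemma root_set_mod_prime:
  fixes f :: "int poly"
  assumes p: "prime p" and S: "finite S" "degree f < card S"
    and roots: "\<And>x. x \<in> S \<Longrightarrow> p dvd poly f x"
    and inj: "\<And>x y. x \<in> S \<Longrightarrow> y \<in> S \<Longrightarrow> p dvd x - y \<Longrightarrow> x = y"
  shows "[:p:] dvd f"
  using S roots inj
proof (induction "degree f" arbitrary: f S rule: less_induct)
  case less
  obtain r where r: "r \<in> S" using less.prems(1,2) by fastforce
  obtain c where c: "poly f r = p * c" using less.prems(3)[OF r] ..
  have f: "f = [:- r, 1:] * synthetic_div f r + [:p:] * [:c:]"
    using synthetic_div_correct'[of r f] c by (simp add: mult.commute)
  show ?case
  proof (cases "degree f = 0")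
    case True
    then obtain a where "f = [:a:]" by (auto elim: degree_eq_zeroE)
    then show ?thesis using less.prems(3)[OF r] by simp
  next
    case False
    have "[:p:] dvd synthetic_div f r"
    proof (rule less.hyps)
      show "degree (synthetic_div f r) < degree f" using False by (simp add: degree_synthetic_div)
      show "degree (synthetic_div f r) < card (S - {r})"
        using False less.prems(1,2) r by (simp add: degree_synthetic_div)
      fix x assume x: "x \<in> S - {r}"
      have "poly f x = (x - r) * poly (synthetic_div f r) x + p * c"
        by (subst f) (simp add: algebra_simps)
      then have "p dvd (x - r) * poly (synthetic_div f r) x"
        using less.prems(3)[of x] x by (metis DiffD1 dvd_add_left_iff dvd_triv_left)
      moreover have "\<not> p dvd x - r" using less.prems(4)[of x r] x r by blast
      ultimately show "p dvd poly (synthetic_div f r) x" using p by (simp add: prime_dvd_mult_iff)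
    qed (use less.prems in auto)
    then show ?thesis by (subst f) (intro dvd_add dvd_mult dvd_triv_left)
  qed
qed

lemma five_dvd_fermat: "5 dvd x ^ 5 - (x :: int)"
proof -
  have "[x = x mod 5] (mod 5)" by (simp add: cong_def)
  then have "[x ^ 5 - x = (x mod 5) ^ 5 - x mod 5] (mod 5)" by (intro cong_diff cong_pow)
  moreover have "x mod 5 \<in> {0, 1, 2, 3, 4}" by auto
  then have "5 dvd (x mod 5) ^ 5 - x mod 5" by auto
  ultimately show ?thesis by (metis cong_dvd_iff)
qed

text \<open>The quotient by 5 is written out so that it is visibly an algebraic integer whenever
  \<open>c\<close>, \<open>t\<close> and \<open>v\<close> are.\<close>

lemma fifth_power_expand:
  fixes c t v :: complex
  shows "(c + t + 5 * v) ^ 5 = c ^ 5 + t ^ 5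
    + 5 * (c ^ 4 * t + 2 * c ^ 3 * t ^ 2 + 2 * c ^ 2 * t ^ 3 + c * t ^ 4
      + v * (5 * (c + t) ^ 4 + 50 * (c + t) ^ 3 * v + 250 * (c + t) ^ 2 * v ^ 2
        + 625 * (c + t) * v ^ 3 + 625 * v ^ 4))"
  by (simp add: eval_nat_numeral algebra_simps)

lemma dvd_poly_diff: "x - y dvd poly f x - poly f y" for f :: "int poly"
proof (induction f)
  case (pCons a f)
  have "poly (pCons a f) x - poly (pCons a f) y = (x - y) * poly f x + y * (poly f x - poly f y)"
    by (simp add: algebra_simps)
  then show ?case using pCons.IH by (metis dvd_add dvd_mult dvd_triv_left)
qed simp

text \<open>The alternating sum of values is a fifth finite difference, which is the constant 120
  for a monic quintic.\<close>

lemma quintic_value_gcd_dvd: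
  fixes P :: "int poly"
  assumes "degree P = 5" "lead_coeff P = 1"
  shows "Gcd (range (poly P)) dvd 120"
proof -
  have "poly P x = coeff P 0 + coeff P 1 * x + coeff P 2 * x ^ 2 + coeff P 3 * x ^ 3
      + coeff P 4 * x ^ 4 + x ^ 5" for x
    using assms by (simp add: poly_altdef eval_nat_numeral)
  then have "120 = poly P 5 - 5 * poly P 4 + 10 * poly P 3 - 10 * poly P 2 + 5 * poly P 1
      - poly P 0"
    by simp
  moreover have "Gcd (range (poly P)) dvd poly P x" for x by (simp add: Gcd_dvd)
  ultimately show ?thesis by (metis dvd_add dvd_diff dvd_mult)
qed

text \<open>Modulo \<open>5\<close> every integer of \<open>K\<close> is congruent to a rational integer modulo \<open>\<theta>\<close>, and
  \<open>\<theta>\<^sup>5\<close> is divisible by \<open>5\<close>. Hence if all values of the characteristic polynomial of \<open>y\<close> were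
  divisible by \<open>5\<close>, then \<open>y \<equiv> y\<^sup>5 \<equiv> b\<close> modulo \<open>5\<close> for some integer \<open>b\<close>, and the
  characteristic polynomial would be congruent to \<open>(X - b)\<^sup>5\<close>.\<close>

lemma (in power_basis) five_not_dvd_value_gcd_Eisenstein:
  assumes n5: "n = 5" and F: "[:5:] dvd F - monom 1 n" "\<not> 5 ^ 2 dvd coeff F 0"
    and y: "y \<in> primitive_integers K"
  shows "\<not> 5 dvd elem_value_gcd K y"
proof
  assume dvd: "5 dvd elem_value_gcd K y"
  have p5: "prime (5 :: int)" by simp
  note yK = primitive_integersD[OF y]
  define P where "P = field_char_poly K y"
  note props = field_char_poly_props[OF y, folded P_def]
  interpret y: power_basis y P by (rule props(2))
  have val: "5 dvd poly P a" for a
    unfolding P_def using dvd elem_value_gcd_dvd by (rule dvd_trans)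
  define Q where "Q = P - [:0, -1, 0, 0, 0, 1:]"
  \<comment> \<open>By Fermat \<open>Q\<close> vanishes at all five residues modulo 5, and its
    degree is below 5.\<close>
  have "[:5:] dvd Q"
  proof (rule root_set_mod_prime[OF p5, of "{0..<5}"])
    have "degree Q \<le> 5" unfolding Q_def using props(3) n5 by (intro degree_diff_le) auto
    moreover have "coeff Q 5 = 0" using y.monic props(3) n5 by (simp add: Q_def eval_nat_numeral)
    ultimately have "degree Q < 5"
      by (metis degree_0 le_neq_implies_less leading_coeff_0_iff zero_less_numeral)
    then show "degree Q < card {0..<5 :: int}" by simp
    show "5 dvd poly Q x" for x
    proof -
      have "poly Q x = poly P x - (x ^ 5 - x)" by (simp add: Q_def eval_nat_numeral algebra_simps)
      then show ?thesis using val[of x] five_dvd_fermat[of x] by (simp only: dvd_diff)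
    qed
    show "x = y" if "x \<in> {0..<5}" "y \<in> {0..<5}" "5 dvd x - y" for x y :: int
      using that by auto presburger
  qed simp
  then obtain E where E: "Q = [:5:] * E" ..
  then have PE: "P = [:0, -1, 0, 0, 0, 1:] + [:5:] * E" by (simp add: Q_def algebra_simps)
  have y5: "y ^ 5 = y - 5 * ev E y"
    using y.root by (subst (asm) PE) (simp add: eval_nat_numeral algebra_simps)
  obtain e where e: "F - monom 1 n = [:5:] * e" using F(1) ..
  have \<theta>5: "\<theta> ^ 5 = - 5 * ev e \<theta>"
  proof -
    have "ev F \<theta> - \<theta> ^ 5 = 5 * ev e \<theta>"
      using arg_cong[OF e, of "\<lambda>f. ev f \<theta>"] n5 by simp
    then show ?thesis using root by (metis diff_0 minus_minus mult_minus_left)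
  qed
  obtain k where k: "\<not> 5 dvd int k" "of_nat k * y \<in> Z_adjoin \<theta>"
    using coprime_denominator[OF p5 _ yK(1,2)] no_torsion_Eisenstein[OF p5 F] by auto
  obtain g where g: "degree g < n" "of_nat k * y = ev g \<theta>" using Z_adjoinE[OF k(2)] .
  obtain g0 g1 where g01: "g = pCons g0 g1" by (rule pCons_cases)
  have "coprime (int k) 5" using p5 k(1) by (metis prime_imp_coprime coprime_commute)
  then obtain a b where ab: "a * int k + b * 5 = 1"
    by (metis bezout_int coprime_iff_gcd_eq_1)
  define c where "c = a * g0"
  define u where "u = of_int a * ev g1 \<theta>"
  have u: "algebraic_int u" unfolding u_def by (intro algebraic_int_intros integral)
  have "of_int (a * int k + b * 5) * y = of_int a * ev g \<theta> + 5 * (of_int b * y)"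
    using g(2) by (simp add: algebra_simps)
  then have yc: "y = of_int c + \<theta> * u + 5 * (of_int b * y)"
    by (simp add: ab g01 c_def u_def algebra_simps)
  define v where "v = of_int b * y"
  have v: "algebraic_int v" unfolding v_def by (intro algebraic_int_intros yK(2))
  obtain c' where c': "c ^ 5 - c = 5 * c'" using five_dvd_fermat by (auto elim: dvdE)
  have "y ^ 5 = (of_int c + \<theta> * u + 5 * v) ^ 5" using yc by (simp add: v_def)
  also have "\<dots> = of_int c ^ 5 + \<theta> ^ 5 * u ^ 5
    + 5 * (of_int c ^ 4 * (\<theta> * u) + 2 * of_int c ^ 3 * (\<theta> * u) ^ 2
      + 2 * of_int c ^ 2 * (\<theta> * u) ^ 3 + of_int c * (\<theta> * u) ^ 4
      + v * (5 * (of_int c + \<theta> * u) ^ 4 + 50 * (of_int c + \<theta> * u) ^ 3 * v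
        + 250 * (of_int c + \<theta> * u) ^ 2 * v ^ 2 + 625 * (of_int c + \<theta> * u) * v ^ 3 + 625 * v ^ 4))"
    (is "_ = _ + _ + 5 * ?w")
    by (simp add: fifth_power_expand power_mult_distrib)
  \<comment> \<open>On the left \<open>y ^ 5 = y - 5 * ev E y\<close>; on the right
    \<open>\<theta> ^ 5\<close> is a multiple of 5 and \<open>c ^ 5\<close> is \<open>c\<close>
    modulo 5. What remains says that \<open>(y - c) / 5\<close> is an algebraic integer.\<close>
  finally have yw: "y = of_int c + 5 * (of_int c' - ev e \<theta> * u ^ 5 + ?w + ev E y)"
    using arg_cong[OF c', of complex_of_int] unfolding y5 \<theta>5 by (simp add: algebra_simps)
  then obtain z where z: "y = of_int c + 5 * z" "algebraic_int z"
  proof -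
    have num: "algebraic_int (numeral k :: complex)" for k by (rule int_imp_algebraic_int) simp
    have "algebraic_int (of_int c' - ev e \<theta> * u ^ 5 + ?w + ev E y)"
      by (intro algebraic_int_intros integral u v yK(2) num)
    from yw this show thesis by (rule that)
  qed
  have zy: "z = (y - of_int c) / of_int 5" using z(1) by simp
  have zK: "z \<in> K" unfolding zy by (intro Q_adjoin_divide Q_adjoin_diff Q_adjoin_of_int yK(1))
  have "y \<in> Q_adjoin z"
    unfolding z(1) using Q_adjoin_of_int[of 5]
      by (auto intro!: Q_adjoin_add Q_adjoin_mult Q_adjoin_of_int Q_adjoin_base)
  then have "Q_adjoin z = K"
    using Q_adjoin_subset[of y z] Q_adjoin_subset[of z \<theta>] zK yK(3) by auto
  then have zp: "z \<in> primitive_integers K"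
    using zK z(2) by (simp add: primitive_integers_def ring_of_integers_def)
  define R where "R = field_char_poly K z"
  note zprops = field_char_poly_props[OF zp, folded R_def]
  interpret z: power_basis z R by (rule zprops(2))
  \<comment> \<open>\<open>R\<close> is the characteristic polynomial of \<open>z\<close>, which is
    \<open>(y - c) / 5\<close>, so \<open>S\<close> will be \<open>5 ^ 5\<close> times
    \<open>R\<close>, with all values divisible by 25. But \<open>poly S 1 - poly S 0\<close> is -5
    modulo 25: this is the share of the term -X, while X^5 and \<open>E\<close> contribute multiples
    of 25.\<close>
  define S where "S = pcompose P [:c, 5:]"
  have "degree S = 5" "coeff S 5 = 5 ^ 5"
    using props(3) y.monic n5 lead_coeff_comp[of "[:c, 5:]" P] by (simp_all add: S_def)
  then have "degree (S - smult (5 ^ 5) R) < 5"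
  proof -
    assume S: "degree S = 5" "coeff S 5 = 5 ^ 5"
    have "degree (S - smult (5 ^ 5) R) \<le> 5" using S zprops(3) n5 by (intro degree_diff_le) auto
    moreover have "coeff (S - smult (5 ^ 5) R) 5 = 0" using S z.monic zprops(3) n5 by simp
    ultimately show ?thesis
      by (metis degree_0 le_neq_implies_less leading_coeff_0_iff zero_less_numeral)
  qed
  moreover have "ev (S - smult (5 ^ 5) R) z = 0"
    using y.root z.root z(1) by (simp add: S_def ev_pcompose algebra_simps)
  ultimately have "S - smult (5 ^ 5) R = 0" using zprops(3) n5 by (intro z.minimal) auto
  then have S: "S = smult (5 ^ 5) R" by simp
  have "25 dvd poly S x" for x by (simp add: S)
  then have S10: "25 dvd poly S 1 - poly S 0" by (intro dvd_diff)
  define A where "A = c ^ 4 + 10 * c ^ 3 + 50 * c ^ 2 + 125 * c + 125"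
  define B where "B = poly E (c + 5) - poly E c"
  have "poly S 1 - poly S 0 = (c + 5) ^ 5 - c ^ 5 - 5 + 5 * B"
    by (simp add: B_def S_def poly_pcompose PE eval_nat_numeral algebra_simps)
  moreover have "(c + 5) ^ 5 - c ^ 5 = 25 * A"
    by (simp add: A_def eval_nat_numeral algebra_simps)
  ultimately have "5 = 25 * A + 5 * B - (poly S 1 - poly S 0)" by simp
  moreover have "5 dvd B" using dvd_poly_diff[of "c + 5" c E] by (simp add: B_def)
  then have "5 * 5 dvd 5 * B" by (rule mult_dvd_mono[OF dvd_refl])
  then have "25 dvd 5 * B" by simp
  ultimately have "(25 :: int) dvd 5" using S10 by (metis dvd_add dvd_diff dvd_triv_left)
  then show False by simp
qed

section \<open>Lehmer quintics\<close>

lemma irreducible_mod_cong: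
  assumes G: "irreducible_mod p G" and FG: "[:p:] dvd F - G"
    and F: "lead_coeff F = 1" "0 < degree F"
  shows "irreducible_mod p F"
  unfolding irreducible_mod_def
proof (intro conjI allI impI)
  fix e s assume es: "lead_coeff e = 1" "lead_coeff s = 1" "[:p:] dvd F - e * s"
  have "G - e * s = (F - e * s) - (F - G)" by simp
  then have "[:p:] dvd G - e * s" using es(3) FG by (simp only: dvd_diff)
  then show "degree e = 0 \<or> degree s = 0" by (rule irreducible_modD[OF G es(1,2)])
qed (use F in auto)

lemma degree_2_eq:
  fixes e :: "int poly"
  assumes "degree e = 2" "lead_coeff e = 1" shows "e = [:coeff e 0, coeff e 1, 1:]"
proof (rule poly_eqI)
  fix i show "coeff e i = coeff [:coeff e 0, coeff e 1, 1:] i"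
    using assms by (cases "i \<le> 2") (auto simp: le_Suc_eq numeral_2_eq_2 coeff_eq_0 coeff_pCons
      split: nat.split)
qed

lemma degree_3_eq:
  fixes e :: "int poly"
  assumes "degree e = 3" "lead_coeff e = 1" shows "e = [:coeff e 0, coeff e 1, coeff e 2, 1:]"
proof (rule poly_eqI)
  fix i show "coeff e i = coeff [:coeff e 0, coeff e 1, coeff e 2, 1:] i"
    using assms by (cases "i \<le> 3")
      (auto simp: le_Suc_eq numeral_2_eq_2 numeral_3_eq_3 coeff_eq_0 coeff_pCons split: nat.split)
qed

text \<open>Division of \<open>G\<close> by \<open>X\<^sup>2 + a X + b\<close> gives the quotient \<open>X\<^sup>3 + c X\<^sup>2 + d X + e\<close>; the assumption
  \<open>quad\<close> says that the remainder does not vanish modulo \<open>p\<close>.\<close>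

lemma irreducible_mod_quintic:
  fixes f0 f1 f2 f3 f4 p :: int
  defines "G \<equiv> [:f0, f1, f2, f3, f4, 1:]"
  assumes p: "prime p"
    and lin: "\<forall>r\<in>{0..<p}. \<not> p dvd poly G r"
    and quad: "\<forall>a\<in>{0..<p}. \<forall>b\<in>{0..<p}.
      \<not> (let c = f4 - a; d = f3 - a * c - b; e = f2 - a * d - b * c
         in p dvd f1 - a * e - b * d \<and> p dvd f0 - b * e)"
  shows "irreducible_mod p G"
proof -
  have p0: "0 < p" and p1: "\<not> p dvd 1" using p prime_gt_0_int by auto
  have main: False
    if e: "lead_coeff e = 1" and s: "lead_coeff s = 1" and es: "[:p:] dvd G - e * s"
      and deg: "degree e = 1 \<and> degree s = 4 \<or> degree e = 2 \<and> degree s = 3" for e s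
    using deg
  proof
    assume "degree e = 1 \<and> degree s = 4"
    then obtain b where b: "e = [:b, 1:]" using e
      by (metis One_nat_def degree_eq_zeroE degree_pCons_eq_if lead_coeff_pCons(1) pCons_cases
          degree_0 nat.inject old.nat.distinct(1) lead_coeff_pCons(2))
    obtain g where g: "G - e * s = [:p:] * g" using es ..
    have "poly G (- b) = poly (e * s) (- b) + poly (G - e * s) (- b)" by simp
    also have "poly (e * s) (- b) = 0" by (simp add: b)
    also have "poly (G - e * s) (- b) = p * poly g (- b)" unfolding g by simp
    finally have "p dvd poly G (- b)" by simp
    moreover have "p dvd (- b) mod p - (- b)" by (metis mod_eq_dvd_iff mod_mod_trivial)
    then have "p dvd poly G ((- b) mod p) - poly G (- b)" using dvd_poly_diff dvd_trans by blast
    ultimately have "p dvd poly G ((- b) mod p)" by (metis diff_add_cancel dvd_add)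
    then show False using lin p0 by simp
  next
    assume d: "degree e = 2 \<and> degree s = 3"
    define b a where "b = coeff e 0" and "a = coeff e 1"
    define s0 s1 s2 where "s0 = coeff s 0" and "s1 = coeff s 1" and "s2 = coeff s 2"
    have e': "e = [:b, a, 1:]" using degree_2_eq[OF _ e] d by (simp add: a_def b_def)
    have s': "s = [:s0, s1, s2, 1:]" using degree_3_eq[OF _ s] d by (simp add: s0_def s1_def s2_def)
    have co: "p dvd coeff (G - e * s) i" for i using es by (simp add: const_poly_dvd_iff)
    have c0: "[f0 = b * s0] (mod p)" and c1: "[f1 = a * s0 + b * s1] (mod p)"
      and c2: "[f2 = s0 + a * s1 + b * s2] (mod p)" and c3: "[f3 = s1 + a * s2 + b] (mod p)"
      and c4: "[f4 = s2 + a] (mod p)"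
      using co[of 0] co[of 1] co[of 2] co[of 3] co[of 4]
      by (simp_all add: G_def e' s' cong_iff_dvd_diff eval_nat_numeral algebra_simps)
    define a' b' where "a' = a mod p" and "b' = b mod p"
    define u v w where "u = f4 - a'" and "v = f3 - a' * u - b'" and "w = f2 - a' * v - b' * u"
    have aa: "[a' = a] (mod p)" and bb: "[b' = b] (mod p)" by (simp_all add: a'_def b'_def cong_def)
    have uu: "[u = s2] (mod p)" using cong_diff[OF c4 aa] by (simp add: u_def)
    have vv: "[v = s1] (mod p)"
      using cong_diff[OF cong_diff[OF c3 cong_mult[OF aa uu]] bb] by (simp add: v_def)
    have ww: "[w = s0] (mod p)"
      using cong_diff[OF cong_diff[OF c2 cong_mult[OF aa vv]] cong_mult[OF bb uu]]
        by (simp add: w_def)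
    have "[f1 - a' * w - b' * v = 0] (mod p)"
      using cong_diff[OF cong_diff[OF c1 cong_mult[OF aa ww]] cong_mult[OF bb vv]] by simp
    moreover have "[f0 - b' * w = 0] (mod p)"
      using cong_diff[OF c0 cong_mult[OF bb ww]] by simp
    moreover have "a' \<in> {0..<p}" "b' \<in> {0..<p}" using p0 by (simp_all add: a'_def b'_def)
    ultimately show False using quad unfolding Let_def cong_0_iff u_def v_def w_def by blast
  qed
  show ?thesis
    unfolding irreducible_mod_def
  proof (intro conjI allI impI)
    fix e s assume e: "lead_coeff e = 1" and s: "lead_coeff s = 1" and es: "[:p:] dvd G - e * s"
    have G5: "coeff G 5 = 1" "degree G = 5" by (simp_all add: G_def eval_nat_numeral)
    have co: "p dvd coeff (G - e * s) i" for i using es by (simp add: const_poly_dvd_iff)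
    have l: "coeff (e * s) (degree e + degree s) = 1" using e s by (simp add: coeff_mult_degree_sum)
    have "degree (e * s) = degree e + degree s" using e s by (intro degree_mult_eq) auto
    \<comment> \<open>If the degrees differed, the leading coefficient of \<open>G\<close> or of
      \<open>e * s\<close> would survive in the difference, and \<open>p\<close> would divide
      1.\<close>
    then have deg: "degree e + degree s = 5"
      using co[of 5] co[of "degree e + degree s"] p1 G5 l
      by (cases "degree e + degree s" "5 :: nat" rule: linorder_cases) (auto simp: coeff_eq_0)
    show "degree e = 0 \<or> degree s = 0"
    proof (rule ccontr)
      assume "\<not> (degree e = 0 \<or> degree s = 0)"
      then have "(degree e = 1 \<and> degree s = 4 \<or> degree e = 2 \<and> degree s = 3)
          \<or> (degree s = 1 \<and> degree e = 4 \<or> degree s = 2 \<and> degree e = 3)"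
        using deg by auto
      then show False using main[OF e s es] main[OF s e] es by (auto simp: mult.commute)
    qed
  qed (simp_all add: G_def)
qed

lemma int_interval_small:
  "{0..<2 :: int} = {0, 1}" "{0..<3 :: int} = {0, 1, 2}" "{0..<5 :: int} = {0, 1, 2, 3, 4}"
  by auto

lemma const_dvd_pCons_diff:
  assumes "[a = b] (mod p)" "[:p:] dvd f - g"
  shows "[:p:] dvd pCons a f - pCons (b :: int) g"
proof -
  obtain c where "a - b = p * c" using assms(1) unfolding cong_iff_dvd_diff ..
  moreover obtain h where "f - g = [:p:] * h" using assms(2) ..
  ultimately have "pCons a f - pCons b g = [:p:] * pCons c h" by simp
  then show ?thesis by (metis dvd_triv_left)
qed

section \<open>The polynomials h_m modulo 2, 3 and 5\<close>

lemma h_poly_cong: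
  assumes "[m = k] (mod p)" shows "[:p:] dvd h_poly m - h_poly k"
  unfolding h_poly_def
  by (intro const_dvd_pCons_diff)
    (simp_all only: cong_minus_minus_iff diff_self dvd_0_right,
      (intro cong_add cong_diff cong_mult cong_pow cong_refl assms)+)

lemma h_poly_monic: "lead_coeff (h_poly m) = 1" "degree (h_poly m) = 5"
  by (simp_all add: h_poly_def)

lemma irreducible_mod_2_h_poly: "irreducible_mod 2 (h_poly m)"
proof -
  have "irreducible_mod 2 (h_poly 0)" "irreducible_mod 2 (h_poly 1)"
    unfolding h_poly_def by (rule irreducible_mod_quintic; simp add: int_interval_small)+
  moreover have "[m = 0] (mod 2) \<or> [m = 1] (mod 2)" unfolding cong_def by auto
  ultimately show ?thesis
    using irreducible_mod_cong h_poly_cong h_poly_monic by (metis zero_less_numeral)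
qed

lemma irreducible_mod_3_h_poly: "irreducible_mod 3 (h_poly m)"
proof -
  have "irreducible_mod 3 (h_poly 0)" "irreducible_mod 3 (h_poly 1)" "irreducible_mod 3 (h_poly 2)"
    unfolding h_poly_def by (rule irreducible_mod_quintic; simp add: int_interval_small)+
  moreover have "[m = 0] (mod 3) \<or> [m = 1] (mod 3) \<or> [m = 2] (mod 3)" unfolding cong_def by auto
  ultimately show ?thesis
    using irreducible_mod_cong h_poly_cong h_poly_monic by (metis zero_less_numeral)
qed

lemma irreducible_mod_5_h_poly_1: "irreducible_mod 5 (h_poly 1)"
proof -
  have "h_poly 1 = [:1, 25, 37, -28, 1, 1:]" by (simp add: h_poly_def)
  then show ?thesis by (simp only:) (rule irreducible_mod_quintic; simp add: int_interval_small)
qed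

lemma irreducible_mod_5_h_poly_3: "irreducible_mod 5 (h_poly 3)"
proof -
  have "h_poly 3 = [:1, 103, 365, -148, 9, 1:]" by (simp add: h_poly_def)
  then show ?thesis by (simp only:) (rule irreducible_mod_quintic; simp add: int_interval_small)
qed

lemma irreducible_mod_5_h_poly_4: "irreducible_mod 5 (h_poly 4)"
proof -
  have "h_poly 4 = [:1, 178, 817, -274, 16, 1:]" by (simp add: h_poly_def)
  then show ?thesis by (simp only:) (rule irreducible_mod_quintic; simp add: int_interval_small)
qed

lemma irreducible_mod_5_h_poly:
  assumes "\<not> [m = 0] (mod 5)" "\<not> [m = 2] (mod 5)" shows "irreducible_mod 5 (h_poly m)"
proof -
  have "[m = 1] (mod 5) \<or> [m = 3] (mod 5) \<or> [m = 4] (mod 5)"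
    using assms unfolding cong_def by auto
  then show ?thesis
    using irreducible_mod_cong h_poly_cong h_poly_monic irreducible_mod_5_h_poly_1
      irreducible_mod_5_h_poly_3 irreducible_mod_5_h_poly_4
    by (metis zero_less_numeral)
qed

text \<open>The discriminant of \<open>h_poly m\<close> is
  \<open>lehmer_index m ^ 2 * lehmer_conductor m ^ 4\<close>. Under the hypothesis of the theorem,
  the first factor comes from the index of \<int>[\<rho>] and the second from ramification.\<close>

definition lehmer_conductor :: "int \<Rightarrow> int" where
  "lehmer_conductor m = m ^ 4 + 5 * m ^ 3 + 15 * m ^ 2 + 25 * m + 25"

definition lehmer_index :: "int \<Rightarrow> int" where
  "lehmer_index m = m ^ 3 + 5 * m ^ 2 + 10 * m + 7"

text \<open>These rules only split a polynomial identity into its coefficients; the expressions in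
  \<open>m\<close> are left unexpanded for the Groebner basis method.\<close>

lemmas poly_arith_simps = pderiv_pCons pderiv_0 mult_pCons_left mult_zero_left smult_pCons
  smult_0_right add_pCons add_0_right add_0_left pCons_eq_iff pCons_eq_0_iff HOL.simp_thms

text \<open>This constant has the same prime divisors as the discriminant, so
  \<open>h_poly m\<close> is squarefree modulo all other primes.\<close>

lemma h_poly_bezout:
  "\<exists>U V. U * h_poly m + V * pderiv (h_poly m) = [:lehmer_index m ^ 2 * lehmer_conductor m:]"
proof (intro exI)
  show "[: - 425 - 1775 * m - 3155 * m ^ 2 - 3210 * m ^ 3 - 2103 * m ^ 4 - 926 * m ^ 5 - 270 * m ^
         6 - 48 * m ^ 7 - 4 * m ^ 8,
       810 + 2460 * m + 3394 * m ^ 2 + 2836 * m ^ 3 + 1562 * m ^ 4 + 560 * m ^ 5 + 120 * m ^ 6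
         + 12 * m ^ 7,
       5 - 10 * m - 135 * m ^ 2 - 237 * m ^ 3 - 168 * m ^ 4 - 56 * m ^ 5 - 8 * m ^ 6,
       - 150 - 290 * m - 210 * m ^ 2 - 70 * m ^ 3 - 10 * m ^ 4 :]
    * h_poly m
    + [: 165 + 485 * m + 613 * m ^ 2 + 442 * m ^ 3 + 202 * m ^ 4 + 60 * m ^ 5 + 11 * m ^ 6 + m ^
         7,
       179 + 795 * m + 1463 * m ^ 2 + 1522 * m ^ 3 + 1015 * m ^ 4 + 454 * m ^ 5 + 134 * m ^ 6 +
         24 * m ^ 7 + 2 * m ^ 8,
       - 282 - 844 * m - 1151 * m ^ 2 - 954 * m ^ 3 - 523 * m ^ 4 - 187 * m ^ 5 - 40 * m ^ 6 -
         4 * m ^ 7,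
       - 1 + 2 * m + 33 * m ^ 2 + 59 * m ^ 3 + 42 * m ^ 4 + 14 * m ^ 5 + 2 * m ^ 6,
       30 + 58 * m + 42 * m ^ 2 + 14 * m ^ 3 + 2 * m ^ 4 :]
    * pderiv (h_poly m) = [:lehmer_index m ^ 2 * lehmer_conductor m:]"
    unfolding h_poly_def lehmer_index_def lehmer_conductor_def
    by (simp only: poly_arith_simps) (intro conjI; Groebner_Basis.algebra)
qed

text \<open>The characteristic polynomial of \<open>alt_elem m \<rho>\<close>, written out; its
  constant coefficient is \<open>lehmer_index m ^ 2\<close>.\<close>

definition alt_poly :: "int \<Rightarrow> int poly" where
  "alt_poly m =
    [: 49 + 140 * m + 170 * m ^ 2 + 114 * m ^ 3 + 45 * m ^ 4 + 10 * m ^ 5 + m ^ 6,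
       - 890 - 2190 * m - 2581 * m ^ 2 - 1892 * m ^ 3 - 950 * m ^ 4 - 337 * m ^ 5 - 83 * m ^ 6
         - 13 * m ^ 7 - m ^ 8,
       - 1105 - 3730 * m - 5666 * m ^ 2 - 5265 * m ^ 3 - 3337 * m ^ 4 - 1507 * m ^ 5 - 486 * m
         ^ 6 - 108 * m ^ 7 - 15 * m ^ 8 - m ^ 9,
       490 + 1135 * m + 1239 * m ^ 2 + 841 * m ^ 3 + 383 * m ^ 4 + 117 * m ^ 5 + 22 * m ^ 6 + 2
         * m ^ 7,
       - 50 - 70 * m - 51 * m ^ 2 - 24 * m ^ 3 - 7 * m ^ 4 - m ^ 5,
       1 :]"

text \<open>The cofactors were obtained by inverting the derivative of \<^term>\<open>alt_poly m\<close> over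
  \<open>\<int>[m]/(lehmer_index m)\<close>.\<close>

lemma alt_poly_bezout:
  "\<exists>U V W. U * alt_poly m + V * pderiv (alt_poly m) = [:1:] + [:lehmer_index m:] * W"
proof (intro exI)
  show "[: - 99 + 21 * m + 63 * m ^ 2,
       - 3768 - 4328 * m - 1184 * m ^ 2,
       1547 - 360 * m - 1008 * m ^ 2,
       5460 + 5820 * m + 1400 * m ^ 2 :]
    * alt_poly m
    + [: - 8 - 7 * m - m ^ 2,
       181 + 85 * m - 29 * m ^ 2,
       1434 + 1672 * m + 468 * m ^ 2,
       - 455 + 48 * m + 256 * m ^ 2,
       - 1092 - 1164 * m - 280 * m ^ 2 :]
    * pderiv (alt_poly m) = [:1:] + [:lehmer_index m:] *
    [: 324 + 1097 * m + 1925 * m ^ 2 + 1634 * m ^ 3 + 716 * m ^ 4 + 160 * m ^ 5 + 15 * m ^ 6 +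
         m ^ 7,
       - 34276 - 85086 * m - 87316 * m ^ 2 - 47196 * m ^ 3 - 14054 * m ^ 4 - 2126 * m ^ 5 - 126
         * m ^ 6 + 2 * m ^ 8,
       264384 + 542975 * m + 518044 * m ^ 2 + 302612 * m ^ 3 + 120886 * m ^ 4 + 33631 * m ^ 5 +
         5965 * m ^ 6 + 475 * m ^ 7 - 5 * m ^ 8,
       72760 + 470760 * m + 739068 * m ^ 2 + 615168 * m ^ 3 + 326568 * m ^ 4 + 118588 * m ^ 5 +
         28924 * m ^ 6 + 4216 * m ^ 7 + 248 * m ^ 8,
       - 623005 - 1240375 * m - 1075587 * m ^ 2 - 519974 * m ^ 3 - 130203 * m ^ 4 + 686 * m ^ 5
         + 12635 * m ^ 6 + 4104 * m ^ 7 + 496 * m ^ 8,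
       - 518342 - 1578472 * m - 2082294 * m ^ 2 - 1648012 * m ^ 3 - 874512 * m ^ 4 - 320448 * m
         ^ 5 - 78996 * m ^ 6 - 11892 * m ^ 7 - 840 * m ^ 8,
       155316 + 299706 * m + 267865 * m ^ 2 + 148320 * m ^ 3 + 53008 * m ^ 4 + 11376 * m ^ 5 +
         1120 * m ^ 6,
       - 7904 - 7960 * m - 4540 * m ^ 2 - 1724 * m ^ 3 - 280 * m ^ 4,
       0 :]"
    unfolding alt_poly_def lehmer_index_def
    by (simp only: poly_arith_simps) (intro conjI; Groebner_Basis.algebra)
qed

section \<open>The element with denominator \<open>lehmer_index m\<close>\<close>

lemma alt_poly_monic: "lead_coeff (alt_poly m) = 1" "degree (alt_poly m) = 5"
  by (simp_all add: alt_poly_def)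

lemma alt_poly_cong:
  assumes "[m = k] (mod p)" shows "[:p:] dvd alt_poly m - alt_poly k"
  unfolding alt_poly_def
  by (intro const_dvd_pCons_diff)
    (simp_all only: diff_self dvd_0_right,
      (intro cong_add cong_diff cong_mult cong_pow cong_refl assms)+)

text \<open>Through \<open>power_basis_if_irreducible_mod\<close> this makes
  \<open>alt_poly m\<close> the minimal polynomial of \<open>alt_elem m \<rho>\<close>, so that this
  element generates the whole quintic field.\<close>

lemma irreducible_mod_2_alt_poly: "irreducible_mod 2 (alt_poly m)"
proof -
  have "irreducible_mod 2 (alt_poly 0)" "irreducible_mod 2 (alt_poly 1)"
    unfolding alt_poly_def by (rule irreducible_mod_quintic; simp add: int_interval_small)+
  moreover have "[m = 0] (mod 2) \<or> [m = 1] (mod 2)" unfolding cong_def by auto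
  ultimately show ?thesis
    using irreducible_mod_cong alt_poly_cong alt_poly_monic by (metis zero_less_numeral)
qed

lemma five_dvd_alt_poly:
  assumes "[m = 2] (mod 5)" shows "5 dvd poly (alt_poly m) x"
proof -
  obtain g where "alt_poly m - alt_poly 2 = [:5:] * g" using alt_poly_cong[OF assms] ..
  then have "poly (alt_poly m) x = poly (alt_poly 2) x + 5 * poly g x"
    by (metis diff_add_cancel add.commute poly_add poly_mult poly_const_conv)
  moreover have "poly (alt_poly 2) x = (x ^ 5 - x)
      + 5 * (605 - 12789 * x - 44849 * x ^ 2 + 5196 * x ^ 3 - 146 * x ^ 4)"
    by (simp add: alt_poly_def eval_nat_numeral algebra_simps)
  ultimately show ?thesis using five_dvd_fermat[of x]
    by (simp only: dvd_add dvd_triv_left)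
qed

definition alt_elem :: "int \<Rightarrow> complex \<Rightarrow> complex" where
  "alt_elem m r = (of_int (m + 2) + of_int (2 * m ^ 2 + 9 * m + 9) * r
      + of_int (2 * m ^ 2 + 4 * m - 1) * r ^ 2 - of_int (3 * m + 4) * r ^ 3 + r ^ 4)
      / of_int (lehmer_index m) + r + r ^ 2"

text \<open>The value is odd for every \<open>m\<close>, as \<open>m ^ 3 + 5 * m ^ 2\<close> is
  even.\<close>

lemma lehmer_index_nonzero: "lehmer_index m \<noteq> 0"
proof
  assume "lehmer_index m = 0"
  then have "even (lehmer_index m)" by simp
  then show False by (simp add: lehmer_index_def)
qed

text \<open>The quotient \<open>w\<close> completes \<open>1, r, r\<^sup>2, r\<^sup>3\<close> to the integral basis of Gaal and Pohst. The
  facts \<open>T1\<close> to \<open>T4\<close> are the multiplication table by \<open>t\<close> in this basis, and \<open>b2\<close> to \<open>b4\<close> are the stages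
  of Horner's scheme.\<close>

lemma alt_poly_root:
  assumes root: "ev (h_poly m) r = 0"
  shows "ev (alt_poly m) (alt_elem m r) = 0"
proof -
  define M where "M = (of_int m :: complex)"
  define d where "d = M ^ 3 + 5 * M ^ 2 + 10 * M + 7"
  have d: "d = of_int (lehmer_index m)" by (simp add: d_def M_def lehmer_index_def)
  then have d0: "d \<noteq> 0" using lehmer_index_nonzero by simp
  define w where "w = ((M + 2) + (2 * M ^ 2 + 9 * M + 9) * r
      + (2 * M ^ 2 + 4 * M - 1) * r ^ 2 - (3 * M + 4) * r ^ 3 + r ^ 4) / d"
  define t where "t = alt_elem m r"
  have T0: "t = r + r ^ 2 + w" by (simp add: t_def alt_elem_def w_def d M_def)
  have dw: "d * w = (M + 2) + (2 * M ^ 2 + 9 * M + 9) * r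
      + (2 * M ^ 2 + 4 * M - 1) * r ^ 2 - (3 * M + 4) * r ^ 3 + r ^ 4"
    using d0 by (simp add: w_def)
  then have r4: "r ^ 4 = d * w - ((M + 2) + (2 * M ^ 2 + 9 * M + 9) * r
      + (2 * M ^ 2 + 4 * M - 1) * r ^ 2 - (3 * M + 4) * r ^ 3)" by simp
  have h: "r ^ 5 = - (M ^ 2 * r ^ 4 - (2 * M ^ 3 + 6 * M ^ 2 + 10 * M + 10) * r ^ 3
      + (M ^ 4 + 5 * M ^ 3 + 11 * M ^ 2 + 15 * M + 5) * r ^ 2
      + (M ^ 3 + 4 * M ^ 2 + 10 * M + 10) * r + 1)"
  proof -
    have "r ^ 5 + (M ^ 2 * r ^ 4 - (2 * M ^ 3 + 6 * M ^ 2 + 10 * M + 10) * r ^ 3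
      + (M ^ 4 + 5 * M ^ 3 + 11 * M ^ 2 + 15 * M + 5) * r ^ 2
      + (M ^ 3 + 4 * M ^ 2 + 10 * M + 10) * r + 1) = ev (h_poly m) r"
      by (simp add: h_poly_def M_def eval_nat_numeral algebra_simps)
    also have "\<dots> = 0" by (rule root)
    finally show ?thesis by (simp only: eq_neg_iff_add_eq_0)
  qed
  \<comment> \<open>Relations for \<open>w\<close> are proved after multiplication by
    \<open>d\<close>, where they are polynomial identities in \<open>r\<close> modulo
    \<open>h\<close>; \<open>d\<close> is cancelled at the end.\<close>
  have "d * (r * w) = r * (d * w)" by simp
  also have "\<dots> = (M + 2) * r + (2 * M ^ 2 + 9 * M + 9) * r ^ 2
      + (2 * M ^ 2 + 4 * M - 1) * r ^ 3 - (3 * M + 4) * r ^ 4 + r ^ 5"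
    unfolding dw by Groebner_Basis.algebra
  also have "\<dots> = d * (1 + (2 * M + 4) * r + M * r ^ 2 - r ^ 3) - (M ^ 2 + 3 * M + 4) * (d * w)"
    unfolding h dw unfolding d_def by Groebner_Basis.algebra
  also have "\<dots> = d * (1 + (2 * M + 4) * r + M * r ^ 2 - r ^ 3 - (M ^ 2 + 3 * M + 4) * w)"
    by Groebner_Basis.algebra
  finally have "d * (r * w) = d * (1 + (2 * M + 4) * r + M * r ^ 2 - r ^ 3
      - (M ^ 2 + 3 * M + 4) * w)" .
  then have rw: "r * w = 1 + (2 * M + 4) * r + M * r ^ 2 - r ^ 3 - (M ^ 2 + 3 * M + 4) * w"
    using d0 by (metis mult_left_cancel)
  define c where "c = 29 + 54 * M + 47 * M ^ 2 + 24 * M ^ 3 + 7 * M ^ 4 + M ^ 5"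
  define a where "a = (- 7 - 8 * M - 4 * M ^ 2 - M ^ 3)
      + (- 25 - 43 * M - 31 * M ^ 2 - 12 * M ^ 3 - 2 * M ^ 4) * r
        + (7 + 2 * M - 3 * M ^ 2 - 3 * M ^ 3 - M ^ 4) * r ^ 2
        + (3 + 5 * M + 3 * M ^ 2 + M ^ 3) * r ^ 3"
  have ww: "w * w = a + c * w"
  proof -
    \<comment> \<open>As a polynomial in \<open>r\<close> the left side has degree 8; the cubic
      factor on the right is its quotient by \<open>h_poly m\<close>.\<close>
    have "(d * w) * (d * w) - d * (d * a) - d * (c * (d * w)) =
        (r ^ 5 + M ^ 2 * r ^ 4 - (2 * M ^ 3 + 6 * M ^ 2 + 10 * M + 10) * r ^ 3
          + (M ^ 4 + 5 * M ^ 3 + 11 * M ^ 2 + 15 * M + 5) * r ^ 2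
          + (M ^ 3 + 4 * M ^ 2 + 10 * M + 10) * r + 1)
        * ((- 59 - 163 * M - 189 * M ^ 2 - 121 * M ^ 3 - 46 * M ^ 4 - 10 * M ^ 5 - M ^ 6)
            + (24 + 42 * M + 27 * M ^ 2 + 8 * M ^ 3 + M ^ 4) * r + (- 8 - 6 * M - M ^ 2) * r ^ 2
              + r ^ 3)"
      unfolding dw unfolding d_def a_def c_def by Groebner_Basis.algebra
    also have "\<dots> = 0" unfolding h by simp
    finally have "d * (d * (w * w)) = d * (d * (a + c * w))" by (simp add: algebra_simps)
    then show ?thesis using d0 by (metis mult_left_cancel)
  qed
  have T1: "t * r = 1 + (4 + 2 * M) * r + (1 + M) * r ^ 2 + (- 4 - 3 * M - M ^ 2) * w"
  proof -
    have "t * r = r ^ 2 + r ^ 3 + r * w" unfolding T0 by Groebner_Basis.algebra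
    also have "\<dots> = 1 + (4 + 2 * M) * r + (1 + M) * r ^ 2 + (- 4 - 3 * M - M ^ 2) * w" unfolding rw
      by Groebner_Basis.algebra
    finally show ?thesis .
  qed
  have T2: "t * r ^ 2 = (- 4 - 3 * M - M ^ 2) + (- 15 - 20 * M - 10 * M ^ 2 - 2 * M ^ 3) * r
      + (4 - 2 * M - 3 * M ^ 2 - M ^ 3) * r ^ 2 + (5 + 4 * M + M ^ 2) * r ^ 3
        + (16 + 24 * M + 17 * M ^ 2 + 6 * M ^ 3 + M ^ 4) * w"
  proof -
    have "t * r ^ 2 = t * r * r" by Groebner_Basis.algebra
    also have "\<dots> = (1) * r + (4 + 2 * M) * r ^ 2 + (1 + M) * r ^ 3
        + (- 4 - 3 * M - M ^ 2) * (r * w)"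
      unfolding T1 by Groebner_Basis.algebra
    also have "\<dots> = (- 4 - 3 * M - M ^ 2) + (- 15 - 20 * M - 10 * M ^ 2 - 2 * M ^ 3) * r
        + (4 - 2 * M - 3 * M ^ 2 - M ^ 3) * r ^ 2 + (5 + 4 * M + M ^ 2) * r ^ 3
          + (16 + 24 * M + 17 * M ^ 2 + 6 * M ^ 3 + M ^ 4) * w" unfolding rw
          by Groebner_Basis.algebra
    finally show ?thesis .
  qed
  have T3: "t * r ^ 3 = (6 + 11 * M + 11 * M ^ 2 + 5 * M ^ 3 + M ^ 4)
      + (15 + 44 * M + 60 * M ^ 2 + 41 * M ^ 3 + 14 * M ^ 4 + 2 * M ^ 5) * r
        + (- 10 - 20 * M - 11 * M ^ 2 + 3 * M ^ 3 + 4 * M ^ 4 + M ^ 5) * r ^ 2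
        + (8 + 5 * M - 4 * M ^ 2 - 4 * M ^ 3 - M ^ 4) * r ^ 3
        + (- 29 - 66 * M - 84 * M ^ 2 - 64 * M ^ 3 - 30 * M ^ 4 - 8 * M ^ 5 - M ^ 6) * w"
  proof -
    have "t * r ^ 3 = t * r ^ 2 * r" by Groebner_Basis.algebra
    also have "\<dots> = (- 4 - 3 * M - M ^ 2) * r + (- 15 - 20 * M - 10 * M ^ 2 - 2 * M ^ 3) * r ^ 2
        + (4 - 2 * M - 3 * M ^ 2 - M ^ 3) * r ^ 3 + (5 + 4 * M + M ^ 2) * r ^ 4
          + (16 + 24 * M + 17 * M ^ 2 + 6 * M ^ 3 + M ^ 4) * (r * w)"
      unfolding T2 by Groebner_Basis.algebra
    also have "\<dots> = (6 + 11 * M + 11 * M ^ 2 + 5 * M ^ 3 + M ^ 4)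
        + (15 + 44 * M + 60 * M ^ 2 + 41 * M ^ 3 + 14 * M ^ 4 + 2 * M ^ 5) * r
          + (- 10 - 20 * M - 11 * M ^ 2 + 3 * M ^ 3 + 4 * M ^ 4 + M ^ 5) * r ^ 2
          + (8 + 5 * M - 4 * M ^ 2 - 4 * M ^ 3 - M ^ 4) * r ^ 3
          + (- 29 - 66 * M - 84 * M ^ 2 - 64 * M ^ 3 - 30 * M ^ 4 - 8 * M ^ 5 - M ^ 6) * w"
          unfolding rw r4 d_def by Groebner_Basis.algebra
    finally show ?thesis .
  qed
  have T4: "t * w = (- 8 - 10 * M - 5 * M ^ 2 - M ^ 3)
      + (- 27 - 52 * M - 39 * M ^ 2 - 14 * M ^ 3 - 2 * M ^ 4) * r
        + (10 + 5 * M - 4 * M ^ 2 - 4 * M ^ 3 - M ^ 4) * r ^ 2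
        + (2 + 6 * M + 4 * M ^ 2 + M ^ 3) * r ^ 3
        + (34 + 65 * M + 58 * M ^ 2 + 29 * M ^ 3 + 8 * M ^ 4 + M ^ 5) * w"
  proof -
    have "r * (r * w) = r * (1 + (2 * M + 4) * r + M * r ^ 2 - r ^ 3 - (M ^ 2 + 3 * M + 4) * w)"
      by (simp only: rw)
    also have "\<dots> = r + (2 * M + 4) * r ^ 2 + M * r ^ 3 - r ^ 4 - (M ^ 2 + 3 * M + 4) * (r * w)"
      by Groebner_Basis.algebra
    finally have rrw: "r * (r * w) = \<dots>" .
    have "t * w = r * w + r * (r * w) + w * w" unfolding T0 by Groebner_Basis.algebra
    also have "\<dots> = r * w + (r + (2 * M + 4) * r ^ 2 + M * r ^ 3 - r ^ 4
        - (M ^ 2 + 3 * M + 4) * (r * w)) + w * w" by (simp only: rrw)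
    also have "\<dots> = (- 8 - 10 * M - 5 * M ^ 2 - M ^ 3)
        + (- 27 - 52 * M - 39 * M ^ 2 - 14 * M ^ 3 - 2 * M ^ 4) * r
          + (10 + 5 * M - 4 * M ^ 2 - 4 * M ^ 3 - M ^ 4) * r ^ 2
          + (2 + 6 * M + 4 * M ^ 2 + M ^ 3) * r ^ 3
          + (34 + 65 * M + 58 * M ^ 2 + 29 * M ^ 3 + 8 * M ^ 4 + M ^ 5) * w"
      unfolding ww rw r4 a_def c_def d_def by Groebner_Basis.algebra
    finally show ?thesis .
  qed
  \<comment> \<open>Distributes \<open>t\<close> over the basis so that \<open>T1\<close> to
    \<open>T4\<close> can be rewritten. \<open>T0\<close> is unfolded only after them, since it
    would replace the \<open>t\<close> that these rules match.\<close>
  have lin: "t * (a0 + a1 * r + a2 * r ^ 2 + a3 * r ^ 3 + a4 * w) =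
      a0 * t + a1 * (t * r) + a2 * (t * r ^ 2) + a3 * (t * r ^ 3) + a4 * (t * w)" for a0 a1 a2 a3 a4
    by Groebner_Basis.algebra
  have b2: "t ^ 2 + (- 50 - 70 * M - 51 * M ^ 2 - 24 * M ^ 3 - 7 * M ^ 4 - M ^ 5) * t
      + (490 + 1135 * M + 1239 * M ^ 2 + 841 * M ^ 3 + 383 * M ^ 4 + 117 * M ^ 5 + 22 * M ^ 6
        + 2 * M ^ 7) =
      (479 + 1122 * M + 1233 * M ^ 2 + 840 * M ^ 3 + 383 * M ^ 4 + 117 * M ^ 5 + 22 * M ^ 6
          + 2 * M ^ 7) + (- 88 - 140 * M - 100 * M ^ 2 - 40 * M ^ 3 - 9 * M ^ 4 - M ^ 5) * r
            + (- 35 - 66 * M - 58 * M ^ 2 - 29 * M ^ 3 - 8 * M ^ 4 - M ^ 5) * r ^ 2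
            + (7 + 10 * M + 5 * M ^ 2 + M ^ 3) * r ^ 3
            + (- 4 + 16 * M + 23 * M ^ 2 + 11 * M ^ 3 + 2 * M ^ 4) * w"
  proof -
    have "t ^ 2 = t * (r + r ^ 2 + w)" by (simp only: T0 power2_eq_square)
    also have "\<dots> = t * r + t * r ^ 2 + t * w" by Groebner_Basis.algebra
    finally have "t ^ 2 = t * r + t * r ^ 2 + t * w" .
    then have "t ^ 2 + (- 50 - 70 * M - 51 * M ^ 2 - 24 * M ^ 3 - 7 * M ^ 4 - M ^ 5) * t
        + (490 + 1135 * M + 1239 * M ^ 2 + 841 * M ^ 3 + 383 * M ^ 4 + 117 * M ^ 5 + 22 * M ^ 6
          + 2 * M ^ 7) = t * r + t * r ^ 2 + t * w
          + (- 50 - 70 * M - 51 * M ^ 2 - 24 * M ^ 3 - 7 * M ^ 4 - M ^ 5) * t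
          + (490 + 1135 * M + 1239 * M ^ 2 + 841 * M ^ 3 + 383 * M ^ 4 + 117 * M ^ 5 + 22 * M ^ 6
          + 2 * M ^ 7)"
      by (simp only:)
    also have "\<dots> = (479 + 1122 * M + 1233 * M ^ 2 + 840 * M ^ 3 + 383 * M ^ 4 + 117 * M ^ 5
        + 22 * M ^ 6 + 2 * M ^ 7) + (- 88 - 140 * M - 100 * M ^ 2 - 40 * M ^ 3 - 9 * M ^ 4
          - M ^ 5) * r + (- 35 - 66 * M - 58 * M ^ 2 - 29 * M ^ 3 - 8 * M ^ 4 - M ^ 5) * r ^ 2
          + (7 + 10 * M + 5 * M ^ 2 + M ^ 3) * r ^ 3
          + (- 4 + 16 * M + 23 * M ^ 2 + 11 * M ^ 3 + 2 * M ^ 4) * w" unfolding T1 T2 T4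
          unfolding T0 by Groebner_Basis.algebra
    finally show ?thesis .
  qed
  have b3: "t ^ 3 + (- 50 - 70 * M - 51 * M ^ 2 - 24 * M ^ 3 - 7 * M ^ 4 - M ^ 5) * t ^ 2
      + (490 + 1135 * M + 1239 * M ^ 2 + 841 * M ^ 3 + 383 * M ^ 4 + 117 * M ^ 5 + 22 * M ^ 6
        + 2 * M ^ 7) * t + (- 1105 - 3730 * M - 5666 * M ^ 2 - 5265 * M ^ 3 - 3337 * M ^ 4
        - 1507 * M ^ 5 - 486 * M ^ 6 - 108 * M ^ 7 - 15 * M ^ 8 - M ^ 9) =
      (- 979 - 3452 * M - 5408 * M ^ 2 - 5137 * M ^ 3 - 3303 * M ^ 4 - 1503 * M ^ 5 - 486 * M ^ 6
          - 108 * M ^ 7 - 15 * M ^ 8 - M ^ 9)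
            + (865 + 2310 * M + 2731 * M ^ 2 + 1866 * M ^ 3 + 792 * M ^ 4 + 208 * M ^ 5
            + 31 * M ^ 6 + 2 * M ^ 7) * r
            + (141 + 600 * M + 997 * M ^ 2 + 911 * M ^ 3 + 506 * M ^ 4 + 173 * M ^ 5 + 34 * M ^ 6
            + 3 * M ^ 7) * r ^ 2 + (- 127 - 347 * M - 401 * M ^ 2 - 258 * M ^ 3 - 98 * M ^ 4
            - 21 * M ^ 5 - 2 * M ^ 6) * r ^ 3
            + (- 68 - 418 * M - 769 * M ^ 2 - 714 * M ^ 3 - 389 * M ^ 4 - 128 * M ^ 5 - 24 * M ^ 6
            - 2 * M ^ 7) * w" (is "?l = _")
  proof -
    have "?l = t * (t ^ 2 + (- 50 - 70 * M - 51 * M ^ 2 - 24 * M ^ 3 - 7 * M ^ 4 - M ^ 5) * t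
        + (490 + 1135 * M + 1239 * M ^ 2 + 841 * M ^ 3 + 383 * M ^ 4 + 117 * M ^ 5 + 22 * M ^ 6
          + 2 * M ^ 7)) + (- 1105 - 3730 * M - 5666 * M ^ 2 - 5265 * M ^ 3 - 3337 * M ^ 4
          - 1507 * M ^ 5 - 486 * M ^ 6 - 108 * M ^ 7 - 15 * M ^ 8 - M ^ 9)"
          by Groebner_Basis.algebra
    also have "\<dots> = (- 979 - 3452 * M - 5408 * M ^ 2 - 5137 * M ^ 3 - 3303 * M ^ 4 - 1503 * M ^ 5
        - 486 * M ^ 6 - 108 * M ^ 7 - 15 * M ^ 8 - M ^ 9)
          + (865 + 2310 * M + 2731 * M ^ 2 + 1866 * M ^ 3 + 792 * M ^ 4 + 208 * M ^ 5 + 31 * M ^ 6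
          + 2 * M ^ 7) * r + (141 + 600 * M + 997 * M ^ 2 + 911 * M ^ 3 + 506 * M ^ 4
          + 173 * M ^ 5 + 34 * M ^ 6 + 3 * M ^ 7) * r ^ 2
          + (- 127 - 347 * M - 401 * M ^ 2 - 258 * M ^ 3 - 98 * M ^ 4 - 21 * M ^ 5
          - 2 * M ^ 6) * r ^ 3 + (- 68 - 418 * M - 769 * M ^ 2 - 714 * M ^ 3 - 389 * M ^ 4
          - 128 * M ^ 5 - 24 * M ^ 6 - 2 * M ^ 7) * w"
      unfolding b2 lin T1 T2 T3 T4 unfolding T0 by Groebner_Basis.algebra
    finally show ?thesis .
  qed
  have b4: "t ^ 4 + (- 50 - 70 * M - 51 * M ^ 2 - 24 * M ^ 3 - 7 * M ^ 4 - M ^ 5) * t ^ 3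
      + (490 + 1135 * M + 1239 * M ^ 2 + 841 * M ^ 3 + 383 * M ^ 4 + 117 * M ^ 5 + 22 * M ^ 6
        + 2 * M ^ 7) * t ^ 2 + (- 1105 - 3730 * M - 5666 * M ^ 2 - 5265 * M ^ 3 - 3337 * M ^ 4
        - 1507 * M ^ 5 - 486 * M ^ 6 - 108 * M ^ 7 - 15 * M ^ 8 - M ^ 9) * t
        + (- 890 - 2190 * M - 2581 * M ^ 2 - 1892 * M ^ 3 - 950 * M ^ 4 - 337 * M ^ 5 - 83 * M ^ 6
        - 13 * M ^ 7 - M ^ 8) =
      (- 807 - 2158 * M - 2727 * M ^ 2 - 2112 * M ^ 3 - 1096 * M ^ 4 - 391 * M ^ 5 - 94 * M ^ 6
          - 14 * M ^ 7 - M ^ 8) + (297 - 273 * M - 1981 * M ^ 2 - 3119 * M ^ 3 - 2660 * M ^ 4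
            - 1434 * M ^ 5 - 509 * M ^ 6 - 117 * M ^ 7 - 16 * M ^ 8 - M ^ 9) * r
            + (1040 + 3331 * M + 4837 * M ^ 2 + 4164 * M ^ 3 + 2324 * M ^ 4 + 862 * M ^ 5
            + 208 * M ^ 6 + 30 * M ^ 7 + 2 * M ^ 8) * r ^ 2
            + (- 447 - 1091 * M - 1227 * M ^ 2 - 812 * M ^ 3 - 340 * M ^ 4 - 90 * M ^ 5
            - 14 * M ^ 6 - M ^ 7) * r ^ 3
            + (- 812 - 2490 * M - 3439 * M ^ 2 - 2807 * M ^ 3 - 1482 * M ^ 4 - 519 * M ^ 5
            - 118 * M ^ 6 - 16 * M ^ 7 - M ^ 8) * w" (is "?l = _")
  proof -
    have "?l = t * (t ^ 3 + (- 50 - 70 * M - 51 * M ^ 2 - 24 * M ^ 3 - 7 * M ^ 4 - M ^ 5) * t ^ 2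
        + (490 + 1135 * M + 1239 * M ^ 2 + 841 * M ^ 3 + 383 * M ^ 4 + 117 * M ^ 5 + 22 * M ^ 6
          + 2 * M ^ 7) * t + (- 1105 - 3730 * M - 5666 * M ^ 2 - 5265 * M ^ 3 - 3337 * M ^ 4
          - 1507 * M ^ 5 - 486 * M ^ 6 - 108 * M ^ 7 - 15 * M ^ 8 - M ^ 9))
          + (- 890 - 2190 * M - 2581 * M ^ 2 - 1892 * M ^ 3 - 950 * M ^ 4 - 337 * M ^ 5
          - 83 * M ^ 6 - 13 * M ^ 7 - M ^ 8)" by Groebner_Basis.algebra
    also have "\<dots> = (- 807 - 2158 * M - 2727 * M ^ 2 - 2112 * M ^ 3 - 1096 * M ^ 4 - 391 * M ^ 5
        - 94 * M ^ 6 - 14 * M ^ 7 - M ^ 8)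
          + (297 - 273 * M - 1981 * M ^ 2 - 3119 * M ^ 3 - 2660 * M ^ 4 - 1434 * M ^ 5
          - 509 * M ^ 6 - 117 * M ^ 7 - 16 * M ^ 8 - M ^ 9) * r
          + (1040 + 3331 * M + 4837 * M ^ 2 + 4164 * M ^ 3 + 2324 * M ^ 4 + 862 * M ^ 5
          + 208 * M ^ 6 + 30 * M ^ 7 + 2 * M ^ 8) * r ^ 2
          + (- 447 - 1091 * M - 1227 * M ^ 2 - 812 * M ^ 3 - 340 * M ^ 4 - 90 * M ^ 5 - 14 * M ^ 6
          - M ^ 7) * r ^ 3 + (- 812 - 2490 * M - 3439 * M ^ 2 - 2807 * M ^ 3 - 1482 * M ^ 4
          - 519 * M ^ 5 - 118 * M ^ 6 - 16 * M ^ 7 - M ^ 8) * w"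
      unfolding b3 lin T1 T2 T3 T4 unfolding T0 by Groebner_Basis.algebra
    finally show ?thesis .
  qed
  have "ev (alt_poly m) t = t * (t ^ 4 + (- 50 - 70 * M - 51 * M ^ 2 - 24 * M ^ 3 - 7 * M ^ 4
      - M ^ 5) * t ^ 3 + (490 + 1135 * M + 1239 * M ^ 2 + 841 * M ^ 3 + 383 * M ^ 4 + 117 * M ^ 5
        + 22 * M ^ 6 + 2 * M ^ 7) * t ^ 2
        + (- 1105 - 3730 * M - 5666 * M ^ 2 - 5265 * M ^ 3 - 3337 * M ^ 4 - 1507 * M ^ 5
        - 486 * M ^ 6 - 108 * M ^ 7 - 15 * M ^ 8 - M ^ 9) * t
        + (- 890 - 2190 * M - 2581 * M ^ 2 - 1892 * M ^ 3 - 950 * M ^ 4 - 337 * M ^ 5 - 83 * M ^ 6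
        - 13 * M ^ 7 - M ^ 8)) + (49 + 140 * M + 170 * M ^ 2 + 114 * M ^ 3 + 45 * M ^ 4
        + 10 * M ^ 5 + M ^ 6)"
    by (simp add: alt_poly_def M_def eval_nat_numeral algebra_simps)
  also have "\<dots> = 0"
    unfolding b4 lin T1 T2 T3 T4 unfolding T0 by Groebner_Basis.algebra
  finally show ?thesis by (simp add: t_def)
qed

text \<open>This is \<open>5 ^ 5\<close> times \<open>h_poly m\<close> at
  \<open>(X - m ^ 2) / 5\<close>; the shift removes the term of degree 4. Modulo a prime q \<noteq>
  5 dividing the conductor, \<open>h_poly m\<close> is a fifth power, and the shift moves its
  fivefold root to 0.\<close>

definition scaled_poly :: "int \<Rightarrow> int poly" where
  "scaled_poly m =
    [: lehmer_conductor m * (125 - 125 * m - 200 * m ^ 2 + 65 * m ^ 4 + 30 * m ^ 5 + 4 * m ^ 6),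
       lehmer_conductor m * (250 - 100 * m ^ 2 - 75 * m ^ 3 - 15 * m ^ 4),
       lehmer_conductor m * (25 + 50 * m + 20 * m ^ 2),
       - (10 * lehmer_conductor m), 0, 1 :]"

lemmas of_int_simps = of_int_add of_int_diff of_int_minus of_int_mult of_int_power of_int_numeral
  of_int_1 of_int_0

lemma scaled_poly_root:
  "ev (h_poly m) r = 0 \<Longrightarrow> ev (scaled_poly m) (5 * r + of_int m ^ 2) = 0"
proof -
  assume root: "ev (h_poly m) r = 0"
  define M where "M = complex_of_int m"
  have "ev (scaled_poly m) (5 * r + M ^ 2) - 3125 * ev (h_poly m) r = 0"
    unfolding scaled_poly_def h_poly_def lehmer_conductor_def
    by (simp only: ev_pCons ev_0 of_int_simps M_def[symmetric]) Groebner_Basis.algebra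
  then show ?thesis by (simp add: root M_def)
qed

text \<open>This is \<open>h_poly m\<close> at \<open>X - 1\<close>: if 5 divides \<open>m\<close>,
  then \<open>h_poly m\<close> is \<open>(X + 1) ^ 5\<close> modulo 5.\<close>

definition shifted_poly :: "int \<Rightarrow> int poly" where
  "shifted_poly m =
    [: 5 + 15 * m + 14 * m ^ 2 + 6 * m ^ 3 + m ^ 4,
       - 25 - 50 * m - 40 * m ^ 2 - 15 * m ^ 3 - 2 * m ^ 4,
       25 + 45 * m + 35 * m ^ 2 + 11 * m ^ 3 + m ^ 4,
       - 10 * m - 10 * m ^ 2 - 2 * m ^ 3,
       - 5 + m ^ 2,
       1 :]"

lemma shifted_poly_root: "ev (h_poly m) r = 0 \<Longrightarrow> ev (shifted_poly m) (r + 1) = 0"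
proof -
  assume root: "ev (h_poly m) r = 0"
  define M where "M = complex_of_int m"
  have "ev (shifted_poly m) (r + 1) - ev (h_poly m) r = 0"
    unfolding shifted_poly_def h_poly_def
    by (simp only: ev_pCons ev_0 of_int_simps M_def[symmetric]) Groebner_Basis.algebra
  then show ?thesis by (simp add: root)
qed

lemma shifted_poly_Eisenstein:
  assumes "5 dvd m"
  shows "[:5:] dvd shifted_poly m - monom 1 5" "\<not> 5 ^ 2 dvd coeff (shifted_poly m) 0"
proof -
  obtain k where k: "m = 5 * k" using assms ..
  have "shifted_poly m - monom 1 5 = [:5:] *
    [: 1 + 15 * k + 70 * k ^ 2 + 150 * k ^ 3 + 125 * k ^ 4,
       - 5 - 50 * k - 200 * k ^ 2 - 375 * k ^ 3 - 250 * k ^ 4,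
       5 + 45 * k + 175 * k ^ 2 + 275 * k ^ 3 + 125 * k ^ 4,
       - 10 * k - 50 * k ^ 2 - 50 * k ^ 3, - 1 + 5 * k ^ 2 :]"
    by (simp add: shifted_poly_def k monom_altdef eval_nat_numeral)
  then show "[:5:] dvd shifted_poly m - monom 1 5" by (metis dvd_triv_left)
  define x where "x = 3 * k + 14 * k ^ 2 + 30 * k ^ 3 + 25 * k ^ 4"
  have "coeff (shifted_poly m) 0 = 5 + 25 * x"
    by (simp add: shifted_poly_def k x_def eval_nat_numeral)
  then show "\<not> 5 ^ 2 dvd coeff (shifted_poly m) 0" by (simp add: dvd_add_left_iff)
qed

lemma scaled_poly_Eisenstein:
  assumes q: "prime q" "q \<noteq> 5" "q dvd lehmer_conductor m" "\<not> q ^ 2 dvd lehmer_conductor m"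
  shows "[:q:] dvd scaled_poly m - monom 1 5" "\<not> q ^ 2 dvd coeff (scaled_poly m) 0"
proof -
  define D where "D = lehmer_conductor m"
  define e where "e = 125 - 125 * m - 200 * m ^ 2 + 65 * m ^ 4 + 30 * m ^ 5 + 4 * m ^ 6"
  obtain k where k: "D = q * k" using q(3) unfolding D_def ..
  have "scaled_poly m - monom 1 5 = [:q:] * [: k * e, k * (250 - 100 * m ^ 2 - 75 * m ^ 3
      - 15 * m ^ 4), k * (25 + 50 * m + 20 * m ^ 2), - (10 * k) :]"
    unfolding scaled_poly_def D_def[symmetric] e_def k by (simp add: monom_altdef eval_nat_numeral)
  then show "[:q:] dvd scaled_poly m - monom 1 5" by (metis dvd_triv_left)
  \<comment> \<open>Eliminating \<open>m\<close> from \<open>e\<close> and \<open>D\<close> leaves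
    \<open>3125 = 5 ^ 5\<close>, so 5 is the only prime that can divide both.\<close>
  have "(- 15 - 20 * m - 7 * m ^ 2 - 3 * m ^ 3) * e
      + (200 - 175 * m - 130 * m ^ 2 + 15 * m ^ 3 + 58 * m ^ 4 + 12 * m ^ 5) * D = 3125"
    unfolding e_def D_def lehmer_conductor_def by (simp add: eval_nat_numeral algebra_simps)
  then have "q dvd 3125" if "q dvd e"
    using that q(3) unfolding D_def[symmetric] by (metis dvd_add dvd_mult)
  moreover have "\<not> q dvd 5 ^ 5"
  proof
    assume "q dvd 5 ^ 5"
    then have "q dvd 5" using q(1) by (rule prime_dvd_power[rotated])
    then show False using primes_dvd_imp_eq[of q 5] q(1,2) by simp
  qed
  then have "\<not> q dvd 3125" by simp
  ultimately have "\<not> q dvd e" by blast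
  then have "coprime (q ^ 2) e" using q(1) by (simp add: prime_imp_coprime)
  then have "\<not> q ^ 2 dvd D * e" using q(4) by (simp add: coprime_dvd_mult_left_iff D_def)
  then show "\<not> q ^ 2 dvd coeff (scaled_poly m) 0" by (simp add: scaled_poly_def D_def e_def)
qed

context power_basis
begin

lemma power_basis_if_primitive:
  assumes "y \<in> primitive_integers K" "lead_coeff G = 1" "degree G = n" "ev G y = 0"
  shows "power_basis y G"
  using assms primitive_integersD[OF assms(1)] minimal_if_primitive
  by unfold_locales auto

text \<open>Both fields have dimension \<open>n\<close>: if \<open>\<theta>\<close> were outside
  \<open>Q_adjoin y\<close>, then \<open>\<theta>\<close> and the powers of \<open>y\<close> would
  be n + 1 independent elements of \<open>K\<close>.\<close>

lemma Q_adjoin_eq_if_power_basis: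
  assumes y: "y \<in> K" and G: "power_basis y G" "degree G = n"
  shows "Q_adjoin y = K"
proof
  interpret y: power_basis y G by (rule G(1))
  show "Q_adjoin y \<subseteq> K" by (rule Q_adjoin_subset[OF y])
  let ?S = "(\<lambda>i. y ^ i) ` {..<degree G}"
  have S: "card ?S = n" "rat_vs.independent ?S" "rat_vs.span ?S = Q_adjoin y" "finite ?S"
    using y.card_powers y.independent_powers y.span_powers G(2) by simp_all
  have "\<theta> \<in> Q_adjoin y"
  proof (rule ccontr)
    assume "\<theta> \<notin> Q_adjoin y"
    then have \<theta>: "\<theta> \<notin> rat_vs.span ?S" using S(3) by simp
    then have "\<theta> \<notin> ?S" using rat_vs.span_superset[of ?S] by (rule contra_subsetD[rotated])
    have "rat_vs.independent (insert \<theta> ?S)" using \<theta> S(2) rat_vs.independent_insert by metis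
    moreover have "insert \<theta> ?S \<subseteq> rat_vs.span ((\<lambda>i. \<theta> ^ i) ` {..<n})"
      unfolding span_powers using y Q_adjoin_base Q_adjoin_power by blast
    ultimately have "card (insert \<theta> ?S) \<le> card ((\<lambda>i. \<theta> ^ i) ` {..<n})"
      using rat_vs.independent_span_bound by blast
    then show False using \<open>\<theta> \<notin> ?S\<close> S(1,4) card_powers by simp
  qed
  then show "K \<subseteq> Q_adjoin y" by (rule Q_adjoin_subset)
qed

lemma primitive_integersI:
  "y \<in> K \<Longrightarrow> algebraic_int y \<Longrightarrow> Q_adjoin y = K \<Longrightarrow> y \<in> primitive_integers K"
  by (simp add: primitive_integers_def ring_of_integers_def)

lemma primitive_integers_affine:
  assumes "a \<noteq> 0" shows "of_int a * \<theta> + of_int b \<in> primitive_integers K"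
proof (rule primitive_integersI)
  let ?y = "of_int a * \<theta> + of_int b"
  show y: "?y \<in> K" by (intro Q_adjoin_add Q_adjoin_mult Q_adjoin_of_int Q_adjoin_base)
  show "algebraic_int ?y" by (intro algebraic_int_intros integral)
  have "\<theta> = (?y - of_int b) / of_int a" using assms by simp
  also have "\<dots> \<in> Q_adjoin ?y" by (intro Q_adjoin_divide Q_adjoin_diff Q_adjoin_of_int Q_adjoin_base)
  finally show "Q_adjoin ?y = K" using Q_adjoin_subset y by blast
qed

end

lemma Gcd_nat_eq_1_if_primes:
  fixes S :: "nat set"
  assumes "\<And>q. prime q \<Longrightarrow> \<exists>x\<in>S. \<not> q dvd x" shows "Gcd S = 1"
proof (rule ccontr)
  assume "Gcd S \<noteq> 1"
  then obtain q where q: "prime q" "q dvd Gcd S" using prime_factor_nat by blast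
  then show False using assms[OF q(1)] Gcd_dvd dvd_trans by blast
qed

section \<open>Index and value divisor of the quintic field\<close>

locale lehmer_quintic =
  fixes m :: int and \<rho> :: complex
  assumes lehmer_root: "ev (h_poly m) \<rho> = 0"

text \<open>Irreducibility modulo 2 holds for every \<open>m\<close>, so each root of
  \<open>h_poly m\<close> has degree 5.\<close>

sublocale lehmer_quintic \<subseteq> power_basis \<rho> "h_poly m"
  by (rule power_basis_if_irreducible_mod[OF _ irreducible_mod_2_h_poly lehmer_root]) simp

context lehmer_quintic
begin

lemma n_eq_5: "n = 5"
  by (rule h_poly_monic)

lemma alt_power_basis: "power_basis (alt_elem m \<rho>) (alt_poly m)"
  by (rule power_basis_if_irreducible_mod[OF _ irreducible_mod_2_alt_poly alt_poly_root[OF lehmer_root]])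
    simp

lemma alt_primitive: "alt_elem m \<rho> \<in> primitive_integers K"
proof (rule primitive_integersI)
  show y: "alt_elem m \<rho> \<in> K"
    unfolding alt_elem_def
    by (intro Q_adjoin_add Q_adjoin_diff Q_adjoin_divide Q_adjoin_mult Q_adjoin_of_int Q_adjoin_power
        Q_adjoin_base)
  show "algebraic_int (alt_elem m \<rho>)"
    using algebraic_int_if_ev[OF alt_poly_monic(1) alt_poly_root[OF lehmer_root]] .
  show "Q_adjoin (alt_elem m \<rho>) = K"
    by (rule Q_adjoin_eq_if_power_basis[OF y alt_power_basis])
      (simp add: h_poly_monic alt_poly_monic)
qed

lemma exists_index_not_dvd:
  assumes sqf: "\<And>p :: nat. prime p \<Longrightarrow> p \<noteq> 5 \<Longrightarrow> \<not> (int p) ^ 2 dvd lehmer_conductor m"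
    and q: "prime q"
  shows "\<exists>y\<in>primitive_integers K. \<not> q dvd elem_index K y"
proof -
  have iq: "prime (int q)" using q by simp
  have concl: ?thesis
    if y: "y \<in> primitive_integers K" and pb: "power_basis y G"
      and tor: "\<And>x. algebraic_int x \<Longrightarrow> of_int (int q) * x \<in> Z_adjoin y \<Longrightarrow> x \<in> Z_adjoin y" for y G
    using power_basis.prime_not_dvd_elem_index[OF pb q tor] primitive_integersD(3)[OF y] y by auto
  show ?thesis
  proof (cases "int q dvd lehmer_index m")
    case True
    then obtain e where e: "lehmer_index m = int q * e" ..
    obtain U V W where "U * alt_poly m + V * pderiv (alt_poly m) = [:1:] + [:lehmer_index m:] * W"
      using alt_poly_bezout by blast
    then have "U * alt_poly m + V * pderiv (alt_poly m) = [:1:] + [:int q:] * ([:e:] * W)"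
      by (simp add: e mult.commute)
    moreover have "\<not> int q dvd 1" using iq by auto
    ultimately show ?thesis
      using concl[OF alt_primitive alt_power_basis]
        power_basis.no_torsion_squarefree[OF alt_power_basis iq] by blast
  next
    case index: False
    show ?thesis
    proof (cases "int q dvd lehmer_conductor m")
      case False
      obtain U V where "U * h_poly m + V * pderiv (h_poly m) =
          [:lehmer_index m ^ 2 * lehmer_conductor m:]"
        using h_poly_bezout by blast
      then have "U * h_poly m + V * pderiv (h_poly m)
          = [:lehmer_index m ^ 2 * lehmer_conductor m:] + [:int q:] * 0" by simp
      moreover have "\<not> int q dvd lehmer_index m ^ 2 * lehmer_conductor m"
        using False index iq by (simp add: prime_dvd_mult_iff prime_dvd_power_iff)
      moreover have "\<rho> \<in> primitive_integers K" using primitive_integers_affine[of 1 0] by simp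
      ultimately show ?thesis
        using concl[OF _ power_basis_axioms] no_torsion_squarefree[OF iq] by blast
    next
      case D: True
      show ?thesis
      proof (cases "q = 5")
        case True
        have "5 dvd lehmer_conductor m" using D True by simp
        \<comment> \<open>The remaining coefficients are multiples of 5, so 5 divides
          \<open>m\<close>. The conductor is then divisible by 25, out of reach of
          \<open>scaled_poly_Eisenstein\<close>, whereas the constant coefficient of
          \<open>shifted_poly m\<close> is 5 modulo 25.\<close>
        then have "5 dvd m ^ 4" unfolding lehmer_conductor_def by presburger
        then have "5 dvd m" using prime_dvd_power[of 5 m 4] by simp
        note eis = shifted_poly_Eisenstein[OF this]
        have prim: "\<rho> + 1 \<in> primitive_integers K" using primitive_integers_affine[of 1 1] by simp
        have pb: "power_basis (\<rho> + 1) (shifted_poly m)"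
          by (rule power_basis_if_primitive[OF prim _ _ shifted_poly_root[OF lehmer_root]])
            (simp_all add: shifted_poly_def h_poly_monic)
        have "degree (shifted_poly m) = 5" by (simp add: shifted_poly_def)
        then show ?thesis
          using concl[OF prim pb] power_basis.no_torsion_Eisenstein[OF pb iq] eis True by simp
      next
        case False
        have q5: "int q \<noteq> 5" using False by simp
        note eis = scaled_poly_Eisenstein[OF iq q5 D sqf[OF q False]]
        have prim: "5 * \<rho> + of_int m ^ 2 \<in> primitive_integers K"
          using primitive_integers_affine[of 5 "m ^ 2"] by simp
        have pb: "power_basis (5 * \<rho> + of_int m ^ 2) (scaled_poly m)"
          by (rule power_basis_if_primitive[OF prim _ _ scaled_poly_root[OF lehmer_root]])
            (simp_all add: scaled_poly_def h_poly_monic)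
        have "degree (scaled_poly m) = 5" by (simp add: scaled_poly_def)
        then show ?thesis
          using concl[OF prim pb] power_basis.no_torsion_Eisenstein[OF pb iq] eis by simp
      qed
    qed
  qed
qed

lemma value_gcd_dvd_5:
  assumes y: "y \<in> primitive_integers K" shows "elem_value_gcd K y dvd 5"
proof -
  let ?c = "elem_value_gcd K y"
  have "?c dvd 120"
    unfolding elem_value_gcd_def
    using field_char_poly_props(2,3)[OF y] n_eq_5
    by (intro quintic_value_gcd_dvd) (auto simp: power_basis_def)
  moreover have "\<not> 2 dvd ?c" "\<not> 3 dvd ?c"
    using inert_not_dvd_value_gcd[OF _ irreducible_mod_2_h_poly y]
      inert_not_dvd_value_gcd[OF _ irreducible_mod_3_h_poly y] by simp_all
  then have "coprime ?c 2" "coprime ?c 3"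
    using prime_imp_coprime[of 2 ?c] prime_imp_coprime[of 3 ?c] by (simp_all add: coprime_commute)
  then have "coprime ?c (2 ^ 3 * 3)"
    by (simp only: coprime_mult_right_iff coprime_power_right_iff simp_thms)
  ultimately show ?thesis using coprime_dvd_mult_right_iff[of ?c "2 ^ 3 * 3" 5] by simp
qed

lemma five_not_dvd_value_gcd:
  assumes y: "y \<in> primitive_integers K" and m: "\<not> [m = 2] (mod 5)"
  shows "\<not> 5 dvd elem_value_gcd K y"
proof (cases "[m = 0] (mod 5)")
  case True
  then have "5 dvd m" by (simp add: cong_0_iff)
  note eis = shifted_poly_Eisenstein[OF this]
  have prim: "\<rho> + 1 \<in> primitive_integers K" using primitive_integers_affine[of 1 1] by simp
  have pb: "power_basis (\<rho> + 1) (shifted_poly m)"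
    by (rule power_basis_if_primitive[OF prim _ _ shifted_poly_root[OF lehmer_root]])
      (simp_all add: shifted_poly_def h_poly_monic)
  have "degree (shifted_poly m) = 5" by (simp add: shifted_poly_def)
  then show ?thesis
    using power_basis.five_not_dvd_value_gcd_Eisenstein[OF pb] eis primitive_integersD(3)[OF prim] y
    by simp
next
  case False
  show ?thesis by (rule inert_not_dvd_value_gcd[OF _ irreducible_mod_5_h_poly[OF False m] y]) simp
qed

lemma five_dvd_value_gcd_alt:
  assumes "[m = 2] (mod 5)" shows "5 dvd elem_value_gcd K (alt_elem m \<rho>)"
proof -
  have "field_char_poly K (alt_elem m \<rho>) = alt_poly m"
    by (rule field_char_poly_unique[OF alt_primitive alt_poly_monic(1) _ alt_poly_root[OF lehmer_root]])
      (simp add: alt_poly_monic(2) h_poly_monic(2))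
  then show ?thesis
    unfolding elem_value_gcd_def by (intro Gcd_greatest) (auto intro: five_dvd_alt_poly[OF assms])
qed

lemma field_value_lcm_eq: "field_value_lcm K = (if [m = 2] (mod 5) then 5 else 1)"
proof (cases "[m = 2] (mod 5)")
  case True
  have "field_value_lcm K dvd 5"
    unfolding field_value_lcm_def by (intro Lcm_least) (auto intro: value_gcd_dvd_5)
  moreover have "5 dvd field_value_lcm K"
    unfolding field_value_lcm_def
    using dvd_trans[OF five_dvd_value_gcd_alt[OF True] dvd_Lcm] alt_primitive by blast
  moreover have "0 \<le> field_value_lcm K" unfolding field_value_lcm_def by simp
  ultimately have "field_value_lcm K = 5" by (intro zdvd_antisym_nonneg) auto
  then show ?thesis using True by simp
next
  case False
  have "elem_value_gcd K y dvd 1" if y: "y \<in> primitive_integers K" for y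
  proof -
    have "coprime (elem_value_gcd K y) 5"
      using five_not_dvd_value_gcd[OF y False] prime_imp_coprime[of 5 "elem_value_gcd K y"]
      by (simp add: coprime_commute)
    then show ?thesis using value_gcd_dvd_5[OF y] by (metis coprime_common_divisor dvd_refl)
  qed
  then have "field_value_lcm K dvd 1"
    unfolding field_value_lcm_def by (intro Lcm_least) auto
  moreover have "0 \<le> field_value_lcm K" unfolding field_value_lcm_def by simp
  ultimately have "field_value_lcm K = 1" by (intro zdvd_antisym_nonneg) auto
  then show ?thesis using False by simp
qed

end

theorem theorem1p5:
  fixes m :: int and \<rho> :: complex
  assumes "\<And>p :: nat. prime p \<Longrightarrow> p \<noteq> 5 \<Longrightarrow>
             \<not> (int p) ^ 2 dvd m ^ 4 + 5 * m ^ 3 + 15 * m ^ 2 + 25 * m + 25"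
    and "poly (map_poly of_int (h_poly m)) \<rho> = 0"
  shows "field_index (Q_adjoin \<rho>) = 1 \<and>
         field_value_lcm (Q_adjoin \<rho>) = (if [m = 2] (mod 5) then 5 else 1)"
proof
  interpret lehmer_quintic m \<rho>
    using assms(2) by unfold_locales (simp add: ev_def)
  show "field_index (Q_adjoin \<rho>) = 1"
    unfolding field_index_def
    using exists_index_not_dvd assms(1) unfolding lehmer_conductor_def
    by (intro Gcd_nat_eq_1_if_primes) blast
  show "field_value_lcm (Q_adjoin \<rho>) = (if [m = 2] (mod 5) then 5 else 1)"
    by (rule field_value_lcm_eq)
qed

end
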